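(* For the Lorentz mirror model on the cylinders $\mathcal C_n$ and every fixed $p\in(0,1)$, there are constants $C=C(p)<\infty$ and $n_*=n_*(p)<\infty$ such that, for all integers $n\ge n_*$ and all $M\ge Cn^{10}$, $$\mathbb P_p^{\mathrm L}\bigl(B_n^{(M)}\bigr)\ge 1-C\exp\left\{-\frac{M}{Cn^{10}}\right\}.$$
   Context: Cylinder: for an integer $n\ge1$, $\mathcal C_n=\mathbb Z\times(\mathbb Z/2n\mathbb Z)$ (quotient of $\mathbb Z^2$ by translation by $(0,2n)$; its edges are the images of the nearest-neighbor edges of $\mathbb Z^2$). Mirrors and trajectories: each vertex has four incident half-edges $N,E,S,W$ (pointing in directions $(0,1),(1,0),(0,-1),(-1,0)$). A one-site state is one of: no mirror, pairing $(N,S)(E,W)$; a north-west (NW) mirror (a diagonal segment along the NW--SE direction), pairing $(N,E)(S,W)$; a north-east (NE) mirror (along the NE--SW direction), pairing $(N,W)(S,E)$. A ray arriving at a vertex along a half-edge leaves along the half-edge paired with it. A directed edge is an ordered pair $(u,v)$ of nearest neighbors along an edge; together with the environment (a state at each vertex) it determines a trajectory, i.e. the sequence of directed edges starting with $(u,v)$ and following this rule at each vertex; $u$ is its initial vertex. A trajectory remains in a set if all its vertices lie in it. Lorentz mirror law $\mathbb P_p^{\mathrm L}$: independently at each vertex, no mirror with probability $1-p$, and a NW or NE mirror with probability $p/2$ each. Localization event: for $M\ge1$, $B_n^{(M)}$ is the event that every trajectory whose initial vertex lies in $\{0\}\times(\mathbb Z/2n\mathbb Z)$ remains in $[-M,M]\times(\mathbb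 Z/2n\mathbb Z)$. *)

theory Defs
  imports "HOL-Probability.Probability"
begin

text \<open>Vertices of the cylinder \<open>\<int> \<times> (\<int>/2n\<int>)\<close>; the class of \<open>y\<close> modulo \<open>2n\<close> is
  encoded by its representative in \<open>{0..<2n}\<close>.\<close>

type_synonym vertex = "int \<times> int"

definition cylinder :: "nat \<Rightarrow> vertex set" where
  "cylinder n = UNIV \<times> {0..<2 * int n}"

datatype direction = North | East | South | West

fun opposite :: "direction \<Rightarrow> direction" where
  "opposite North = South"
| "opposite East = West"
| "opposite South = North"
| "opposite West = East"

fun neighbour :: "nat \<Rightarrow> vertex \<Rightarrow> direction \<Rightarrow> vertex" where
  "neighbour n (x, y) North = (x, (y + 1) mod (2 * int n))"
| "neighbour n (x, y) East = (x + 1, y)"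
| "neighbour n (x, y) South = (x, (y - 1) mod (2 * int n))"
| "neighbour n (x, y) West = (x - 1, y)"

text \<open>\<open>NW_Mirror\<close> lies along the NW--SE diagonal, \<open>NE_Mirror\<close> along the NE--SW diagonal.\<close>

datatype site = No_Mirror | NW_Mirror | NE_Mirror

text \<open>The pairing of the four half-edges at a vertex, as a fixed-point-free involution.\<close>

fun paired :: "site \<Rightarrow> direction \<Rightarrow> direction" where
  "paired No_Mirror d = opposite d"
| "paired NW_Mirror North = East"
| "paired NW_Mirror East = North"
| "paired NW_Mirror South = West"
| "paired NW_Mirror West = South"
| "paired NE_Mirror North = West"
| "paired NE_Mirror West = North"
| "paired NE_Mirror South = East"
| "paired NE_Mirror East = South"

text \<open>A directed edge is given by its initial vertex and the half-edge along which it leaves it,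
  not by its two endpoints: for \<open>n = 1\<close> the vertices \<open>(x, 0)\<close> and \<open>(x, 1)\<close> are joined by two
  different edges.\<close>

type_synonym directed_edge = "vertex \<times> direction"

fun initial_vertex :: "directed_edge \<Rightarrow> vertex" where
  "initial_vertex (u, d) = u"

fun final_vertex :: "nat \<Rightarrow> directed_edge \<Rightarrow> vertex" where
  "final_vertex n (u, d) = neighbour n u d"

text \<open>A ray that leaves \<open>u\<close> in direction \<open>d\<close> arrives at the next vertex along the half-edge
  \<open>opposite d\<close> of that vertex.\<close>

fun next_edge :: "nat \<Rightarrow> (vertex \<Rightarrow> site) \<Rightarrow> directed_edge \<Rightarrow> directed_edge" where
  "next_edge n \<omega> (u, d) = (neighbour n u d, paired (\<omega> (neighbour n u d)) (opposite d))"

definition trajectory :: "nat \<Rightarrow> (vertex \<Rightarrow> site) \<Rightarrow> directed_edge \<Rightarrow> nat \<Rightarrow> directed_edge" where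
  "trajectory n \<omega> e k = (next_edge n \<omega> ^^ k) e"

definition remains_in :: "nat \<Rightarrow> (vertex \<Rightarrow> site) \<Rightarrow> directed_edge \<Rightarrow> vertex set \<Rightarrow> bool" where
  "remains_in n \<omega> e A \<longleftrightarrow>
     (\<forall>k. initial_vertex (trajectory n \<omega> e k) \<in> A \<and> final_vertex n (trajectory n \<omega> e k) \<in> A)"

definition site_law :: "real \<Rightarrow> site pmf" where
  "site_law p = bind_pmf (bernoulli_pmf p)
     (\<lambda>mirror. if mirror then pmf_of_set {NW_Mirror, NE_Mirror} else return_pmf No_Mirror)"

lemma pmf_site_law:
  assumes "0 \<le> p" "p \<le> 1"
  shows "pmf (site_law p) No_Mirror = 1 - p"
    and "pmf (site_law p) NW_Mirror = p / 2"
    and "pmf (site_law p) NE_Mirror = p / 2"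
  using assms by (simp_all add: site_law_def pmf_bind)

text \<open>Environments are total functions; on the probability space below they are \<open>undefined\<close>
  outside \<^term>\<open>cylinder n\<close>, where trajectories never look at them.\<close>

definition lorentz_law :: "real \<Rightarrow> nat \<Rightarrow> (vertex \<Rightarrow> site) measure" where
  "lorentz_law p n = (\<Pi>\<^sub>M v\<in>cylinder n. measure_pmf (site_law p))"

definition localization_event :: "real \<Rightarrow> nat \<Rightarrow> real \<Rightarrow> (vertex \<Rightarrow> site) set" where
  "localization_event p n M = {\<omega> \<in> space (lorentz_law p n).
     \<forall>e. initial_vertex e \<in> {0} \<times> {0..<2 * int n} \<longrightarrow>
       remains_in n \<omega> e {(x, y) \<in> cylinder n. - M \<le> real_of_int x \<and> real_of_int x \<le> M}}"

lemma prob_space_lorentz_law: "prob_space (lorentz_law p n)"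
  unfolding lorentz_law_def by (intro prob_space_PiM measure_pmf.prob_space_axioms)

instance direction :: countable
  by countable_datatype

lemma neighbour_in_cylinder: "u \<in> cylinder n \<Longrightarrow> neighbour n u d \<in> cylinder n"
  by (cases u; cases d) (auto simp: cylinder_def)

lemma trajectory_in_cylinder:
  "fst e \<in> cylinder n \<Longrightarrow> fst (trajectory n \<omega> e k) \<in> cylinder n"
proof (induction k)
  case (Suc k)
  then show ?case
    by (cases "trajectory n \<omega> e k") (auto simp: trajectory_def neighbour_in_cylinder)
qed (simp add: trajectory_def)

lemma measurable_trajectory:
  assumes "fst e \<in> cylinder n"
  shows "(\<lambda>\<omega>. trajectory n \<omega> e k) \<in> lorentz_law p n \<rightarrow>\<^sub>M count_space UNIV"
proof (induction k)
  case (Suc k)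
  have site: "(\<lambda>\<omega>. \<omega> v) \<in> lorentz_law p n \<rightarrow>\<^sub>M count_space UNIV" if "v \<in> cylinder n" for v
    using measurable_component_singleton[OF that, of "\<lambda>_. measure_pmf (site_law p)"]
    unfolding lorentz_law_def by simp
  define g where "g f \<omega> = (if fst f \<in> cylinder n then next_edge n \<omega> f else f)" for f \<omega>
  have g: "g f \<in> lorentz_law p n \<rightarrow>\<^sub>M count_space UNIV" for f
  proof (cases "fst f \<in> cylinder n")
    case True
    obtain u d where f: "f = (u, d)" by (rule prod.exhaust)
    have "(\<lambda>\<omega>. (\<lambda>s. (neighbour n u d, paired s (opposite d))) (\<omega> (neighbour n u d)))
        \<in> lorentz_law p n \<rightarrow>\<^sub>M count_space UNIV"
      by (rule measurable_compose[OF site]) (use True f neighbour_in_cylinder in auto)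
    then show ?thesis using True f by (simp add: g_def[abs_def])
  qed (simp add: g_def[abs_def])
  have "(\<lambda>\<omega>. g (trajectory n \<omega> e k) \<omega>) \<in> lorentz_law p n \<rightarrow>\<^sub>M count_space UNIV"
    using g Suc by (rule measurable_compose_countable)
  moreover have "g (trajectory n \<omega> e k) \<omega> = trajectory n \<omega> e (Suc k)" for \<omega>
    using trajectory_in_cylinder[OF assms] by (simp add: g_def trajectory_def)
  ultimately show ?case by simp
qed (simp add: trajectory_def)

lemma localization_event_measurable: "localization_event p n M \<in> sets (lorentz_law p n)"
proof -
  let ?A = "{(x, y) \<in> cylinder n. - M \<le> real_of_int x \<and> real_of_int x \<le> M}"
  let ?Q = "\<lambda>f. initial_vertex f \<in> ?A \<and> final_vertex n f \<in> ?A"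
  have "{\<omega> \<in> space (lorentz_law p n). remains_in n \<omega> e ?A} \<in> sets (lorentz_law p n)"
    if "initial_vertex e \<in> {0} \<times> {0..<2 * int n}" for e
  proof -
    have "fst e \<in> cylinder n"
      using that by (cases e) (auto simp: cylinder_def)
    then have "Measurable.pred (lorentz_law p n) (\<lambda>\<omega>. ?Q (trajectory n \<omega> e k))" for k
      by (rule measurable_compose[OF measurable_trajectory]) simp
    then have "Measurable.pred (lorentz_law p n) (\<lambda>\<omega>. \<forall>k. ?Q (trajectory n \<omega> e k))"
      by (rule pred_intros_countable(1))
    then show ?thesis by (simp add: remains_in_def pred_def)
  qed
  then have "{\<omega> \<in> space (lorentz_law p n). initial_vertex e \<in> {0} \<times> {0..<2 * int n} \<longrightarrow>
      remains_in n \<omega> e ?A} \<in> sets (lorentz_law p n)" for e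
    by (cases "initial_vertex e \<in> {0} \<times> {0..<2 * int n}") simp_all
  then show ?thesis
    unfolding localization_event_def by (intro sets.sets_Collect_countable_All)
qed

end

theory Submission
  imports Defs
begin

text \<open>Count the rays that cross a slab of \<open>L\<close> columns from left to right. The returning rays pair up, so
  this number has the parity of the circumference \<open>2n\<close>; it decreases with \<open>L\<close>, and it suffices that a
  fresh block of order \<open>n\<close> columns destroys a crossing with a probability polynomial in \<open>1/n\<close>.

  As the number is even, a surviving crossing has a companion. Explore both; the other sites
  of the block are still independent. A ray started on the first crossing \<open>A\<close> meets the second
  crossing \<open>B\<close> with probability at least \<open>c/n\<close>: on a cylinder of odd circumference some ray always
  crosses, so in the plane a ray reaches distance \<open>R\<close> with probability at least \<open>1/(2R + 1)\<close>, and by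
  planarity one of the eight symmetric copies of such a path must meet a lift of \<open>B\<close>. Until it does,
  it stays between two lifts of \<open>B\<close>, where the plane and the cylinder cannot be told apart. Hence a
  piece of trajectory links \<open>A\<close> to \<open>B\<close>, and changing the states at its two ends connects the left end
  of \<open>A\<close> to the left end of \<open>B\<close>, so that both stop crossing. There are \<open>O(n\<^sup>4)\<close> choices for the two
  sites, so a block destroys a crossing with probability at least \<open>c n\<^sup>-\<^sup>5\<close>.\<close>

text \<open>Parity is both the obstacle and the tool. On a cylinder of odd circumference some ray
  always crosses, so no local change can remove a lone crossing: crossings disappear only in pairs,
  which is why the surgery joins two of them. The same obstruction supplies the only a priori lower
  bound, the one for a ray to travel far. The link may meet the two crossings only at its ends. Its
  existence is then decided by unexplored sites, and the two changes leave intact the parts of the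
  crossings and of the link that are used afterwards. The number of pairs of sites enters as a loss
  because the changed environment does not reveal where it was changed. A block has about 4n
  columns, so M columns contain of order M/n blocks and the exponent is of order M/n^6. Initially
  all 2n entering rays may cross; controlling them together through 2^X, with X the number of
  crossings, costs a factor 2^(2n). The assumption M \<ge> C n^10 makes this factor negligible, and
  the rate is finally weakened to M/n^10.\<close>

section \<open>Rays and crossings\<close>

text \<open>\<open>nbr m\<close> is the neighbour map of the cylinder \<open>\<int> \<times> (\<int>/m\<int>)\<close>; as \<open>y mod 0 = y\<close>, \<open>nbr 0\<close> is that
  of the plane.\<close>

fun nbr :: "int \<Rightarrow> vertex \<Rightarrow> direction \<Rightarrow> vertex" where
  "nbr m (x, y) North = (x, (y + 1) mod m)"
| "nbr m (x, y) East = (x + 1, y)"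
| "nbr m (x, y) South = (x, (y - 1) mod m)"
| "nbr m (x, y) West = (x - 1, y)"

definition target :: "int \<Rightarrow> directed_edge \<Rightarrow> vertex" where
  "target m e = nbr m (fst e) (snd e)"

definition advance :: "int \<Rightarrow> (vertex \<Rightarrow> site) \<Rightarrow> directed_edge \<Rightarrow> directed_edge" where
  "advance m \<omega> e = (target m e, paired (\<omega> (target m e)) (opposite (snd e)))"

definition ray :: "int \<Rightarrow> (vertex \<Rightarrow> site) \<Rightarrow> directed_edge \<Rightarrow> nat \<Rightarrow> directed_edge" where
  "ray m \<omega> e k = (advance m \<omega> ^^ k) e"

text \<open>Vertices outside the strip \<open>0 \<le> y < m\<close> are junk: there a step cannot be undone.\<close>

definition valid :: "int \<Rightarrow> directed_edge \<Rightarrow> bool" where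
  "valid m e \<longleftrightarrow> snd (fst e) mod m = snd (fst e)"

definition flip :: "int \<Rightarrow> directed_edge \<Rightarrow> directed_edge" where
  "flip m e = (target m e, opposite (snd e))"

lemma neighbour_eq_nbr: "neighbour n u d = nbr (2 * int n) u d"
  by (cases u; cases d) auto

lemma next_edge_eq_advance: "next_edge n \<omega> = advance (2 * int n) \<omega>"
  by (rule ext) (auto simp: advance_def target_def neighbour_eq_nbr)

lemma trajectory_eq_ray: "trajectory n \<omega> e k = ray (2 * int n) \<omega> e k"
  by (simp add: trajectory_def ray_def next_edge_eq_advance)

lemma opposite_opposite [simp]: "opposite (opposite d) = d"
  by (cases d) auto

lemma opposite_neq [simp]: "opposite d \<noteq> d" "d \<noteq> opposite d"
  by (cases d; auto)+

lemma opposite_inject [simp]: "opposite d = opposite d' \<longleftrightarrow> d = d'"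
  by (metis opposite_opposite)

lemma paired_paired [simp]: "paired s (paired s d) = d"
  by (cases s; cases d) auto

lemma paired_neq [simp]: "paired s d \<noteq> d"
  by (cases s; cases d) auto

text \<open>The three states of a site realise all three perfect matchings of its four half-edges.
  This makes surgery at a single site possible: an arriving ray can be sent out along any other
  half-edge.\<close>

lemma exists_site_pairing:
  assumes "d \<noteq> d'"
  obtains s where "paired s d = d'"
proof -
  have "\<exists>s. paired s d = d'"
    using assms by (cases d; cases d') (auto intro: exI[of _ No_Mirror] exI[of _ NW_Mirror] exI[of _ NE_Mirror])
  then show ?thesis using that by blast
qed

lemma ray_0 [simp]: "ray m \<omega> e 0 = e"
  by (simp add: ray_def)

lemma ray_Suc: "ray m \<omega> e (Suc k) = advance m \<omega> (ray m \<omega> e k)"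
  by (simp add: ray_def)

lemma ray_add: "ray m \<omega> e (j + k) = ray m \<omega> (ray m \<omega> e j) k"
  by (simp add: ray_def funpow_add add.commute[of j k])

lemma fst_ray_Suc [simp]: "fst (ray m \<omega> e (Suc k)) = target m (ray m \<omega> e k)"
  by (simp add: ray_Suc advance_def)

lemma snd_ray_Suc:
  "snd (ray m \<omega> e (Suc k)) =
     paired (\<omega> (target m (ray m \<omega> e k))) (opposite (snd (ray m \<omega> e k)))"
  by (simp add: ray_Suc advance_def)

lemma nbr_opposite: "snd u mod m = snd u \<Longrightarrow> nbr m (nbr m u d) (opposite d) = u"
  by (cases u; cases d) (auto simp: mod_simps)

lemma snd_nbr_mod: "snd u mod m = snd u \<Longrightarrow> snd (nbr m u d) mod m = snd (nbr m u d)"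
  by (cases u; cases d) auto

lemma valid_advance [simp]: "valid m e \<Longrightarrow> valid m (advance m \<omega> e)"
  by (simp add: valid_def advance_def target_def snd_nbr_mod)

lemma valid_ray: "valid m e \<Longrightarrow> valid m (ray m \<omega> e k)"
  by (induction k) (auto simp: ray_Suc)

lemma valid_range: "valid m e \<Longrightarrow> 0 < m \<Longrightarrow> snd (fst e) \<in> {0..<m}"
  using pos_mod_bound[of m "snd (fst e)"] pos_mod_sign[of m "snd (fst e)"] by (simp add: valid_def)

lemma target_flip: "valid m e \<Longrightarrow> target m (flip m e) = fst e"
  by (simp add: flip_def target_def valid_def nbr_opposite)

lemma flip_flip: "valid m e \<Longrightarrow> flip m (flip m e) = e"
  using target_flip[of m e] by (simp add: flip_def[of m "flip m e"]) (simp add: flip_def)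

lemma fst_flip [simp]: "fst (flip m e) = target m e"
  and snd_flip [simp]: "snd (flip m e) = opposite (snd e)"
  by (simp_all add: flip_def)

lemma flip_inject: "valid m e \<Longrightarrow> valid m e' \<Longrightarrow> flip m e = flip m e' \<Longrightarrow> e = e'"
  by (metis flip_flip)

text \<open>Because \<open>paired s\<close> is an involution, \<open>flip\<close> turns a step into
  its inverse, so that a ray run backwards is again a ray.\<close>

lemma advance_flip_advance:
  assumes "valid m e"
  shows "advance m \<omega> (flip m (advance m \<omega> e)) = flip m e"
  using target_flip[OF valid_advance[OF assms, of \<omega>]]
  by (simp add: advance_def[of m \<omega> "flip m _"]) (simp add: advance_def flip_def)

lemma ray_flip:
  assumes "valid m e" "i \<le> k"
  shows "ray m \<omega> (flip m (ray m \<omega> e k)) i = flip m (ray m \<omega> e (k - i))"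
  using assms(2)
proof (induction i)
  case (Suc i)
  then have "k - i = Suc (k - Suc i)" by simp
  then show ?case
    using Suc by (simp add: ray_Suc advance_flip_advance valid_ray[OF assms(1)])
qed simp

text \<open>Run both rays backwards from the common edge. In particular, a ray that repeats an edge
  comes back to its first edge.\<close>

lemma ray_cancel:
  assumes "valid m e" "valid m e'" "ray m \<omega> e i = ray m \<omega> e' j" "i \<le> j"
  shows "e = ray m \<omega> e' (j - i)"
proof -
  have "flip m e = flip m (ray m \<omega> e' (j - i))"
    using ray_flip[OF assms(1), of i i \<omega>] ray_flip[OF assms(2) assms(4), of \<omega>] assms(3) by simp
  then show ?thesis
    using assms by (meson flip_inject valid_ray)
qed

text \<open>Naturality of the dynamics under a map \<open>f\<close> of vertices, \<open>g\<close> of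
  directions and \<open>h\<close> of sites. Compatibility is demanded only along the ray, so
  \<open>f\<close> may be a chart that identifies plane and cylinder merely on the part that the ray
  sees.\<close>

lemma ray_transport:
  assumes opp: "\<And>d. opposite (g d) = g (opposite d)"
    and pair: "\<And>s d. paired (h s) (g d) = g (paired s d)"
    and nb: "\<And>j. j < k \<Longrightarrow> target m' (f (fst (ray m \<omega> e j)), g (snd (ray m \<omega> e j)))
               = f (target m (ray m \<omega> e j))"
    and site: "\<And>j. j < k \<Longrightarrow> \<omega>' (f (target m (ray m \<omega> e j))) = h (\<omega> (target m (ray m \<omega> e j)))"
    and "i \<le> k"
  shows "ray m' \<omega>' (f (fst e), g (snd e)) i = (f (fst (ray m \<omega> e i)), g (snd (ray m \<omega> e i)))"
  using \<open>i \<le> k\<close>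
proof (induction i)
  case (Suc i)
  then have "i < k" by simp
  with Suc nb[of i] site[of i] show ?case
    by (simp add: ray_Suc advance_def opp pair)
qed simp

lemma ray_cong:
  assumes "\<And>j. j < k \<Longrightarrow> \<omega>' (target m (ray m \<omega> e j)) = \<omega> (target m (ray m \<omega> e j))" "i \<le> k"
  shows "ray m \<omega>' e i = ray m \<omega> e i"
  using ray_transport[of "\<lambda>d. d" "\<lambda>s. s" k m "\<lambda>v. v" m \<omega> e \<omega>' i] assms by simp

lemma fst_nbr_bounds: "\<bar>fst (nbr m u d) - fst u\<bar> \<le> 1"
  by (cases u; cases d) auto

section \<open>Crossings and returns of a slab, and the parity of their number\<close>

abbreviation entry :: "int \<Rightarrow> directed_edge" where
  "entry y \<equiv> ((0, y), East)"

text \<open>The column is read at the head of an edge: the ray starts in column 0, outside the slab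
  \<open>{1..L}\<close>, and at step 0 it already stands in column 1. For \<open>L = 0\<close> every
  entry therefore crosses at once.\<close>

definition col :: "int \<Rightarrow> (vertex \<Rightarrow> site) \<Rightarrow> int \<Rightarrow> nat \<Rightarrow> int" where
  "col m \<omega> y j = fst (target m (ray m \<omega> (entry y) j))"

definition exits_at :: "int \<Rightarrow> (vertex \<Rightarrow> site) \<Rightarrow> int \<Rightarrow> int \<Rightarrow> int \<Rightarrow> nat \<Rightarrow> bool" where
  "exits_at m \<omega> L y c k \<longleftrightarrow> col m \<omega> y k = c \<and> (\<forall>j<k. col m \<omega> y j \<in> {1..L})"

definition crossings :: "int \<Rightarrow> (vertex \<Rightarrow> site) \<Rightarrow> int \<Rightarrow> int set" where
  "crossings m \<omega> L = {y \<in> {0..<m}. \<exists>k. exits_at m \<omega> L y (L + 1) k}"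

definition returns :: "int \<Rightarrow> (vertex \<Rightarrow> site) \<Rightarrow> int \<Rightarrow> int set" where
  "returns m \<omega> L = {y \<in> {0..<m}. \<exists>k. exits_at m \<omega> L y 0 k}"

lemma col_0 [simp]: "col m \<omega> y 0 = 1"
  by (simp add: col_def target_def)

lemma col_step: "\<bar>col m \<omega> y (Suc j) - col m \<omega> y j\<bar> \<le> 1"
  using fst_nbr_bounds[of m "target m (ray m \<omega> (entry y) j)" "snd (ray m \<omega> (entry y) (Suc j))"]
  by (simp add: col_def target_def[of m "ray _ _ _ (Suc j)"])

lemma exits_at_unique:
  assumes "exits_at m \<omega> L y c k" "exits_at m \<omega> L y c' k'" "c \<notin> {1..L}" "c' \<notin> {1..L}"
  shows "k = k'" "c = c'"
  using assms unfolding exits_at_def by (metis linorder_neqE_nat)+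

lemma valid_entry: "y \<in> {0..<m} \<Longrightarrow> valid m (entry y)"
  by (simp add: valid_def)

lemma crossings_subset: "crossings m \<omega> L \<subseteq> {0..<m}"
  and returns_subset: "returns m \<omega> L \<subseteq> {0..<m}"
  by (auto simp: crossings_def returns_def)

lemma finite_crossings [simp]: "finite (crossings m \<omega> L)"
  and finite_returns [simp]: "finite (returns m \<omega> L)"
  by (rule finite_subset[OF crossings_subset] finite_subset[OF returns_subset], simp)+

lemma crossings_Int_returns: "0 \<le> L \<Longrightarrow> crossings m \<omega> L \<inter> returns m \<omega> L = {}"
  by (auto simp: crossings_def returns_def dest: exits_at_unique(2))

lemma finite_UNIV_direction [simp]: "finite (UNIV :: direction set)"
proof (rule finite_subset)
  show "UNIV \<subseteq> {North, East, South, West}"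
  proof
    fix d :: direction
    show "d \<in> {North, East, South, West}" by (cases d) auto
  qed
qed simp

text \<open>A ray that did neither would stay in the finite slab forever and repeat a directed edge.
  By reversibility its entry edge would recur, but that edge starts in column 0.\<close>

lemma crosses_or_returns:
  assumes "0 \<le> L"
  shows "crossings m \<omega> L \<union> returns m \<omega> L = {0..<m}"
proof -
  have "y \<in> crossings m \<omega> L \<union> returns m \<omega> L" if y: "y \<in> {0..<m}" for y
  proof (rule ccontr)
    assume neg: "y \<notin> crossings m \<omega> L \<union> returns m \<omega> L"
    let ?r = "ray m \<omega> (entry y)"
    have inside: "col m \<omega> y k \<in> {1..L}" for k
    proof (induction k rule: less_induct)
      case (less k)
      have "col m \<omega> y k \<noteq> 0" "col m \<omega> y k \<noteq> L + 1"
        using neg y less by (auto simp: crossings_def returns_def exits_at_def)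
      moreover have "col m \<omega> y k \<in> {0..L + 1}"
      proof (cases k)
        case (Suc j)
        then show ?thesis
          using less[of j] col_step[of m \<omega> y j] by (auto simp: abs_le_iff)
      qed (use assms in simp)
      ultimately show ?case by auto
    qed
    have v: "valid m (?r k)" for k
      using valid_ray[OF valid_entry[OF y]] .
    \<comment> \<open>Shifted by one, since the entry edge itself starts outside the slab.\<close>
    have fin: "?r (Suc k) \<in> ({1..L} \<times> {0..<m}) \<times> UNIV" for k
    proof -
      have "snd (fst (?r (Suc k))) \<in> {0..<m}"
        using y by (intro valid_range[OF v]) simp
      then show ?thesis
        using inside[of k] by (simp add: col_def mem_Times_iff)
    qed
    have "range (\<lambda>k. ?r (Suc k)) \<subseteq> ({1..L} \<times> {0..<m}) \<times> UNIV"
      by (rule image_subsetI) (rule fin)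
    moreover have "finite (({1..L} \<times> {0..<m}) \<times> (UNIV :: direction set))"
      by (intro finite_cartesian_product) simp_all
    ultimately have "finite (range (\<lambda>k. ?r (Suc k)))"
      by (rule finite_subset)
    then have "\<not> inj (\<lambda>k. ?r (Suc k))"
      using range_inj_infinite by blast
    then obtain i j where ij: "i < j" "?r i = ?r j"
      unfolding inj_def by (metis Suc_mono linorder_neqE_nat)
    then have "entry y = ?r (j - i)"
      using ray_cancel[OF valid_entry[OF y] valid_entry[OF y]] by auto
    moreover obtain l where "j - i = Suc l"
      using ij by (metis Suc_diff_Suc)
    ultimately have "fst (entry y) = target m (?r l)"
      by (metis fst_ray_Suc)
    then have "col m \<omega> y l = 0"
      by (simp add: col_def flip: \<open>fst (entry y) = target m (?r l)\<close>)
    then show False using inside[of l] by simp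
  qed
  then show ?thesis
    using crossings_subset[of m \<omega> L] returns_subset[of m \<omega> L] by blast
qed

text \<open>Columns change by at most one per step, so at the first time beyond column
  \<open>L\<close> the ray stands exactly in column \<open>L + 1\<close>.\<close>

lemma crossings_mono:
  assumes "0 \<le> L" "L \<le> L'"
  shows "crossings m \<omega> L' \<subseteq> crossings m \<omega> L"
proof
  fix y assume "y \<in> crossings m \<omega> L'"
  then obtain k where k: "exits_at m \<omega> L' y (L' + 1) k" and y: "y \<in> {0..<m}"
    by (auto simp: crossings_def)
  define k' where "k' = (LEAST i. col m \<omega> y i \<ge> L + 1)"
  have ex: "col m \<omega> y k \<ge> L + 1"
    using k assms by (simp add: exits_at_def)
  then have ge: "col m \<omega> y k' \<ge> L + 1" and le: "k' \<le> k"
    unfolding k'_def by (rule LeastI, rule Least_le)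
  have lt: "col m \<omega> y j < L + 1" if "j < k'" for j
    using that not_less_Least unfolding k'_def by fastforce
  have "col m \<omega> y k' = L + 1"
  proof (cases k')
    case 0
    then show ?thesis using ge assms by simp
  next
    case (Suc j)
    then show ?thesis using ge lt[of j] col_step[of m \<omega> y j] by simp
  qed
  moreover have "\<forall>j<k'. col m \<omega> y j \<in> {1..L}"
    using lt le k by (fastforce simp: exits_at_def)
  ultimately show "y \<in> crossings m \<omega> L"
    using y by (auto simp: crossings_def exits_at_def)
qed

lemma even_card_if_paired_off:
  assumes "finite S"
    and "\<And>y. y \<in> S \<Longrightarrow> f y \<in> S" "\<And>y. y \<in> S \<Longrightarrow> f (f y) = y" "\<And>y. y \<in> S \<Longrightarrow> f y \<noteq> y"
  shows "even (card S)"
  using assms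
proof (induction S rule: finite_psubset_induct)
  case (psubset S)
  show ?case
  proof (cases "S = {}")
    case False
    then obtain y where y: "y \<in> S" by blast
    let ?S = "S - {y, f y}"
    have "even (card ?S)"
    proof (rule psubset.IH)
      show "?S \<subset> S" using y by blast
      fix z assume z: "z \<in> ?S"
      then show "f (f z) = z" "f z \<noteq> z"
        using psubset.prems by blast+
      have "f z \<noteq> y" "f z \<noteq> f y"
        using z y psubset.prems(2) by (metis DiffD1 DiffD2 insertI1 insertI2)+
      then show "f z \<in> ?S"
        using z psubset.prems(1) by blast
    qed
    moreover have "card S = card ?S + 2"
    proof -
      have "card {y, f y} = 2" using psubset.prems(3)[OF y] by auto
      moreover have "{y, f y} \<subseteq> S" using y psubset.prems by blast
      ultimately show ?thesis
        using card_Diff_subset[of "{y, f y}" S] card_mono[OF psubset.hyps(1), of "{y, f y}"] by simp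
    qed
    ultimately show ?thesis by simp
  qed simp
qed

text \<open>A step from the slab to column 0 can only be a west edge leaving column 1, that is, an
  entry edge run backwards.\<close>

lemma flip_entry_return:
  assumes "y \<in> {0..<m}" "exits_at m \<omega> L y 0 k" "0 \<le> L"
  obtains y' where "y' \<in> {0..<m}" "ray m \<omega> (entry y) k = flip m (entry y')"
proof -
  let ?e = "ray m \<omega> (entry y) k"
  obtain x z d where e: "?e = ((x, z), d)" by (metis surj_pair)
  have v: "valid m ?e" by (rule valid_ray[OF valid_entry[OF assms(1)]])
  have t: "fst (target m ?e) = 0" using assms(2) by (simp add: exits_at_def col_def)
  have "k \<noteq> 0" using assms(2) col_0[of m \<omega> y] by (metis exits_at_def zero_neq_one)
  then obtain l where l: "k = Suc l" by (metis not0_implies_Suc)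
  have "x = col m \<omega> y l" using arg_cong[OF e, of "\<lambda>e. fst (fst e)"] unfolding l col_def by simp
  then have "x \<ge> 1" using assms(2) l by (simp add: exits_at_def)
  then have d: "d = West \<and> x = 1" using t unfolding e by (cases d) (auto simp: target_def)
  have "z \<in> {0..<m}"
    using valid_range[OF v] e assms(1) by simp
  then show ?thesis
    using e d by (intro that[of z]) (auto simp: flip_def target_def)
qed

text \<open>The returning ray run backwards is the ray of the entry through which it leaves, so
  returning is an involution. A fixed point would be a ray equal to its own reversal.\<close>

lemma return_partner:
  assumes "y \<in> {0..<m}" "y' \<in> {0..<m}" "exits_at m \<omega> L y 0 k" "ray m \<omega> (entry y) k = flip m (entry y')"
  shows "exits_at m \<omega> L y' 0 k" "ray m \<omega> (entry y') k = flip m (entry y)" "y' \<noteq> y"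
proof -
  have v: "valid m (ray m \<omega> (entry y) j)" for j
    by (rule valid_ray[OF valid_entry[OF assms(1)]])
  have "flip m (ray m \<omega> (entry y) k) = entry y'"
    using assms(4) flip_flip[OF valid_entry[OF assms(2)]] by simp
  then have r: "ray m \<omega> (entry y') i = flip m (ray m \<omega> (entry y) (k - i))" if "i \<le> k" for i
    using ray_flip[OF valid_entry[OF assms(1)] that, of \<omega>] by simp
  show "ray m \<omega> (entry y') k = flip m (entry y)"
    using r[of k] by simp
  have "col m \<omega> y' j \<in> {1..L}" if "j < k" for j
  proof -
    have "target m (ray m \<omega> (entry y') j) = fst (ray m \<omega> (entry y) (k - j))"
      using r[of j] that target_flip[OF v] by simp
    also have "k - j = Suc (k - j - 1)" using that by simp
    then have "fst (ray m \<omega> (entry y) (k - j)) = target m (ray m \<omega> (entry y) (k - j - 1))"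
      by (metis fst_ray_Suc)
    finally have "col m \<omega> y' j = col m \<omega> y (k - j - 1)"
      by (simp add: col_def)
    then show ?thesis
      using assms(3) that by (simp add: exits_at_def)
  qed
  moreover have "col m \<omega> y' k = 0"
    using r[of k] target_flip[OF valid_entry[OF assms(1)]] by (simp add: col_def)
  ultimately show "exits_at m \<omega> L y' 0 k" by (simp add: exits_at_def)
  show "y' \<noteq> y"
  proof
    assume eq: "y' = y"
    \<comment> \<open>In the middle of a self-reversed ray, an edge would be its own reversal
      (\<open>k\<close> even), or a site would send the ray back along the half-edge by which it
      came (\<open>k\<close> odd).\<close>
    show False
    proof (cases "even k")
      case True
      then have "ray m \<omega> (entry y) (k div 2) = flip m (ray m \<omega> (entry y) (k div 2))"
        using r[of "k div 2"] eq by (metis (no_types, lifting) diff_add_inverse2 div_le_dividend even_two_times_div_two mult_2)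
      then show False by (metis opposite_neq(1) snd_flip)
    next
      case False
      then obtain i where i: "k = Suc (2 * i)" using oddE by (metis Suc_eq_plus1)
      have "ray m \<omega> (entry y) (Suc i) = flip m (ray m \<omega> (entry y) i)"
        using r[of "Suc i"] eq i by simp
      then have "snd (ray m \<omega> (entry y) (Suc i)) = opposite (snd (ray m \<omega> (entry y) i))"
        by simp
      then show False by (simp add: snd_ray_Suc)
    qed
  qed
qed

lemma even_card_returns:
  assumes "0 \<le> L"
  shows "even (card (returns m \<omega> L))"
proof -
  define P where "P y y' \<longleftrightarrow> y' \<in> {0..<m} \<and>
    (\<exists>k. exits_at m \<omega> L y 0 k \<and> ray m \<omega> (entry y) k = flip m (entry y'))" for y y'
  define f where "f y = (SOME y'. P y y')" for y
  have "P y (f y)" if y: "y \<in> returns m \<omega> L" for y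
  proof -
    obtain k where k: "y \<in> {0..<m}" "exits_at m \<omega> L y 0 k"
      using y unfolding returns_def mem_Collect_eq by blast
    obtain y' where "y' \<in> {0..<m}" "ray m \<omega> (entry y) k = flip m (entry y')"
      by (rule flip_entry_return[OF k assms])
    then have "P y y'" using k unfolding P_def by blast
    then show ?thesis unfolding f_def by (rule someI)
  qed
  then have f: "f y \<in> {0..<m}" "\<exists>k. exits_at m \<omega> L y 0 k \<and> ray m \<omega> (entry y) k = flip m (entry (f y))"
    if "y \<in> returns m \<omega> L" for y using that unfolding P_def by blast+
  show ?thesis
  proof (rule even_card_if_paired_off[of _ f])
    fix y assume y: "y \<in> returns m \<omega> L"
    then have y0: "y \<in> {0..<m}" by (simp add: returns_def)
    obtain k where k: "exits_at m \<omega> L y 0 k" "ray m \<omega> (entry y) k = flip m (entry (f y))"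
      using f(2)[OF y] by blast
    note p = return_partner[OF y0 f(1)[OF y] k]
    show fy: "f y \<in> returns m \<omega> L"
      using p(1) f(1)[OF y] by (auto simp: returns_def)
    show "f y \<noteq> y" by (rule p(3))
    obtain k' where k': "exits_at m \<omega> L (f y) 0 k'" "ray m \<omega> (entry (f y)) k' = flip m (entry (f (f y)))"
      using f(2)[OF fy] by blast
    have "k' = k" by (rule exits_at_unique(1)[OF k'(1) p(1)]) auto
    then have "flip m (entry (f (f y))) = flip m (entry y)"
      using k' p(2) by simp
    then show "f (f y) = y"
      using flip_inject[OF valid_entry[OF f(1)[OF fy]] valid_entry[OF y0]] by simp
  qed simp
qed

text \<open>Used twice: for even \<open>m\<close> it supplies a second crossing, for odd
  \<open>m\<close> the existence of a first one.\<close>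

lemma card_crossings_parity:
  assumes "0 \<le> L" "0 \<le> m"
  shows "even (card (crossings m \<omega> L)) \<longleftrightarrow> even m"
proof -
  have "card (crossings m \<omega> L) + card (returns m \<omega> L) = nat m"
    using card_Un_disjoint[OF finite_crossings finite_returns crossings_Int_returns[OF assms(1)], of m \<omega>]
      crosses_or_returns[OF assms(1)] by simp
  then have "even (card (crossings m \<omega> L)) \<longleftrightarrow> even (nat m)"
    using even_card_returns[OF assms(1)] by (metis even_add)
  then show ?thesis using assms(2) by (simp add: even_nat_iff)
qed

lemma crossings_cong_subset:
  assumes "\<And>v. v \<in> {1..L} \<times> {0..<m} \<Longrightarrow> \<omega>' v = \<omega> v"
  shows "crossings m \<omega> L \<subseteq> crossings m \<omega>' L"
proof
  fix y assume "y \<in> crossings m \<omega> L"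
  then obtain k where k: "exits_at m \<omega> L y (L + 1) k" and y: "y \<in> {0..<m}"
    by (auto simp: crossings_def)
  have r: "ray m \<omega>' (entry y) i = ray m \<omega> (entry y) i" if "i \<le> k" for i
  proof (rule ray_cong[OF _ that])
    fix j assume "j < k"
    have "snd (target m (ray m \<omega> (entry y) j)) \<in> {0..<m}"
      using valid_range[OF valid_ray[OF valid_entry[OF y]], of \<omega> "Suc j"] y by simp
    then show "\<omega>' (target m (ray m \<omega> (entry y) j)) = \<omega> (target m (ray m \<omega> (entry y) j))"
      using k \<open>j < k\<close> by (intro assms) (simp add: exits_at_def col_def mem_Times_iff)
  qed
  have "col m \<omega>' y j = col m \<omega> y j" if "j \<le> k" for j
    using r[OF that] by (simp only: col_def)
  then have "exits_at m \<omega>' L y (L + 1) k"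
    using k unfolding exits_at_def by (metis less_imp_le order_refl)
  then show "y \<in> crossings m \<omega>' L" using y unfolding crossings_def by blast
qed

lemma crossings_cong:
  assumes "\<And>v. v \<in> {1..L} \<times> {0..<m} \<Longrightarrow> \<omega>' v = \<omega> v"
  shows "crossings m \<omega>' L = crossings m \<omega> L"
  by (intro equalityI crossings_cong_subset) (use assms in simp_all)

section \<open>Paths in the square lattice\<close>

text \<open>Equality is allowed, so that a single vertex counts as a degenerate edge in
  \<open>edge_union\<close>.\<close>

definition adjacent :: "vertex \<Rightarrow> vertex \<Rightarrow> bool" where
  "adjacent u v \<longleftrightarrow> \<bar>fst u - fst v\<bar> + \<bar>snd u - snd v\<bar> \<le> 1"

inductive linked :: "vertex set \<Rightarrow> vertex \<Rightarrow> vertex \<Rightarrow> bool" for S where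
  linked_refl: "u \<in> S \<Longrightarrow> linked S u u"
| linked_step: "linked S u v \<Longrightarrow> w \<in> S \<Longrightarrow> adjacent v w \<Longrightarrow> linked S u w"

lemma adjacent_sym: "adjacent u v \<Longrightarrow> adjacent v u"
  by (simp add: adjacent_def abs_minus_commute)

lemma linked_in: "linked S u v \<Longrightarrow> u \<in> S \<and> v \<in> S"
  by (induction rule: linked.induct) auto

lemma linked_trans: "linked S v w \<Longrightarrow> linked S u v \<Longrightarrow> linked S u w"
  by (induction rule: linked.induct) (auto intro: linked.intros)

lemma linked_sym: "linked S u v \<Longrightarrow> linked S v u"
proof (induction rule: linked.induct)
  case (linked_step u v w)
  have "linked S w v"
    using linked_step linked_in[OF linked_step(1)]
    by (meson adjacent_sym linked.linked_refl linked.linked_step)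
  then show ?case using linked_step.IH by (rule linked_trans[rotated])
qed (rule linked_refl)

lemma linked_map:
  assumes "linked S u v" "\<And>a. a \<in> S \<Longrightarrow> f a \<in> S'"
    "\<And>a b. adjacent a b \<Longrightarrow> adjacent (f a) (f b)"
  shows "linked S' (f u) (f v)"
  using assms(1) by (induction rule: linked.induct) (auto intro: linked.intros assms(2,3))

lemma linked_mono: "linked S u v \<Longrightarrow> S \<subseteq> S' \<Longrightarrow> linked S' u v"
  using linked_map[of S u v "\<lambda>a. a" S'] by auto

lemma linked_sequence:
  assumes "\<And>i. i \<in> {i0..i1} \<Longrightarrow> g i \<in> S" "\<And>i. i0 \<le> i \<Longrightarrow> i < i1 \<Longrightarrow> adjacent (g i) (g (Suc i))" "i0 \<le> (i1 :: nat)"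
  shows "linked S (g i0) (g i1)"
  using assms(3,1,2)
proof (induction rule: dec_induct)
  case (step i)
  have "linked S (g i0) (g i)"
    using step.prems by (intro step.IH) simp_all
  then show ?case
    by (rule linked.linked_step) (use step.hyps step.prems in simp_all)
qed (auto intro: linked_refl)

section \<open>Lattice paths as curves in the plane\<close>

definition point :: "vertex \<Rightarrow> real^2" where
  "point u = vector [real_of_int (fst u), real_of_int (snd u)]"

lemma point_nth [simp]: "point u $ 1 = real_of_int (fst u)" "point u $ 2 = real_of_int (snd u)"
  by (simp_all add: point_def)

definition edge_union :: "vertex set \<Rightarrow> (real^2) set" where
  "edge_union S = {z. \<exists>a\<in>S. \<exists>b\<in>S. adjacent a b \<and> z \<in> closed_segment (point a) (point b)}"

lemma segment_nth_bounds:
  fixes p q :: "real^'n"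
  assumes "z \<in> closed_segment p q"
  shows "min (p $ i) (q $ i) \<le> z $ i" "z $ i \<le> max (p $ i) (q $ i)"
proof -
  obtain t where t: "0 \<le> t" "t \<le> 1" "z = (1 - t) *\<^sub>R p + t *\<^sub>R q"
    using assms by (auto simp: in_segment)
  have "z $ i \<in> closed_segment (p $ i) (q $ i)"
    using t by (auto simp: in_segment)
  then show "min (p $ i) (q $ i) \<le> z $ i" "z $ i \<le> max (p $ i) (q $ i)"
    by (auto simp: closed_segment_eq_real_ivl split: if_splits)
qed

lemma edge_union_bounds:
  assumes "S \<subseteq> {a..b} \<times> {c..d}" "z \<in> edge_union S"
  shows "real_of_int a \<le> z $ 1" "z $ 1 \<le> real_of_int b" "real_of_int c \<le> z $ 2" "z $ 2 \<le> real_of_int d"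
proof -
  obtain u v where uv: "u \<in> S" "v \<in> S" "z \<in> closed_segment (point u) (point v)"
    using assms(2) by (auto simp: edge_union_def)
  have "a \<le> fst u" "fst u \<le> b" "c \<le> snd u" "snd u \<le> d" "a \<le> fst v" "fst v \<le> b" "c \<le> snd v" "snd v \<le> d"
    using uv assms(1) by auto
  then show "real_of_int a \<le> z $ 1" "z $ 1 \<le> real_of_int b" "real_of_int c \<le> z $ 2" "z $ 2 \<le> real_of_int d"
    using segment_nth_bounds[OF uv(3), of 1] segment_nth_bounds[OF uv(3), of 2] by auto
qed

lemma edge_union_meet:
  assumes "z \<in> edge_union S" "z \<in> edge_union S'"
  shows "S \<inter> S' \<noteq> {}"
proof -
  obtain a b c d where ab: "a \<in> S" "b \<in> S" "adjacent a b" "z \<in> closed_segment (point a) (point b)"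
    and cd: "c \<in> S'" "d \<in> S'" "adjacent c d" "z \<in> closed_segment (point c) (point d)"
    using assms by (auto simp: edge_union_def)
  \<comment> \<open>The lower left corner of the common part of the two bounding boxes. It is a
    lattice point, and the box of a lattice edge contains no lattice points but the ends of the
    edge.\<close>
  define px py where "px = max (min (fst a) (fst b)) (min (fst c) (fst d))"
    and "py = max (min (snd a) (snd b)) (min (snd c) (snd d))"
  have "real_of_int (max (min (fst a) (fst b)) (min (fst c) (fst d))) \<le> real_of_int (min (max (fst a) (fst b)) (max (fst c) (fst d)))"
    "real_of_int (max (min (snd a) (snd b)) (min (snd c) (snd d))) \<le> real_of_int (min (max (snd a) (snd b)) (max (snd c) (snd d)))"
    using segment_nth_bounds[OF ab(4), of 1] segment_nth_bounds[OF ab(4), of 2]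
      segment_nth_bounds[OF cd(4), of 1] segment_nth_bounds[OF cd(4), of 2]
    by (simp_all add: of_int_max of_int_min)
  then have x: "px \<le> min (max (fst a) (fst b)) (max (fst c) (fst d))"
    and y: "py \<le> min (max (snd a) (snd b)) (max (snd c) (snd d))"
    unfolding px_def py_def of_int_le_iff .
  have box: "p = u \<or> p = v" if "adjacent u v" "min (fst u) (fst v) \<le> fst p" "fst p \<le> max (fst u) (fst v)"
    "min (snd u) (snd v) \<le> snd p" "snd p \<le> max (snd u) (snd v)" for p u v :: vertex
  proof -
    have "(fst u = fst v \<and> \<bar>snd u - snd v\<bar> \<le> 1) \<or> (snd u = snd v \<and> \<bar>fst u - fst v\<bar> \<le> 1)"
      using that(1) unfolding adjacent_def by linarith
    then show ?thesis
      using that(2-) by (auto simp: prod_eq_iff min_def max_def abs_if split: if_splits)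
  qed
  have "(px, py) = a \<or> (px, py) = b"
    using x y by (intro box ab) (auto simp: px_def py_def)
  moreover have "(px, py) = c \<or> (px, py) = d"
    using x y by (intro box cd) (auto simp: px_def py_def)
  ultimately show ?thesis using ab cd by blast
qed

lemma linked_path:
  assumes "linked S u v"
  obtains g where "path g" "pathstart g = point u" "pathfinish g = point v" "path_image g \<subseteq> edge_union S"
proof -
  have "\<exists>g. path g \<and> pathstart g = point u \<and> pathfinish g = point v \<and> path_image g \<subseteq> edge_union S"
    using assms
  proof (induction rule: linked.induct)
    case (linked_refl u)
    then show ?case
      by (intro exI[of _ "linepath (point u) (point u)"])
        (auto simp: edge_union_def adjacent_def path_def pathstart_def pathfinish_def intro!: bexI[of _ u])
  next
    case (linked_step u v w)
    then obtain g where g: "path g" "pathstart g = point u" "pathfinish g = point v" "path_image g \<subseteq> edge_union S"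
      by blast
    have "v \<in> S" using linked_in[OF linked_step(1)] by simp
    then have "closed_segment (point v) (point w) \<subseteq> edge_union S"
      using linked_step unfolding edge_union_def by blast
    then show ?case
      using g by (intro exI[of _ "g +++ linepath (point v) (point w)"]) (simp add: path_image_join)
  qed
  then show ?thesis using that by blast
qed

text \<open>A discrete form of \<open>fashoda\<close>. That theorem wants the vertical curve to end
  exactly on the bottom and the top of the box, whereas \<Theta> may leave the rows
  \<open>{c..d}\<close>. So the box is enlarged to the heights from \<open>- M\<close> to
  \<open>M\<close>, and the curve is prolonged by two vertical segments.\<close>

theorem crossing_paths_meet:
  assumes \<Lambda>: "linked \<Lambda> u v" "\<Lambda> \<subseteq> {a..b} \<times> {c..d}" "fst u = a" "fst v = b"
    and \<Theta>: "linked \<Theta> u' v'" "\<Theta> \<subseteq> {a..b} \<times> UNIV" "snd u' \<le> c" "snd v' \<ge> d"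
  shows "\<Lambda> \<inter> \<Theta> \<noteq> {}"
proof -
  obtain f where f: "path f" "pathstart f = point u" "pathfinish f = point v" "path_image f \<subseteq> edge_union \<Lambda>"
    using linked_path[OF \<Lambda>(1)] .
  obtain g where g: "path g" "pathstart g = point u'" "pathfinish g = point v'" "path_image g \<subseteq> edge_union \<Theta>"
    using linked_path[OF \<Theta>(1)] .
  obtain B where B: "\<And>z. z \<in> path_image g \<Longrightarrow> norm z \<le> B"
    using bounded_path_image[OF g(1)] by (auto simp: bounded_iff)
  define M where "M = max B (max \<bar>real_of_int c\<bar> \<bar>real_of_int d\<bar>)"
  have gM: "\<bar>z $ 2\<bar> \<le> M" if "z \<in> path_image g" for z
    using B[OF that] component_le_norm_cart[of z 2] by (simp add: M_def)
  have g1: "real_of_int a \<le> z $ 1 \<and> z $ 1 \<le> real_of_int b" if z: "z \<in> path_image g" for z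
  proof -
    obtain p q where pq: "p \<in> \<Theta>" "q \<in> \<Theta>" "z \<in> closed_segment (point p) (point q)"
      using z g(4) by (auto simp: edge_union_def)
    have "a \<le> fst p" "fst p \<le> b" "a \<le> fst q" "fst q \<le> b"
      using pq \<Theta>(2) by auto
    then show ?thesis
      using segment_nth_bounds[OF pq(3), of 1] by auto
  qed
  have ends: "point u' \<in> path_image g" "point v' \<in> path_image g"
    using g(2,3) pathstart_in_path_image[of g] pathfinish_in_path_image[of g] by auto
  define lo hi lo' hi' :: "real^2" where
    "lo = vector [real_of_int a, - M]" and "hi = vector [real_of_int b, M]"
    and "lo' = vector [real_of_int (fst u'), - M]" and "hi' = vector [real_of_int (fst v'), M]"
  note defs = lo_def hi_def lo'_def hi'_def
  define h where "h = linepath lo' (point u') +++ g +++ linepath (point v') hi'"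
  have box: "z \<in> cbox lo hi \<longleftrightarrow> real_of_int a \<le> z $ 1 \<and> z $ 1 \<le> real_of_int b \<and> - M \<le> z $ 2 \<and> z $ 2 \<le> M"
    for z :: "real^2"
    by (auto simp: mem_box_cart forall_2 defs)
  have M: "- M \<le> real_of_int c" "real_of_int d \<le> M"
    by (auto simp: M_def)
  have image_h: "path_image h = closed_segment lo' (point u') \<union> path_image g \<union> closed_segment (point v') hi'"
    using g by (simp add: h_def path_image_join Un_assoc)
  have corners: "lo' \<in> cbox lo hi" "hi' \<in> cbox lo hi" "point u' \<in> cbox lo hi" "point v' \<in> cbox lo hi"
    using g1[OF ends(1)] g1[OF ends(2)] gM[OF ends(1)] gM[OF ends(2)] unfolding box
    by (auto simp: defs abs_le_iff)
  have "path_image f \<subseteq> cbox lo hi"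
    using f(4) edge_union_bounds[OF \<Lambda>(2)] M unfolding subset_iff box
    by (meson order_trans)
  moreover have "path_image h \<subseteq> cbox lo hi"
    unfolding image_h
  proof (intro Un_least)
    show "path_image g \<subseteq> cbox lo hi"
      using g1 gM by (auto simp: box abs_le_iff) (smt (verit))
  qed (intro closed_segment_subset corners convex_box)+
  moreover have "path h"
    using g by (simp add: h_def)
  ultimately obtain z where z: "z \<in> path_image f" "z \<in> path_image h"
    using fashoda[of f h lo hi] f(1) f(2,3) \<Lambda>(3,4) by (auto simp: h_def defs)
  have zf: "z \<in> edge_union \<Lambda>" using z f by auto
  have mem: "point w \<in> edge_union \<Theta>" if "w \<in> \<Theta>" for w
    using that by (auto simp: edge_union_def adjacent_def intro!: bexI[of _ w])
  have "z \<in> edge_union \<Theta>"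
    using z(2) unfolding image_h
  proof (elim UnE)
    \<comment> \<open>The prolongation lies at or below row \<open>c\<close> and the curve of
      \<Lambda> at or above it, so they can meet only in \<open>point u'\<close> itself.\<close>
    assume zs: "z \<in> closed_segment lo' (point u')"
    have "z $ 1 = real_of_int (fst u')" "z $ 2 \<le> real_of_int (snd u')"
      using segment_nth_bounds[OF zs, of 1] segment_nth_bounds[OF zs, of 2] corners(3) unfolding box
      by (auto simp: defs)
    moreover have "real_of_int (snd u') \<le> z $ 2"
      using edge_union_bounds(3)[OF \<Lambda>(2) zf] \<Theta>(3) by linarith
    ultimately have "z = point u'" by (simp add: vec_eq_iff forall_2)
    then show ?thesis using mem linked_in[OF \<Theta>(1)] by simp
  next
    assume zs: "z \<in> closed_segment (point v') hi'"
    have "z $ 1 = real_of_int (fst v')" "z $ 2 \<ge> real_of_int (snd v')"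
      using segment_nth_bounds[OF zs, of 1] segment_nth_bounds[OF zs, of 2] corners(4) unfolding box
      by (auto simp: defs)
    moreover have "real_of_int (snd v') \<ge> z $ 2"
      using edge_union_bounds(4)[OF \<Lambda>(2) zf] \<Theta>(4) by linarith
    ultimately have "z = point v'" by (simp add: vec_eq_iff forall_2)
    then show ?thesis using mem linked_in[OF \<Theta>(1)] by simp
  qed (use g in blast)
  then show ?thesis using edge_union_meet[OF zf] by blast
qed

section \<open>A periodic barrier in a strip\<close>

text \<open>For \<open>a, b = \<plusminus>1\<close> these are the eight lattice symmetries that fix the origin.\<close>

definition dih :: "int \<Rightarrow> int \<Rightarrow> bool \<Rightarrow> vertex \<Rightarrow> vertex" where
  "dih a b s v = (if s then (a * snd v, b * fst v) else (a * fst v, b * snd v))"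

lemma dih_0 [simp]: "dih a b s (0, 0) = (0, 0)"
  by (simp add: dih_def)

lemma adjacent_dih: "\<bar>a\<bar> = 1 \<Longrightarrow> \<bar>b\<bar> = 1 \<Longrightarrow> adjacent u v \<Longrightarrow> adjacent (dih a b s u) (dih a b s v)"
  by (auto simp: adjacent_def dih_def abs_mult simp flip: right_diff_distrib)

text \<open>In the application \<B> consists of all lifts of the second crossing to the plane,
  \<Lambda> is one lifted left-right path, and the origin is a lift of a vertex of the first
  crossing.\<close>

locale periodic_barrier =
  fixes R N :: int and \<B> \<Lambda> :: "vertex set" and c d :: int
  assumes N: "0 < N" "N \<le> R"
    and periodic: "(x, y) \<in> \<B> \<longleftrightarrow> (x, y + k * N) \<in> \<B>"
    and barrier: "\<Lambda> \<subseteq> \<B>" "\<Lambda> \<subseteq> {-R..R} \<times> {c..d}"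
    and across: "\<exists>u v. linked \<Lambda> u v \<and> fst u = - R \<and> fst v = R"
begin

definition free :: "vertex set" where
  "free = {-R..R} \<times> UNIV - \<B>"

lemma free_shift: "u \<in> free \<Longrightarrow> (fst u, snd u + k * N) \<in> free"
  using periodic[of "fst u" "snd u" k] by (auto simp: free_def)

lemma linked_shift: "linked free u v \<Longrightarrow> linked free (fst u, snd u + k * N) (fst v, snd v + k * N)"
  by (erule linked_map) (auto simp: free_shift adjacent_def)

text \<open>Stacking the translates of such a link gives a path of arbitrary height that avoids
  \<B>, although it has to cross \<Lambda>.\<close>

lemma no_wrap_pos:
  assumes "linked free u (fst u, snd u + k * N)" "0 < k"
  shows False
proof -
  have step: "linked free (fst u, snd u + j * (k * N)) (fst u, snd u + (j + 1) * (k * N))" for j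
    using linked_shift[OF assms(1), of "j * k"] by (simp add: algebra_simps)
  have up: "linked free (fst u, snd u + j * (k * N)) (fst u, snd u + (j + int i) * (k * N))" for i j
  proof (induction i)
    case 0
    then show ?case using step[of j] linked_in by (auto intro: linked_refl)
  next
    case (Suc i)
    show ?case
      using linked_trans[OF step[of "j + int i"] Suc] by (simp add: ac_simps)
  qed
  have kN: "1 \<le> k * N" using assms(2) N(1) by (simp add: int_one_le_iff_zero_less)
  \<comment> \<open>Each translate climbs by at least 1, so the stack from the \<open>j\<close>-th
    to the \<open>(j + i)\<close>-th starts at or below row \<open>c\<close> and ends at or above
    row \<open>d\<close>.\<close>
  define j where "j = - (\<bar>snd u\<bar> + \<bar>c\<bar>)"
  define i where "i = nat (\<bar>snd u\<bar> + \<bar>c\<bar> + \<bar>snd u\<bar> + \<bar>d\<bar>)"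
  have "j * (k * N) \<le> j * 1"
    using kN by (intro mult_left_mono_neg) (simp_all add: j_def)
  then have lo: "snd u + j * (k * N) \<le> c" by (simp add: j_def)
  have ji: "j + int i = \<bar>snd u\<bar> + \<bar>d\<bar>" by (simp add: i_def j_def)
  have "(j + int i) * 1 \<le> (j + int i) * (k * N)"
    using kN by (intro mult_left_mono) (simp_all add: ji)
  moreover have "d \<le> snd u + q" if "(j + int i) * 1 \<le> q" for q using that ji by simp
  ultimately have hi: "d \<le> snd u + (j + int i) * (k * N)" by blast
  obtain a b where ab: "linked \<Lambda> a b" "fst a = - R" "fst b = R" using across by blast
  have "free \<subseteq> {-R..R} \<times> UNIV" by (auto simp: free_def)
  then have "\<Lambda> \<inter> free \<noteq> {}"
    using crossing_paths_meet[OF ab(1) barrier(2) ab(2,3) up[of j i]] lo hi by simp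
  then show False using barrier(1) by (auto simp: free_def)
qed

text \<open>Each connected component of \<open>free\<close> thus projects injectively to the
  cylinder, which is what later carries the plane estimate over to it.\<close>

lemma no_wrap:
  assumes "linked free u v" "fst u = fst v" "snd u mod N = snd v mod N"
  shows "u = v"
proof -
  obtain k where k: "snd v = snd u + k * N"
    using assms(3) by (metis mod_eqE mult.commute)
  have "\<not> 0 < k" using no_wrap_pos[of u k] assms k by (metis prod.collapse)
  moreover have "\<not> k < 0"
  proof
    assume "k < 0"
    have "(fst v, snd v + (- k) * N) = u" using k assms(2) by (simp add: prod_eq_iff)
    then show False using no_wrap_pos[of v "- k"] linked_sym[OF assms(1)] \<open>k < 0\<close> by simp
  qed
  ultimately show ?thesis using k assms(2) by (simp add: prod_eq_iff)
qed

text \<open>If no symmetric copy of the path met the barrier, folding it into the first quadrant would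
  give a left-right path above the axis and a vertical path that, shifted by \<open>N\<close>, still starts below
  the axis; their common vertex would be linked to its own translate.\<close>

theorem symmetric_copy_hits:
  fixes g :: "nat \<Rightarrow> vertex"
  assumes g0: "g 0 = (0, 0)" and adj: "\<And>i. i < K \<Longrightarrow> adjacent (g i) (g (Suc i))"
    and inside: "\<And>i. i \<le> K \<Longrightarrow> \<bar>fst (g i)\<bar> \<le> R \<and> \<bar>snd (g i)\<bar> \<le> R"
    and far: "\<bar>fst (g K)\<bar> = R \<or> \<bar>snd (g K)\<bar> = R"
  shows "\<exists>i\<le>K. \<exists>a b s. \<bar>a\<bar> = 1 \<and> \<bar>b\<bar> = 1 \<and> dih a b s (g i) \<in> \<B>"
proof (rule ccontr)
  assume "\<not> ?thesis"
  then have avoid: "dih a b s (g i) \<notin> \<B>" if "i \<le> K" "\<bar>a\<bar> = 1" "\<bar>b\<bar> = 1" for i a b s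
    using that by blast
  \<comment> \<open>Folded into the first quadrant, and transposed if necessary, the path ends on
    the right side of the square.\<close>
  define h where "h i = (if \<bar>fst (g K)\<bar> = R then (\<bar>fst (g i)\<bar>, \<bar>snd (g i)\<bar>) else (\<bar>snd (g i)\<bar>, \<bar>fst (g i)\<bar>))" for i
  define t where "t = snd (h K)"
  have hK: "h K = (R, t)" using far by (auto simp: h_def t_def)
  have h_in: "0 \<le> fst (h i)" "fst (h i) \<le> R" "0 \<le> snd (h i)" "snd (h i) \<le> R" if "i \<le> K" for i
    using inside[OF that] by (auto simp: h_def)
  have h0: "h 0 = (0, 0)" by (simp add: h_def g0)
  have h_adj: "adjacent (h i) (h (Suc i))" if "i < K" for i
    using adj[OF that] by (auto simp: h_def adjacent_def)
  \<comment> \<open>The signs that undo the folding vary with \<open>i\<close>. For this reason all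
    eight copies of every single vertex are assumed to avoid \<B>.\<close>
  have copy: "\<exists>a' b' s'. \<bar>a'\<bar> = 1 \<and> \<bar>b'\<bar> = 1 \<and> dih a b s (h i) = dih a' b' s' (g i)"
    if ab: "\<bar>a\<bar> = 1" "\<bar>b\<bar> = 1" for a b s i
  proof -
    obtain e f :: int where ef: "\<bar>e\<bar> = 1" "\<bar>f\<bar> = 1" "\<bar>fst (g i)\<bar> = e * fst (g i)" "\<bar>snd (g i)\<bar> = f * snd (g i)"
      using that by (metis abs_1 abs_minus abs_if mult_1 mult_minus1)
    show ?thesis
    proof (cases "\<bar>fst (g K)\<bar> = R")
      case True
      then have "dih a b s (h i) = dih (if s then a * f else a * e) (if s then b * e else b * f) s (g i)"
        by (simp add: h_def dih_def ef)
      moreover have "\<bar>if s then a * f else a * e\<bar> = 1" "\<bar>if s then b * e else b * f\<bar> = 1"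
        using ab ef by (simp_all add: abs_mult)
      ultimately show ?thesis by blast
    next
      case False
      then have "dih a b s (h i) = dih (if s then a * e else a * f) (if s then b * f else b * e) (\<not> s) (g i)"
        by (simp add: h_def dih_def ef)
      moreover have "\<bar>if s then a * e else a * f\<bar> = 1" "\<bar>if s then b * f else b * e\<bar> = 1"
        using ab ef by (simp_all add: abs_mult)
      ultimately show ?thesis by blast
    qed
  qed
  have free: "dih a b s (h i) \<in> free" if "\<bar>a\<bar> = 1" "\<bar>b\<bar> = 1" "i \<le> K" for a b s i
  proof -
    have "dih a b s (h i) \<notin> \<B>" using copy[OF that(1,2), of s i] avoid[OF that(3)] by metis
    moreover have "\<bar>fst (dih a b s (h i))\<bar> \<le> R"
      using h_in[OF that(3)] that by (auto simp: dih_def abs_mult)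
    ultimately show ?thesis by (cases "dih a b s (h i)") (auto simp: free_def abs_le_iff)
  qed
  have link: "linked Y (dih a b s (0, 0)) (dih a b s (h i))"
    if "\<bar>a\<bar> = 1" "\<bar>b\<bar> = 1" "i \<le> K" "\<And>j. j \<le> K \<Longrightarrow> dih a b s (h j) \<in> Y" for Y a b s i
    using linked_sequence[of 0 i "\<lambda>j. dih a b s (h j)" Y] that h_adj h0 adjacent_dih[OF that(1,2)] by simp
  have link_free: "linked free (0, 0) (dih a b s (h i))" if "\<bar>a\<bar> = 1" "\<bar>b\<bar> = 1" "i \<le> K" for a b s i
    using link[OF that, of s free] free[OF that(1,2)] by simp
  define \<Lambda>' where "\<Lambda>' = {dih a 1 False (h i) | a i. \<bar>a\<bar> = 1 \<and> i \<le> K}"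
  define T where "T = {dih 1 b True (h i) | b i. \<bar>b\<bar> = 1 \<and> i \<le> K}"
  define \<Theta>' where "\<Theta>' = (\<lambda>v. (fst v, snd v + N)) ` T"
  have "linked \<Lambda>' (dih (- 1) 1 False (h K)) (dih 1 1 False (h K))"
  proof (rule linked_trans)
    show "linked \<Lambda>' (0, 0) (dih 1 1 False (h K))"
      using link[of 1 1 K False \<Lambda>'] by (force simp: \<Lambda>'_def)
    have "linked \<Lambda>' (0, 0) (dih (- 1) 1 False (h K))"
      using link[of "- 1" 1 K False \<Lambda>'] by (force simp: \<Lambda>'_def)
    then show "linked \<Lambda>' (dih (- 1) 1 False (h K)) (0, 0)" by (rule linked_sym)
  qed
  moreover have "linked T (dih 1 (- 1) True (h K)) (dih 1 1 True (h K))"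
  proof (rule linked_trans)
    show "linked T (0, 0) (dih 1 1 True (h K))"
      using link[of 1 1 K True T] by (force simp: T_def)
    have "linked T (0, 0) (dih 1 (- 1) True (h K))"
      using link[of 1 "- 1" K True T] by (force simp: T_def)
    then show "linked T (dih 1 (- 1) True (h K)) (0, 0)" by (rule linked_sym)
  qed
  then have "linked \<Theta>' (t, - R + N) (t, R + N)"
    using linked_map[of T "dih 1 (- 1) True (h K)" "dih 1 1 True (h K)" "\<lambda>v. (fst v, snd v + N)" \<Theta>']
    by (simp add: \<Theta>'_def adjacent_def dih_def hK)
  moreover have "\<Lambda>' \<subseteq> {-R..R} \<times> {0..R}"
  proof -
    have "- R \<le> a * fst (h i) \<and> a * fst (h i) \<le> R" if "\<bar>a\<bar> = 1" "i \<le> K" for a i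
    proof -
      have "\<bar>a * fst (h i)\<bar> \<le> R" using h_in[OF that(2)] that(1) by (simp add: abs_mult)
      then show ?thesis by (simp add: abs_le_iff)
    qed
    then show ?thesis using h_in by (auto simp: \<Lambda>'_def dih_def)
  qed
  moreover have "\<Theta>' \<subseteq> {-R..R} \<times> UNIV"
    using h_in N by (fastforce simp: \<Theta>'_def T_def dih_def)
  \<comment> \<open>Here \<open>N \<le> R\<close> enters: the shifted vertical path starts in row
    \<open>N - R\<close>, at or below row 0, which bounds \<Lambda>' from below.\<close>
  ultimately have "\<Lambda>' \<inter> \<Theta>' \<noteq> {}"
    using N by (intro crossing_paths_meet[of \<Lambda>' "dih (- 1) 1 False (h K)" "dih 1 1 False (h K)"
          "- R" R 0 R \<Theta>' "(t, - R + N)" "(t, R + N)"]) (simp_all add: dih_def hK)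
  then obtain v where v: "v \<in> \<Lambda>'" "v \<in> \<Theta>'" by blast
  then obtain a i where ai: "\<bar>a\<bar> = 1" "i \<le> K" "v = dih a 1 False (h i)" by (auto simp: \<Lambda>'_def)
  obtain b j where bj: "\<bar>b\<bar> = 1" "j \<le> K" "v = (fst (dih 1 b True (h j)), snd (dih 1 b True (h j)) + N)"
    using v(2) by (auto simp: \<Theta>'_def T_def)
  have "linked free (dih 1 b True (h j)) v"
    using linked_trans[OF link_free linked_sym[OF link_free]] ai bj(1,2) by simp
  then have "dih 1 b True (h j) = v"
    by (rule no_wrap) (use bj(3) in simp_all)
  then show False using bj(3) N by (metis add_cancel_right_right less_irrefl snd_conv)
qed

end

section \<open>Independent environments\<close>

text \<open>All estimates take place in finite windows, where \<open>Pi_pmf\<close> gives a discrete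
  law; \<open>No_Mirror\<close> is its default value outside \<open>V\<close>. The passage to
  \<open>lorentz_law\<close> is made by \<open>prob_lorentz_law_restrict\<close>.\<close>

definition env :: "real \<Rightarrow> vertex set \<Rightarrow> (vertex \<Rightarrow> site) pmf" where
  "env p V = Pi_pmf V No_Mirror (\<lambda>_. site_law p)"

text \<open>For \<open>f = id\<close> and \<open>h = id\<close> this is restriction to
  \<open>S\<close>. Other choices give shifts, rotations, charts of the plane, and reflections, for
  which \<open>h\<close> may exchange the mirrors.\<close>

definition pull :: "vertex set \<Rightarrow> (vertex \<Rightarrow> vertex) \<Rightarrow> (site \<Rightarrow> site) \<Rightarrow> (vertex \<Rightarrow> site) \<Rightarrow> vertex \<Rightarrow> site" where
  "pull S f h \<omega> v = (if v \<in> S then h (\<omega> (f v)) else No_Mirror)"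

fun swap_site :: "site \<Rightarrow> site" where
  "swap_site No_Mirror = No_Mirror"
| "swap_site NW_Mirror = NE_Mirror"
| "swap_site NE_Mirror = NW_Mirror"

lemma swap_swap [simp]: "swap_site (swap_site s) = s"
  by (cases s) auto

lemma map_swap_site_law:
  assumes "0 \<le> p" "p \<le> 1"
  shows "map_pmf swap_site (site_law p) = site_law p"
proof (rule pmf_eqI)
  fix s
  have inj: "inj swap_site" by (metis injI swap_swap)
  have "pmf (map_pmf swap_site (site_law p)) s = pmf (site_law p) (swap_site s)"
    using pmf_map_inj'[OF inj, of "site_law p" "swap_site s"] by simp
  then show "pmf (map_pmf swap_site (site_law p)) s = pmf (site_law p) s"
    using assms by (cases s) (simp_all add: pmf_site_law)
qed

text \<open>Injectivity makes the sites that are read independent, and \<open>h\<close> preserves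
  the law of each of them. The default value outside \<open>S\<close> has to be a fixed point of
  \<open>h\<close>.\<close>

lemma env_pull:
  assumes fin: "finite V" and f: "inj_on f S" "f ` S \<subseteq> V"
    and h: "map_pmf h (site_law p) = site_law p" "h No_Mirror = No_Mirror"
  shows "map_pmf (pull S f h) (env p V) = env p S"
proof -
  have finS: "finite S" using fin f finite_subset finite_imageD by blast
  then have "finite (f ` S)" by simp
  moreover have "infinite (UNIV :: vertex set)" by (simp add: finite_prod)
  \<comment> \<open>A spare vertex: \<open>Pi_pmf_bij_betw\<close> wants the vertices outside
    \<open>S\<close> to be sent outside the image of \<open>S\<close>.\<close>
  ultimately obtain w where w: "w \<notin> f ` S" by (metis ex_new_if_finite)
  define f' where "f' v = (if v \<in> S then f v else w)" for v
  have "bij_betw f' S (f ` S)"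
    using f(1) by (auto simp: bij_betw_def f'_def inj_on_def)
  then have "env p S = map_pmf (\<lambda>g. g \<circ> f') (env p (f ` S))"
    unfolding env_def using finS w by (intro Pi_pmf_bij_betw) (auto simp: f'_def)
  also have "env p (f ` S) = map_pmf (\<lambda>g v. if v \<in> f ` S then g v else No_Mirror) (env p V)"
    unfolding env_def by (rule Pi_pmf_subset[OF fin f(2)])
  finally have 1: "env p S = map_pmf (\<lambda>g v. if v \<in> S then g (f v) else No_Mirror) (env p V)"
    using w by (simp add: pmf.map_comp o_def f'_def) (intro map_pmf_cong refl ext, auto)
  have "env p S = Pi_pmf S No_Mirror (\<lambda>_. map_pmf h (site_law p))"
    unfolding h env_def ..
  also have "\<dots> = map_pmf (\<lambda>g. h \<circ> g) (env p S)"
    using Pi_pmf_map[OF finS, where f = h and dflt = No_Mirror and dflt' = No_Mirror] h(2)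
    unfolding env_def by simp
  also have "\<dots> = map_pmf (pull S f h) (env p V)"
    unfolding 1 by (auto simp: pmf.map_comp o_def pull_def[abs_def] h(2) intro!: map_pmf_cong)
  finally show ?thesis ..
qed

lemma prob_pull:
  assumes "finite V" "inj_on f S" "f ` S \<subseteq> V" "map_pmf h (site_law p) = site_law p" "h No_Mirror = No_Mirror"
  shows "measure_pmf.prob (env p V) {\<omega>. pull S f h \<omega> \<in> E} = measure_pmf.prob (env p S) E"
  by (simp add: env_pull[OF assms, symmetric] vimage_def)

lemma prob_agree:
  assumes "finite V" "W \<subseteq> V"
  shows "measure_pmf.prob (env p V) {\<omega>. \<forall>v\<in>W. \<omega> v = \<sigma> v} = (\<Prod>v\<in>W. pmf (site_law p) (\<sigma> v))"
proof -
  have "finite W" using assms finite_subset by blast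
  have "{\<omega>. \<forall>v\<in>W. \<omega> v = \<sigma> v} = {\<omega>. pull W id id \<omega> \<in> {pull W id id \<sigma>}}"
    by (auto simp: pull_def fun_eq_iff)
  then have "measure_pmf.prob (env p V) {\<omega>. \<forall>v\<in>W. \<omega> v = \<sigma> v} = pmf (env p W) (pull W id id \<sigma>)"
    using prob_pull[of V id W id p "{pull W id id \<sigma>}"] assms by (simp add: measure_pmf_single)
  also have "\<dots> = (\<Prod>v\<in>W. pmf (site_law p) (\<sigma> v))"
    unfolding env_def by (subst pmf_Pi'[OF \<open>finite W\<close>]) (auto simp: pull_def intro!: prod.cong)
  finally show ?thesis .
qed

lemma prob_pair_Times:
  "measure_pmf.prob (pair_pmf M N) (A \<times> B) = measure_pmf.prob M A * measure_pmf.prob N B"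
proof -
  have "measure_pmf.prob (pair_pmf M N) (A \<times> B)
      = measure_pmf.prob (pair_pmf M N) ((A \<times> B) \<inter> set_pmf (pair_pmf M N))"
    by (simp only: measure_Int_set_pmf)
  also have "(A \<times> B) \<inter> set_pmf (pair_pmf M N) = (A \<inter> set_pmf M) \<times> (B \<inter> set_pmf N)"
    by auto
  also have "measure_pmf.prob (pair_pmf M N) \<dots> = measure_pmf.prob M A * measure_pmf.prob N B"
    by (subst measure_pmf_prob_product) (auto simp: measure_Int_set_pmf)
  finally show ?thesis .
qed

text \<open>The event on the left does not depend on the state of \<open>u\<close>, hence is
  independent of this state being \<open>s\<close>; when both happen, the environment lies in
  \<open>D\<close>.\<close>

lemma prob_change_site:
  assumes "finite V" "u \<in> V"
  shows "measure_pmf.prob (env p V) {\<omega>. fun_upd \<omega> u s \<in> D} * pmf (site_law p) s \<le> measure_pmf.prob (env p V) D"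
proof -
  define W where "W = V - {u}"
  have V: "V = insert u W" "finite W" "u \<notin> W" using assms by (auto simp: W_def)
  have env: "env p V = map_pmf (\<lambda>(y, f). fun_upd f u y) (pair_pmf (site_law p) (env p W))"
    unfolding V env_def by (rule Pi_pmf_insert[OF V(2,3)])
  have "measure_pmf.prob (env p V) {\<omega>. fun_upd \<omega> u s \<in> D}
      = measure_pmf.prob (map_pmf snd (pair_pmf (site_law p) (env p W))) {f. fun_upd f u s \<in> D}"
    unfolding env measure_map_pmf by (intro arg_cong[where f = "measure_pmf.prob _"]) auto
  also have "\<dots> = measure_pmf.prob (env p W) {f. fun_upd f u s \<in> D}"
    by (simp add: map_snd_pair_pmf)
  finally have "measure_pmf.prob (env p V) {\<omega>. fun_upd \<omega> u s \<in> D} * pmf (site_law p) s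
      = measure_pmf.prob (site_law p) {s} * measure_pmf.prob (env p W) {f. fun_upd f u s \<in> D}"
    by (simp add: measure_pmf_single)
  also have "\<dots> = measure_pmf.prob (pair_pmf (site_law p) (env p W)) ({s} \<times> {f. fun_upd f u s \<in> D})"
    by (rule prob_pair_Times[symmetric])
  also have "\<dots> \<le> measure_pmf.prob (env p V) D"
    unfolding env measure_map_pmf by (intro measure_pmf.finite_measure_mono) auto
  finally show ?thesis .
qed

lemma prob_pair_section:
  assumes "\<And>x. x \<in> A \<Longrightarrow> c \<le> measure_pmf.prob N {y. (x, y) \<in> E}"
  shows "c * measure_pmf.prob M A \<le> measure_pmf.prob (pair_pmf M N) E"
proof (cases "0 \<le> c")
  case True
  have "ennreal (c * measure_pmf.prob M A) = (\<integral>\<^sup>+x. ennreal c * indicator A x \<partial>M)"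
    using True by (simp add: nn_integral_cmult_indicator ennreal_mult measure_pmf.emeasure_eq_measure)
  also have "\<dots> \<le> (\<integral>\<^sup>+x. \<integral>\<^sup>+y. indicator E (x, y) \<partial>N \<partial>M)"
  proof (intro nn_integral_mono)
    fix x
    have "(\<integral>\<^sup>+y. indicator E (x, y) \<partial>N) = emeasure N {y. (x, y) \<in> E}"
    proof -
      have "(\<lambda>y. indicator E (x, y) :: ennreal) = indicator {y. (x, y) \<in> E}"
        by (auto simp: indicator_def)
      then show ?thesis by simp
    qed
    then show "ennreal c * indicator A x \<le> (\<integral>\<^sup>+y. indicator E (x, y) \<partial>N)"
      using assms[of x] by (auto simp: measure_pmf.emeasure_eq_measure split: split_indicator)
  qed
  also have "\<dots> = emeasure (pair_pmf M N) E"
    by (simp flip: nn_integral_pair_pmf')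
  finally show ?thesis
    by (simp add: measure_pmf.emeasure_eq_measure)
next
  case False
  then show ?thesis
    by (meson measure_nonneg mult_nonpos_nonneg not_le_imp_less less_imp_le order_trans)
qed

text \<open>\<open>U \<omega>\<close> is a stopping set: given \<open>\<omega>\<close> on the explored set \<open>U \<omega>\<close>, the sites outside
  may be resampled without changing the law.\<close>

lemma prob_given_explored:
  assumes fin: "finite V"
    and U: "\<And>\<omega>. U \<omega> \<subseteq> V"
      "\<And>\<omega> \<omega>'. (\<And>v. v \<in> U \<omega> \<Longrightarrow> \<omega>' v = \<omega> v) \<Longrightarrow> U \<omega>' = U \<omega>"
    and K: "\<And>\<omega> \<omega>'. K \<omega> \<Longrightarrow> (\<And>v. v \<in> U \<omega> \<Longrightarrow> \<omega>' v = \<omega> v) \<Longrightarrow> K \<omega>'"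
    and F: "\<And>\<omega> \<omega>' \<xi>. K \<omega> \<Longrightarrow> F \<omega> \<xi> \<Longrightarrow> (\<And>v. v \<in> U \<omega> \<Longrightarrow> \<omega>' v = \<omega> v) \<Longrightarrow> F \<omega>' \<xi>"
      "\<And>\<omega> \<xi> \<xi>'. K \<omega> \<Longrightarrow> F \<omega> \<xi> \<Longrightarrow> (\<And>v. v \<in> V - U \<omega> \<Longrightarrow> \<xi>' v = \<xi> v) \<Longrightarrow> F \<omega> \<xi>'"
    and c: "\<And>\<omega>. K \<omega> \<Longrightarrow> c \<le> measure_pmf.prob (env p V) {\<xi>. F \<omega> \<xi>}"
  shows "c * measure_pmf.prob (env p V) {\<omega>. K \<omega>} \<le> measure_pmf.prob (env p V) {\<omega>. K \<omega> \<and> F \<omega> \<omega>}"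
proof -
  \<comment> \<open>The explored part of \<omega> is kept and the rest is taken from an independent
    copy \<xi>.\<close>
  define mix where "mix = (\<lambda>(\<omega>, \<xi>) v. if v \<in> U \<omega> then \<omega> v else if v \<in> V then \<xi> v else No_Mirror)"
  have mix_env: "map_pmf mix (pair_pmf (env p V) (env p V)) = env p V"
  proof (rule pmf_eqI)
    fix \<sigma>
    have "pmf (map_pmf mix (pair_pmf (env p V) (env p V))) \<sigma>
        = measure_pmf.prob (pair_pmf (env p V) (env p V)) (mix -` {\<sigma>})"
      by (simp add: pmf_map)
    also have "\<dots> = pmf (env p V) \<sigma>"
    proof (cases "\<forall>v. v \<notin> V \<longrightarrow> \<sigma> v = No_Mirror")
      case True
      \<comment> \<open>Over \<sigma> the explored set is constantly \<open>U \<sigma>\<close>, so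
        the fibre is a rectangle and its probability factorizes.\<close>
      have "mix -` {\<sigma>} = {\<omega>. \<forall>v\<in>U \<sigma>. \<omega> v = \<sigma> v} \<times> {\<xi>. \<forall>v\<in>V - U \<sigma>. \<xi> v = \<sigma> v}"
      proof (intro set_eqI iffI)
        fix z assume "z \<in> mix -` {\<sigma>}"
        then obtain \<omega> \<xi> where z: "z = (\<omega>, \<xi>)" "mix (\<omega>, \<xi>) = \<sigma>" by (cases z) auto
        then have "U \<sigma> = U \<omega>" by (intro U(2)) (auto simp: mix_def)
        then show "z \<in> {\<omega>. \<forall>v\<in>U \<sigma>. \<omega> v = \<sigma> v} \<times> {\<xi>. \<forall>v\<in>V - U \<sigma>. \<xi> v = \<sigma> v}"
          using z by (auto simp: mix_def)
      next
        fix z assume z: "z \<in> {\<omega>. \<forall>v\<in>U \<sigma>. \<omega> v = \<sigma> v} \<times> {\<xi>. \<forall>v\<in>V - U \<sigma>. \<xi> v = \<sigma> v}"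
        then have "U (fst z) = U \<sigma>" by (intro U(2)) auto
        then show "z \<in> mix -` {\<sigma>}"
          using z True by (auto simp: mix_def fun_eq_iff split: prod.splits)
      qed
      then have "measure_pmf.prob (pair_pmf (env p V) (env p V)) (mix -` {\<sigma>})
          = (\<Prod>v\<in>U \<sigma>. pmf (site_law p) (\<sigma> v)) * (\<Prod>v\<in>V - U \<sigma>. pmf (site_law p) (\<sigma> v))"
        by (simp add: prob_pair_Times prob_agree[OF fin] U(1))
      also have "\<dots> = (\<Prod>v\<in>V. pmf (site_law p) (\<sigma> v))"
        using prod.subset_diff[OF U(1) fin, of "\<lambda>v. pmf (site_law p) (\<sigma> v)" \<sigma>] by (simp add: mult.commute)
      also have "\<dots> = pmf (env p V) \<sigma>"
        unfolding env_def using True by (intro pmf_Pi'[OF fin, symmetric]) blast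
      finally show ?thesis .
    next
      case False
      then obtain v where v: "v \<notin> V" "\<sigma> v \<noteq> No_Mirror" by blast
      have "mix z v = No_Mirror" for z
        using v(1) U(1)[of "fst z"] by (auto simp: mix_def split: prod.splits)
      then have "mix -` {\<sigma>} = {}" using v(2) by force
      moreover have "pmf (env p V) \<sigma> = 0"
        using False by (auto simp: env_def intro!: pmf_Pi_outside[OF fin])
      ultimately show ?thesis by simp
    qed
    finally show "pmf (map_pmf mix (pair_pmf (env p V) (env p V))) \<sigma> = pmf (env p V) \<sigma>" .
  qed
  have "c * measure_pmf.prob (env p V) {\<omega>. K \<omega>}
      \<le> measure_pmf.prob (pair_pmf (env p V) (env p V)) {(\<omega>, \<xi>). K \<omega> \<and> F \<omega> \<xi>}"
    by (rule prob_pair_section) (use c in auto)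
  also have "\<dots> \<le> measure_pmf.prob (pair_pmf (env p V) (env p V)) (mix -` {\<omega>. K \<omega> \<and> F \<omega> \<omega>})"
  proof (intro measure_pmf.finite_measure_mono subsetI)
    fix z assume "z \<in> {(\<omega>, \<xi>). K \<omega> \<and> F \<omega> \<xi>}"
    then obtain \<omega> \<xi> where z: "z = (\<omega>, \<xi>)" "K \<omega>" "F \<omega> \<xi>" by auto
    have agree: "\<And>v. v \<in> U \<omega> \<Longrightarrow> mix z v = \<omega> v" by (simp add: mix_def z)
    have "F \<omega> (mix z)"
      using z(2,3) by (rule F(2)) (simp add: mix_def z)
    then show "z \<in> mix -` {\<omega>. K \<omega> \<and> F \<omega> \<omega>}"
      using K[OF z(2) agree] F(1)[OF z(2) _ agree] by simp
  qed simp
  also have "\<dots> = measure_pmf.prob (map_pmf mix (pair_pmf (env p V) (env p V))) {\<omega>. K \<omega> \<and> F \<omega> \<omega>}"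
    by simp
  finally show ?thesis unfolding mix_env .
qed

section \<open>Rays that travel far\<close>

definition square :: "int \<Rightarrow> vertex set" where
  "square R = {-R..R} \<times> {-R..R}"

definition path_vertex :: "int \<Rightarrow> (vertex \<Rightarrow> site) \<Rightarrow> directed_edge \<Rightarrow> nat \<Rightarrow> vertex" where
  "path_vertex m \<omega> e i = fst (ray m \<omega> e i)"

definition reaches :: "int \<Rightarrow> (vertex \<Rightarrow> site) \<Rightarrow> nat \<Rightarrow> bool" where
  "reaches R \<omega> k \<longleftrightarrow>
     (\<forall>i<k. \<bar>fst (path_vertex 0 \<omega> ((0, 0), East) i)\<bar> < R \<and> \<bar>snd (path_vertex 0 \<omega> ((0, 0), East) i)\<bar> < R) \<and>
     max \<bar>fst (path_vertex 0 \<omega> ((0, 0), East) k)\<bar> \<bar>snd (path_vertex 0 \<omega> ((0, 0), East) k)\<bar> = R"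

lemma finite_square [simp]: "finite (square R)"
  by (simp add: square_def)

text \<open>An odd number of crossings is never zero, so some entry crosses; by rotation invariance
  all \<open>m\<close> entries are equally likely to do so.\<close>

lemma prob_crosses_odd_cylinder:
  assumes "odd m" "0 < m" "0 \<le> L" "y \<in> {0..<m}"
  shows "1 / real_of_int m \<le> measure_pmf.prob (env p ({1..L} \<times> {0..<m})) {\<omega>. y \<in> crossings m \<omega> L}"
proof -
  let ?S = "{1..L} \<times> {0..<m}"
  have le: "measure_pmf.prob (env p ?S) {\<omega>. y' \<in> crossings m \<omega> L}
      \<le> measure_pmf.prob (env p ?S) {\<omega>. y \<in> crossings m \<omega> L}" if y': "y' \<in> {0..<m}" for y'
  proof -
    define f where "f v = (fst v, (snd v + (y' - y)) mod m)" for v :: vertex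
    define f' where "f' v = (fst v, (snd v + (y - y')) mod m)" for v :: vertex
    have ff': "f (f' v) = v" "f' (f v) = v" if "snd v \<in> {0..<m}" for v
      using that by (simp_all add: f_def f'_def prod_eq_iff mod_add_left_eq)
    have "inj_on f ?S"
      by (rule inj_on_inverseI[of _ f']) (use ff' in auto)
    moreover have "f ` ?S \<subseteq> ?S"
      using assms(2) by (auto simp: f_def)
    ultimately have "measure_pmf.prob (env p ?S) {\<omega>. y \<in> crossings m \<omega> L}
        = measure_pmf.prob (env p ?S) {\<omega>. pull ?S f id \<omega> \<in> {\<omega>. y \<in> crossings m \<omega> L}}"
      by (intro prob_pull[symmetric]) simp_all
    moreover have "y \<in> crossings m (pull ?S f id \<omega>) L" if cr: "y' \<in> crossings m \<omega> L" for \<omega>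
    proof -
      let ?e = "ray m \<omega> (entry y')"
      obtain k where k: "exits_at m \<omega> L y' (L + 1) k"
        using cr by (auto simp: crossings_def)
      have v: "valid m (?e j)" for j by (rule valid_ray[OF valid_entry[OF y']])
      have rng: "snd (fst (?e j)) \<in> {0..<m}" for j by (rule valid_range[OF v assms(2)])
      have rngt: "snd (target m (?e j)) \<in> {0..<m}" for j using rng[of "Suc j"] by simp
      have nb: "target m (f' (fst e), snd e) = f' (target m e)" for e
      proof -
        obtain a b d where "e = ((a, b), d)" by (metis surj_pair)
        then show ?thesis
          by (cases d; simp add: target_def f'_def mod_add_left_eq mod_diff_left_eq; simp add: algebra_simps)
      qed
      have "ray m (pull ?S f id \<omega>) (f' (fst (entry y')), snd (entry y')) i = (f' (fst (?e i)), snd (?e i))" if "i \<le> k" for i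
      proof (rule ray_transport[of "\<lambda>d. d" id k m f' m \<omega> "entry y'"])
        fix j assume "j < k"
        then have t: "target m (?e j) \<in> ?S"
          using k rngt[of j] by (auto simp: exits_at_def col_def mem_Times_iff)
        then have "f' (target m (?e j)) \<in> ?S"
          using assms(2) by (auto simp: f'_def)
        then show "pull ?S f id \<omega> (f' (target m (?e j))) = id (\<omega> (target m (?e j)))"
          using ff'(1)[OF rngt] by (simp add: pull_def)
      qed (use that nb in auto)
      moreover have "f' (fst (entry y')) = (0, y)"
        using assms(4) by (simp add: f'_def)
      ultimately have r: "ray m (pull ?S f id \<omega>) (entry y) i = (f' (fst (?e i)), snd (?e i))" if "i \<le> k" for i
        using that by simp
      have "col m (pull ?S f id \<omega>) y i = col m \<omega> y' i" if "i \<le> k" for i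
        unfolding col_def r[OF that] nb by (simp add: f'_def)
      then have "exits_at m (pull ?S f id \<omega>) L y (L + 1) k"
        using k unfolding exits_at_def by (metis less_imp_le order_refl)
      then show ?thesis using assms(4) unfolding crossings_def by blast
    qed
    ultimately show ?thesis
      by (auto intro!: measure_pmf.finite_measure_mono)
  qed
  have "crossings m \<omega> L \<noteq> {}" for \<omega>
    using card_crossings_parity[of L m \<omega>] assms by auto
  then have "(\<Union>y'\<in>{0..<m}. {\<omega>. y' \<in> crossings m \<omega> L}) = UNIV"
    using crossings_subset by fast
  then have "1 = measure_pmf.prob (env p ?S) (\<Union>y'\<in>{0..<m}. {\<omega>. y' \<in> crossings m \<omega> L})"
    by simp
  also have "\<dots> \<le> (\<Sum>y'\<in>{0..<m}. measure_pmf.prob (env p ?S) {\<omega>. y' \<in> crossings m \<omega> L})"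
    by (intro measure_pmf.finite_measure_subadditive_finite) auto
  also have "\<dots> \<le> (\<Sum>y'\<in>{0..<m}. measure_pmf.prob (env p ?S) {\<omega>. y \<in> crossings m \<omega> L})"
    by (intro sum_mono le)
  also have "\<dots> = m * measure_pmf.prob (env p ?S) {\<omega>. y \<in> crossings m \<omega> L}"
    using assms(2) by simp
  finally show ?thesis using assms(2) by (simp add: field_simps)
qed

text \<open>Compare with the cylinder of circumference \<open>2 * R + 1\<close> and a slab of
  \<open>R - 1\<close> columns, entered in the middle row \<open>R\<close>. Until it reaches row 0,
  row \<open>2 * R\<close> or column \<open>R\<close>, the ray cannot tell this cylinder from the
  plane.\<close>

lemma prob_reaches:
  assumes "0 < R"
  shows "1 / real_of_int (2 * R + 1) \<le> measure_pmf.prob (env p (square R)) {\<omega>. \<exists>k. reaches R \<omega> k}"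
proof -
  define m where "m = 2 * R + 1"
  let ?S = "{1..R - 1} \<times> {0..<m}"
  define f where "f v = (fst v, snd v - R)" for v :: vertex
  have "inj_on f ?S" by (auto simp: f_def inj_on_def)
  moreover have "f ` ?S \<subseteq> square R" by (auto simp: f_def square_def m_def)
  ultimately have "measure_pmf.prob (env p (square R)) {\<omega>. pull ?S f id \<omega> \<in> {\<omega>. R \<in> crossings m \<omega> (R - 1)}}
      = measure_pmf.prob (env p ?S) {\<omega>. R \<in> crossings m \<omega> (R - 1)}"
    by (intro prob_pull) simp_all
  moreover have "1 / real_of_int m \<le> measure_pmf.prob (env p ?S) {\<omega>. R \<in> crossings m \<omega> (R - 1)}"
    using assms by (intro prob_crosses_odd_cylinder) (auto simp: m_def)
  moreover have "\<exists>k. reaches R \<omega> k" if cr: "R \<in> crossings m (pull ?S f id \<omega>) (R - 1)" for \<omega>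
  proof -
    let ?\<xi> = "pull ?S f id \<omega>"
    let ?e = "ray m ?\<xi> (entry R)"
    obtain k where k: "exits_at m ?\<xi> (R - 1) R R k" and R: "R \<in> {0..<m}"
      using cr by (auto simp: crossings_def)
    define far where "far i \<longleftrightarrow> fst (fst (?e i)) = R \<or> snd (fst (?e i)) \<in> {0, 2 * R}" for i
    have c: "fst (fst (?e (Suc i))) = col m ?\<xi> R i" for i by (simp add: col_def)
    define l where "l = (LEAST i. far i)"
    have farS: "far (Suc k)" using k c[of k] by (simp add: far_def exits_at_def del: fst_ray_Suc)
    then have l: "far l" "l \<le> Suc k" unfolding l_def by (rule LeastI, rule Least_le)
    have near: "\<not> far i" if "i < l" for i using that not_less_Least unfolding l_def by blast
    have rng: "snd (fst (?e i)) \<in> {0..<m}" for i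
      using valid_range[OF valid_ray[OF valid_entry[OF R]]] R by simp
    have x: "fst (fst (?e i)) \<in> {0..R}" if "i \<le> Suc k" for i
    proof (cases i)
      case (Suc j)
      have "col m ?\<xi> R j \<in> {0..R}"
      proof (cases "j = k")
        case False
        then have "j < k" using that Suc by simp
        then have "col m ?\<xi> R j \<in> {1..R - 1}" using k unfolding exits_at_def by blast
        then show ?thesis by simp
      qed (use k assms in \<open>simp add: exits_at_def\<close>)
      then show ?thesis unfolding Suc c .
    qed (use assms in simp)
    have y: "0 < snd (fst (?e i))" "snd (fst (?e i)) < 2 * R" if "i < l" for i
      using near[OF that] rng[of i] by (auto simp: far_def m_def)
    have nb: "target 0 (f (fst (?e i)), snd (?e i)) = f (target m (?e i))" if "i < l" for i
    proof -
      obtain a b d where e: "?e i = ((a, b), d)" by (metis surj_pair)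
      then show ?thesis
        using y[OF that] by (cases d) (auto simp: target_def f_def m_def)
    qed
    \<comment> \<open>The vertex at time \<open>l\<close> may lie outside the slab, where
      \<open>pull\<close> has forgotten the state; the position at time \<open>l\<close> is
      determined by the earlier sites.\<close>
    have r: "ray 0 \<omega> (f (fst (entry R)), snd (entry R)) i = (f (fst (?e i)), snd (?e i))" if "i < l" for i
    proof (rule ray_transport[of "\<lambda>d. d" id "l - 1" 0 f m ?\<xi> "entry R"])
      fix j assume j: "j < l - 1"
      then have "Suc j < l" by simp
      then have "fst (fst (?e (Suc j))) \<noteq> R" using near[of "Suc j"] by (simp add: far_def del: fst_ray_Suc)
      moreover have "j < k"
        using \<open>Suc j < l\<close> l(2) by simp
      ultimately have "target m (?e j) \<in> ?S"
        using k rng[of "Suc j"] by (auto simp: exits_at_def col_def mem_Times_iff)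
      then show "\<omega> (f (target m (?e j))) = id (?\<xi> (target m (?e j)))"
        by (simp add: pull_def)
    qed (use that nb in auto)
    have "\<not> far 0" using assms by (auto simp: far_def)
    then have l0: "0 < l" using l(1) by (cases l) auto
    have pv: "path_vertex 0 \<omega> ((0, 0), East) i = f (fst (?e i))" if "i \<le> l" for i
    proof (cases "i = 0")
      case True
      then show ?thesis by (simp add: path_vertex_def f_def)
    next
      case False
      then obtain j where j: "i = Suc j" by (metis not0_implies_Suc)
      have "f (fst (entry R)) = (0, 0)" by (simp add: f_def)
      then show ?thesis
        using r[of j] nb[of j] that j by (simp add: path_vertex_def)
    qed
    have "reaches R \<omega> l"
      unfolding reaches_def
    proof (intro conjI allI impI)
      fix i assume i: "i < l"
      show "\<bar>fst (path_vertex 0 \<omega> ((0, 0), East) i)\<bar> < R"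
        using pv[of i] x[of i] near[OF i] i l(2) by (auto simp: f_def far_def)
      show "\<bar>snd (path_vertex 0 \<omega> ((0, 0), East) i)\<bar> < R"
        using pv[of i] y[OF i] i by (auto simp: f_def)
    next
      show "max \<bar>fst (path_vertex 0 \<omega> ((0, 0), East) l)\<bar> \<bar>snd (path_vertex 0 \<omega> ((0, 0), East) l)\<bar> = R"
        using pv[of l] x[of l] rng[of l] l by (auto simp: f_def far_def m_def)
    qed
    then show ?thesis by blast
  qed
  ultimately show ?thesis
    unfolding m_def by (smt (verit) Collect_mono measure_pmf.finite_measure_mono mem_Collect_eq sets_measure_pmf UNIV_I)
qed

section \<open>Hitting the barrier\<close>

lemma path_vertex_0 [simp]: "path_vertex m \<omega> e 0 = fst e"
  by (simp add: path_vertex_def)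

text \<open>Positions lag one step behind sites: the vertex at time \<open>k\<close> is determined
  by the sites at times strictly between 0 and \<open>k\<close>. Hence the range of
  \<open>j\<close>, which lets a path start and end on explored sites.\<close>

lemma path_transport:
  assumes opp: "\<And>d. opposite (g d) = g (opposite d)"
    and pair: "\<And>s d. paired (h s) (g d) = g (paired s d)"
    and nb: "\<And>v d. nbr m' (f v) (g d) = f (nbr m v d)"
    and site: "\<And>j. 0 < j \<Longrightarrow> j < k \<Longrightarrow> \<omega>' (f (path_vertex m \<omega> e j)) = h (\<omega> (path_vertex m \<omega> e j))"
    and "i \<le> k"
  shows "path_vertex m' \<omega>' (f (fst e), g (snd e)) i = f (path_vertex m \<omega> e i)"
proof (cases i)
  case (Suc j)
  have "ray m' \<omega>' (f (fst e), g (snd e)) j = (f (fst (ray m \<omega> e j)), g (snd (ray m \<omega> e j)))"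
  proof (rule ray_transport[where k = j, OF opp pair])
    fix l assume "l < j"
    then show "\<omega>' (f (target m (ray m \<omega> e l))) = h (\<omega> (target m (ray m \<omega> e l)))"
      using site[of "Suc l"] Suc \<open>i \<le> k\<close> by (simp add: path_vertex_def)
  qed (auto simp: target_def nb)
  then show ?thesis
    using Suc by (simp add: path_vertex_def target_def nb)
qed simp

lemma path_cong:
  assumes "\<And>j. 0 < j \<Longrightarrow> j < k \<Longrightarrow> \<omega>' (path_vertex m \<omega> e j) = \<omega> (path_vertex m \<omega> e j)" "i \<le> k"
  shows "path_vertex m \<omega>' e i = path_vertex m \<omega> e i"
  using path_transport[of "\<lambda>d. d" "\<lambda>s. s" m "\<lambda>v. v" m k \<omega>' \<omega> e i] assms by simp

lemma adjacent_nbr_plane: "adjacent u (nbr 0 u d)"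
  by (cases u; cases d) (auto simp: adjacent_def)

lemma adjacent_path: "adjacent (path_vertex 0 \<omega> e i) (path_vertex 0 \<omega> e (Suc i))"
  by (simp add: path_vertex_def target_def adjacent_nbr_plane)

definition hits :: "int \<Rightarrow> vertex set \<Rightarrow> direction \<Rightarrow> (vertex \<Rightarrow> site) \<Rightarrow> nat \<Rightarrow> bool" where
  "hits R \<B> d \<omega> k \<longleftrightarrow> path_vertex 0 \<omega> ((0, 0), d) k \<in> \<B> \<and>
     (\<forall>i<k. path_vertex 0 \<omega> ((0, 0), d) i \<in> square R - \<B>)"

fun dih_dir :: "int \<Rightarrow> int \<Rightarrow> bool \<Rightarrow> direction \<Rightarrow> direction" where
  "dih_dir a b s East = (if s then if b = 1 then North else South else if a = 1 then East else West)"
| "dih_dir a b s West = (if s then if b = 1 then South else North else if a = 1 then West else East)"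
| "dih_dir a b s North = (if s then if a = 1 then East else West else if b = 1 then North else South)"
| "dih_dir a b s South = (if s then if a = 1 then West else East else if b = 1 then South else North)"

text \<open>The transposition preserves both diagonals and a reflection in an axis exchanges them,
  so the mirrors are swapped exactly when one sign is negative.\<close>

definition dih_site :: "int \<Rightarrow> int \<Rightarrow> site \<Rightarrow> site" where
  "dih_site a b = (if a = b then id else swap_site)"

lemma abs_eq_1: "\<bar>a\<bar> = 1 \<longleftrightarrow> a = 1 \<or> a = (- 1 :: int)"
  by auto

lemma opposite_dih_dir: "opposite (dih_dir a b s d) = dih_dir a b s (opposite d)"
  by (cases d) auto

lemma paired_dih:
  assumes "\<bar>a\<bar> = 1" "\<bar>b\<bar> = 1"
  shows "paired (dih_site a b t) (dih_dir a b s d) = dih_dir a b s (paired t d)"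
  using assms unfolding abs_eq_1
  by (elim disjE; cases s; cases t; cases d; simp add: dih_site_def)

lemma nbr_dih:
  assumes "\<bar>a\<bar> = 1" "\<bar>b\<bar> = 1"
  shows "nbr 0 (dih a b s v) (dih_dir a b s d) = dih a b s (nbr 0 v d)"
  using assms unfolding abs_eq_1
  by (cases v; elim disjE; cases s; cases d; simp add: dih_def)

text \<open>Inverting a transposed symmetry exchanges its two signs.\<close>

lemma dih_dih:
  assumes "\<bar>a\<bar> = 1" "\<bar>b\<bar> = 1"
  shows "dih (if s then b else a) (if s then a else b) s (dih a b s v) = v"
  using assms unfolding abs_eq_1 by (elim disjE; simp add: dih_def)

lemma dih_square:
  assumes "\<bar>a\<bar> = 1" "\<bar>b\<bar> = 1" "v \<in> square R"
  shows "dih a b s v \<in> square R"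
  using assms unfolding abs_eq_1 by (elim disjE; force simp: dih_def square_def)

context periodic_barrier
begin

text \<open>Which symmetric copy hits depends on the environment. A union bound over the eight
  symmetries, each of which preserves the law, singles out one that hits with at least an eighth of
  the probability in \<open>prob_reaches\<close>; only its starting direction \<open>e\<close> is
  recorded.\<close>

lemma exists_hitting_direction:
  assumes p: "0 \<le> p" "p \<le> 1" and origin: "(0, 0) \<notin> \<B>"
  obtains e where "1 / (8 * real_of_int (2 * R + 1)) \<le> measure_pmf.prob (env p (square R)) {\<omega>. \<exists>k. hits R \<B> e \<omega> k}"
proof -
  let ?P = "measure_pmf.prob (env p (square R))"
  let ?H = "\<lambda>e. {\<omega>. \<exists>k. hits R \<B> e \<omega> k}"
  let ?D = "{1, - 1 :: int} \<times> {1, - 1 :: int} \<times> (UNIV :: bool set)"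
  \<comment> \<open>An environment is moved by a symmetry by reading it at the inverse image, hence
    the exchanged signs.\<close>
  define T where "T = (\<lambda>(a, b, s). pull (square R) (dih (if s then b else a) (if s then a else b) s) (dih_site a b))"
  define dir where "dir = (\<lambda>(a, b, s). dih_dir a b s East)"
  have R: "0 < R" using N by simp
  have "\<exists>\<sigma>\<in>?D. T \<sigma> \<omega> \<in> ?H (dir \<sigma>)" if reach: "reaches R \<omega> k" for \<omega> k
  proof -
    let ?g = "path_vertex 0 \<omega> ((0, 0), East)"
    have near: "\<bar>fst (?g i)\<bar> < R \<and> \<bar>snd (?g i)\<bar> < R" if "i < k" for i
      using reach that by (simp add: reaches_def)
    have far: "max \<bar>fst (?g k)\<bar> \<bar>snd (?g k)\<bar> = R"
      using reach by (simp add: reaches_def)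
    have inside: "\<bar>fst (?g i)\<bar> \<le> R \<and> \<bar>snd (?g i)\<bar> \<le> R" if "i \<le> k" for i
      using near[of i] far that by (cases "i = k") auto
    have "\<exists>i\<le>k. \<exists>a b s. \<bar>a\<bar> = 1 \<and> \<bar>b\<bar> = 1 \<and> dih a b s (?g i) \<in> \<B>"
    proof (rule symmetric_copy_hits)
      show "\<bar>fst (?g k)\<bar> = R \<or> \<bar>snd (?g k)\<bar> = R" using far by (auto simp: max_def split: if_splits)
    qed (use inside adjacent_path in auto)
    then obtain i a b s where i: "i \<le> k" and ab: "\<bar>a\<bar> = 1" "\<bar>b\<bar> = 1" and hit: "dih a b s (?g i) \<in> \<B>"
      by blast
    define l where "l = (LEAST i. dih a b s (?g i) \<in> \<B>)"
    have l: "dih a b s (?g l) \<in> \<B>" "l \<le> i"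
      unfolding l_def by (rule LeastI[of _ i], rule hit, rule Least_le, rule hit)
    have before: "dih a b s (?g j) \<notin> \<B>" if "j < l" for j
      using that not_less_Least unfolding l_def by blast
    have sq: "?g j \<in> square R" if "j \<le> k" for j
      using inside[OF that] by (cases "?g j") (auto simp: square_def abs_le_iff)
    let ?\<omega> = "T (a, b, s) \<omega>"
    have "path_vertex 0 ?\<omega> (dih a b s (fst ((0, 0), East)), dih_dir a b s (snd ((0 :: int, 0 :: int), East))) j = dih a b s (?g j)"
      if "j \<le> k" for j
    proof (rule path_transport[where h = "dih_site a b" and k = k])
      fix j assume "0 < j" "j < k"
      then show "?\<omega> (dih a b s (?g j)) = dih_site a b (\<omega> (?g j))"
        using dih_square[OF ab sq] dih_dih[OF ab, of s "?g j"] by (simp add: T_def pull_def)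
    qed (use that opposite_dih_dir paired_dih[OF ab] nbr_dih[OF ab] in auto)
    then have g': "path_vertex 0 ?\<omega> ((0, 0), dir (a, b, s)) j = dih a b s (?g j)" if "j \<le> k" for j
      using that by (simp add: dir_def)
    have "hits R \<B> (dir (a, b, s)) ?\<omega> l"
      using g' l i before dih_square[OF ab sq] by (auto simp: hits_def)
    moreover have "(a, b, s) \<in> ?D" using ab unfolding abs_eq_1 by auto
    ultimately show ?thesis by blast
  qed
  then have "{\<omega>. \<exists>k. reaches R \<omega> k} \<subseteq> (\<Union>\<sigma>\<in>?D. {\<omega>. T \<sigma> \<omega> \<in> ?H (dir \<sigma>)})"
    by blast
  then have "?P {\<omega>. \<exists>k. reaches R \<omega> k} \<le> ?P (\<Union>\<sigma>\<in>?D. {\<omega>. T \<sigma> \<omega> \<in> ?H (dir \<sigma>)})"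
    by (intro measure_pmf.finite_measure_mono) auto
  also have "\<dots> \<le> (\<Sum>\<sigma>\<in>?D. ?P {\<omega>. T \<sigma> \<omega> \<in> ?H (dir \<sigma>)})"
    by (intro measure_pmf.finite_measure_subadditive_finite) auto
  also have "\<dots> = (\<Sum>\<sigma>\<in>?D. ?P (?H (dir \<sigma>)))"
  proof (intro sum.cong refl)
    fix \<sigma> assume "\<sigma> \<in> ?D"
    then obtain a b s where \<sigma>: "\<sigma> = (a, b, s)" "\<bar>a\<bar> = 1" "\<bar>b\<bar> = 1" by auto
    let ?a = "if s then b else a" and ?b = "if s then a else b"
    have ab': "\<bar>?a\<bar> = 1" "\<bar>?b\<bar> = 1" using \<sigma> by auto
    have "inj_on (dih ?a ?b s) (square R)"
      by (rule inj_on_inverseI[of _ "dih (if s then ?b else ?a) (if s then ?a else ?b) s"]) (rule dih_dih[OF ab'])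
    then show "?P {\<omega>. T \<sigma> \<omega> \<in> ?H (dir \<sigma>)} = ?P (?H (dir \<sigma>))"
      unfolding T_def \<sigma>(1) prod.case
      by (intro prob_pull) (use dih_square[OF ab'] map_swap_site_law[OF p] in \<open>auto simp: dih_site_def\<close>)
  qed
  finally have le: "?P {\<omega>. \<exists>k. reaches R \<omega> k} \<le> (\<Sum>\<sigma>\<in>?D. ?P (?H (dir \<sigma>)))" .
  have "\<exists>e. 1 / (8 * real_of_int (2 * R + 1)) \<le> ?P (?H e)"
  proof (rule ccontr)
    assume "\<not> ?thesis"
    then have "(\<Sum>\<sigma>\<in>?D. ?P (?H (dir \<sigma>))) < (\<Sum>\<sigma>\<in>?D. 1 / (8 * real_of_int (2 * R + 1)))"
      by (intro sum_strict_mono) (auto simp: not_le)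
    also have "\<dots> = 1 / real_of_int (2 * R + 1)"
      using R by (simp add: divide_simps)
    finally show False using le prob_reaches[OF R, of p] by linarith
  qed
  then show ?thesis using that by blast
qed

end

text \<open>The part of the plane that is linked to the centre without meeting the barrier projects
  injectively to the cylinder, so the plane ray and the cylinder ray have the same law until they
  hit.\<close>

lemma exists_hitting_direction_cylinder:
  fixes R N x0 yz :: int
  defines "f \<equiv> \<lambda>v. (x0 + fst v, (yz + snd v) mod N)"
  assumes N: "0 < N" "N \<le> R" and p: "0 \<le> p" "p \<le> 1" and yz: "yz \<in> {0..<N}"
    and z: "(x0, yz) \<notin> B"
    and \<Lambda>: "linked \<Lambda> u v" "fst u = - R" "fst v = R" "\<Lambda> \<subseteq> {-R..R} \<times> {c..c'}" "f ` \<Lambda> \<subseteq> B"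
  obtains d where "1 / (8 * real_of_int (2 * R + 1)) \<le>
    measure_pmf.prob (env p ({x0 - R..x0 + R} \<times> {0..<N}))
      {\<xi>. \<exists>k. path_vertex N \<xi> ((x0, yz), d) k \<in> B \<and>
        (\<forall>i<k. path_vertex N \<xi> ((x0, yz), d) i \<in> {x0 - R..x0 + R} \<times> {0..<N} - B)}"
proof -
  let ?V = "{x0 - R..x0 + R} \<times> {0..<N}"
  define \<B> where "\<B> = {u. f u \<in> B}"
  interpret periodic_barrier R N \<B> \<Lambda> c c'
  proof
    show "((x, y) \<in> \<B>) = ((x, y + k * N) \<in> \<B>)" for x y k
      by (simp add: \<B>_def f_def flip: add.assoc)
    show "\<exists>u v. linked \<Lambda> u v \<and> fst u = - R \<and> fst v = R"
      using \<Lambda>(1-3) by blast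
  qed (use N \<Lambda> in \<open>auto simp: \<B>_def\<close>)
  have f0: "f (0, 0) = (x0, yz)" using yz by (simp add: f_def)
  then have "(0, 0) \<notin> \<B>" using z by (simp add: \<B>_def)
  then obtain e where e: "1 / (8 * real_of_int (2 * R + 1)) \<le> measure_pmf.prob (env p (square R)) {\<omega>. \<exists>k. hits R \<B> e \<omega> k}"
    using exists_hitting_direction[OF p] by blast
  define S where "S = {w. linked (square R - \<B>) (0, 0) w}"
  have S: "S \<subseteq> square R - \<B>" unfolding S_def using linked_in by blast
  have fin: "finite S" using S finite_subset finite_square by blast
  have free: "square R - \<B> \<subseteq> free" by (auto simp: square_def free_def)
  have "inj_on f S"
  proof
    fix a b assume ab: "a \<in> S" "b \<in> S" "f a = f b"
    have "linked free (0, 0) w" if "w \<in> S" for w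
      using that linked_mono[OF _ free] unfolding S_def by blast
    then have "linked free a b"
      using linked_trans[OF _ linked_sym] ab(1,2) by blast
    moreover have "fst a = fst b" "(yz + snd a) mod N = (yz + snd b) mod N"
      using ab(3) by (simp_all add: f_def)
    then have "fst a = fst b" "snd a mod N = snd b mod N"
      by (simp_all add: mod_eq_dvd_iff)
    ultimately show "a = b" by (intro no_wrap)
  qed
  moreover have fS: "f ` S \<subseteq> ?V"
    using S N(1) by (auto simp: f_def square_def)
  ultimately have eq: "measure_pmf.prob (env p ?V) {\<xi>. pull S f id \<xi> \<in> {\<omega>. \<exists>k. hits R \<B> e \<omega> k}}
      = measure_pmf.prob (env p S) {\<omega>. \<exists>k. hits R \<B> e \<omega> k}"
    by (intro prob_pull) simp_all
  have link: "path_vertex 0 \<omega> ((0, 0), e) i \<in> S"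
    if "\<And>j. j \<le> i \<Longrightarrow> path_vertex 0 \<omega> ((0, 0), e) j \<in> square R - \<B>" for \<omega> i
    using linked_sequence[of 0 i "path_vertex 0 \<omega> ((0, 0), e)" "square R - \<B>"] that adjacent_path
    by (simp add: S_def)
  \<comment> \<open>Before it hits, the ray reads only sites of \<open>S\<close>, so the others may
    be replaced by \<open>No_Mirror\<close>.\<close>
  have restrict: "hits R \<B> e (pull S id id \<omega>) k" if h: "hits R \<B> e \<omega> k" for \<omega> k
  proof -
    have "path_vertex 0 (pull S id id \<omega>) ((0, 0), e) i = path_vertex 0 \<omega> ((0, 0), e) i" if "i \<le> k" for i
    proof (rule path_cong[OF _ that])
      fix j assume "j < k"
      then have "path_vertex 0 \<omega> ((0, 0), e) j \<in> S"
        using h by (intro link) (auto simp: hits_def)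
      then show "pull S id id \<omega> (path_vertex 0 \<omega> ((0, 0), e) j) = \<omega> (path_vertex 0 \<omega> ((0, 0), e) j)"
        by (simp add: pull_def)
    qed
    then show ?thesis using h by (simp add: hits_def)
  qed
  have "measure_pmf.prob (env p (square R)) {\<omega>. \<exists>k. hits R \<B> e \<omega> k}
      \<le> measure_pmf.prob (env p (square R)) {\<omega>. pull S id id \<omega> \<in> {\<omega>. \<exists>k. hits R \<B> e \<omega> k}}"
    using restrict by (intro measure_pmf.finite_measure_mono) auto
  also have "\<dots> = measure_pmf.prob (env p S) {\<omega>. \<exists>k. hits R \<B> e \<omega> k}"
    by (intro prob_pull) (use S in auto)
  also have "\<dots> \<le> measure_pmf.prob (env p ?V) {\<xi>. \<exists>k. path_vertex N \<xi> ((x0, yz), e) k \<in> B \<and>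
        (\<forall>i<k. path_vertex N \<xi> ((x0, yz), e) i \<in> ?V - B)}"
    unfolding eq[symmetric]
  proof (intro measure_pmf.finite_measure_mono subsetI)
    fix \<xi> assume "\<xi> \<in> {\<xi>. pull S f id \<xi> \<in> {\<omega>. \<exists>k. hits R \<B> e \<omega> k}}"
    then obtain k where h: "hits R \<B> e (pull S f id \<xi>) k" by auto
    let ?g = "path_vertex 0 (pull S f id \<xi>) ((0, 0), e)"
    have gS: "?g j \<in> S" if "j < k" for j
      using h that by (intro link) (auto simp: hits_def)
    have "path_vertex N \<xi> (f (fst ((0, 0), e)), snd ((0 :: int, 0 :: int), e)) i = f (?g i)" if "i \<le> k" for i
    proof (rule path_transport[of "\<lambda>d. d" id N f 0 k])
      show "nbr N (f v) d = f (nbr 0 v d)" for v d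
        by (cases v; cases d; simp add: f_def mod_add_left_eq mod_diff_left_eq; simp add: algebra_simps)
    qed (use gS that in \<open>auto simp: pull_def\<close>)
    then have g: "path_vertex N \<xi> ((x0, yz), e) i = f (?g i)" if "i \<le> k" for i
      using that f0 by simp
    have "f (?g k) \<in> B" using h by (simp add: hits_def \<B>_def)
    moreover have "f (?g i) \<in> ?V - B" if "i < k" for i
      using gS[OF that] S fS by (auto simp: \<B>_def)
    ultimately show "\<xi> \<in> {\<xi>. \<exists>k. path_vertex N \<xi> ((x0, yz), e) k \<in> B \<and>
        (\<forall>i<k. path_vertex N \<xi> ((x0, yz), e) i \<in> ?V - B)}"
      using g by (auto intro!: exI[of _ k])
  qed simp
  finally show ?thesis using e that by (meson order_trans)
qed

section \<open>Two crossings and a link\<close>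

text \<open>The new ray consists of \<open>i\<close> steps of the first ray, \<open>r\<close> steps
  of the middle piece, and the second ray run backwards to its entry, where it leaves at time
  \<open>i + r + j\<close>.\<close>

lemma reconnect:
  assumes y: "y1 \<in> {0..<m}" "y2 \<in> {0..<m}"
    and A: "\<And>q. q < i \<Longrightarrow> \<omega>' (target m (ray m \<omega> (entry y1) q)) = \<omega> (target m (ray m \<omega> (entry y1) q))"
      "\<And>q. q < i \<Longrightarrow> col m \<omega> y1 q \<in> {1..L}"
    and B: "\<And>q. q < j \<Longrightarrow> \<omega>' (target m (ray m \<omega> (entry y2) q)) = \<omega> (target m (ray m \<omega> (entry y2) q))"
      "\<And>q. q < j \<Longrightarrow> col m \<omega> y2 q \<in> {1..L}"
    and M: "ray m \<omega>' (ray m \<omega> (entry y1) i) r = flip m (ray m \<omega> (entry y2) j)"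
      "\<And>q. q < r \<Longrightarrow> fst (target m (ray m \<omega>' (ray m \<omega> (entry y1) i) q)) \<in> {1..L}"
  shows "y1 \<in> returns m \<omega>' L"
proof -
  let ?A = "ray m \<omega> (entry y1)" and ?B = "ray m \<omega> (entry y2)"
  have rA: "ray m \<omega>' (entry y1) q = ?A q" if "q \<le> i" for q
    using A(1) by (rule ray_cong[OF _ that])
  have rB: "ray m \<omega>' (entry y2) q = ?B q" if "q \<le> j" for q
    using B(1) by (rule ray_cong[OF _ that])
  have v: "valid m (?B q)" for q by (rule valid_ray[OF valid_entry[OF y(2)]])
  have r1: "ray m \<omega>' (entry y1) (i + q) = ray m \<omega>' (?A i) q" for q
    by (simp add: ray_add rA)
  have r2: "ray m \<omega>' (entry y1) (i + r + q) = flip m (?B (j - q))" if "q \<le> j" for q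
  proof -
    have "ray m \<omega>' (entry y1) (i + r + q) = ray m \<omega>' (flip m (?B j)) q"
      by (simp add: ray_add rA M(1))
    then show ?thesis
      using ray_flip[OF valid_entry[OF y(2)] that, of \<omega>'] rB by simp
  qed
  have "col m \<omega>' y1 q \<in> {1..L}" if "q < i + r + j" for q
  proof -
    have "q < i \<or> (q = i + (q - i) \<and> q - i < r) \<or> (q = i + r + (q - i - r) \<and> q - i - r < j)"
      using that by arith
    then consider "q < i" | q' where "q = i + q'" "q' < r" | q' where "q = i + r + q'" "q' < j"
      by blast
    then show ?thesis
    proof cases
      case 1
      then show ?thesis using A(2)[OF 1] rA[of q] by (simp add: col_def)
    next
      case 2
      then show ?thesis using M(2) r1 by (simp add: col_def)
    next
      case (3 q')
      then have j: "j - q' = Suc (j - q' - 1)" by simp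
      have "target m (ray m \<omega>' (entry y1) q) = fst (?B (j - q'))"
        using r2[of q'] 3 target_flip[OF v] by simp
      also have "\<dots> = target m (?B (j - q' - 1))" by (subst j) simp
      finally have "col m \<omega>' y1 q = col m \<omega> y2 (j - q' - 1)"
        by (simp add: col_def)
      then show ?thesis using B(2)[of "j - q' - 1"] 3 by simp
    qed
  qed
  moreover have "col m \<omega>' y1 (i + r + j) = 0"
    using r2[of j] target_flip[OF v, of 0] by (simp add: col_def)
  ultimately show ?thesis
    using y(1) unfolding returns_def exits_at_def by blast
qed

section \<open>Exploring a crossing and linking it to another one\<close>

definition visited :: "int \<Rightarrow> (vertex \<Rightarrow> site) \<Rightarrow> int \<Rightarrow> int \<Rightarrow> vertex set" where
  "visited m \<omega> L y = {target m (ray m \<omega> (entry y) j) | j. \<forall>i\<le>j. col m \<omega> y i \<in> {1..L}}"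

text \<open>The basis for exploration: up to its exit the ray has read only visited sites, so an
  environment that agrees on these produces the same ray.\<close>

lemma visited_agree:
  assumes "\<And>v. v \<in> visited m \<omega> L y \<Longrightarrow> \<omega>' v = \<omega> v"
  shows "(\<forall>i<j. col m \<omega> y i \<in> {1..L}) \<longleftrightarrow> (\<forall>i<j. col m \<omega>' y i \<in> {1..L})"
    and "\<forall>i<j. col m \<omega> y i \<in> {1..L} \<Longrightarrow> ray m \<omega>' (entry y) j = ray m \<omega> (entry y) j"
proof -
  show eq: "ray m \<omega>' (entry y) j = ray m \<omega> (entry y) j" if "\<forall>i<j. col m \<omega> y i \<in> {1..L}" for j
  proof (rule ray_cong[OF _ order_refl])
    fix l assume "l < j"
    then have "target m (ray m \<omega> (entry y) l) \<in> visited m \<omega> L y"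
      using that unfolding visited_def by fastforce
    then show "\<omega>' (target m (ray m \<omega> (entry y) l)) = \<omega> (target m (ray m \<omega> (entry y) l))"
      by (rule assms)
  qed
  show "(\<forall>i<j. col m \<omega> y i \<in> {1..L}) \<longleftrightarrow> (\<forall>i<j. col m \<omega>' y i \<in> {1..L})"
  proof (induction j)
    case (Suc j)
    show ?case
    proof (cases "\<forall>i<j. col m \<omega> y i \<in> {1..L}")
      case True
      then have "col m \<omega>' y j = col m \<omega> y j" using eq[of j] by (simp only: col_def)
      then show ?thesis using Suc True by (simp only: less_Suc_eq all_simps) metis
    next
      case False
      then show ?thesis using Suc by (metis less_Suc_eq)
    qed
  qed simp
qed

lemma visited_cong:
  assumes "\<And>v. v \<in> visited m \<omega> L y \<Longrightarrow> \<omega>' v = \<omega> v"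
  shows "visited m \<omega>' L y = visited m \<omega> L y"
proof -
  have good: "(\<forall>i\<le>j. col m \<omega> y i \<in> {1..L}) \<longleftrightarrow> (\<forall>i\<le>j. col m \<omega>' y i \<in> {1..L})" for j
    using visited_agree(1)[of m \<omega> L y \<omega>' "Suc j"] assms unfolding less_Suc_eq_le by blast
  have eq: "ray m \<omega>' (entry y) j = ray m \<omega> (entry y) j" if "\<forall>i\<le>j. col m \<omega> y i \<in> {1..L}" for j
    using visited_agree(2)[of m \<omega> L y \<omega>' j] assms that by (metis less_imp_le)
  show ?thesis
    unfolding visited_def by (intro Collect_cong) (metis good eq)
qed

lemma crossings_visited_cong:
  assumes "\<And>v. v \<in> visited m \<omega> L y \<Longrightarrow> \<omega>' v = \<omega> v" "y \<in> crossings m \<omega> L"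
  shows "y \<in> crossings m \<omega>' L"
proof -
  obtain k where k: "exits_at m \<omega> L y (L + 1) k" "y \<in> {0..<m}"
    using assms(2) by (auto simp: crossings_def)
  then have in_slab: "\<forall>i<k. col m \<omega> y i \<in> {1..L}" by (simp add: exits_at_def)
  then have "col m \<omega>' y k = L + 1" "\<forall>i<k. col m \<omega>' y i \<in> {1..L}"
    using visited_agree[of m \<omega> L y \<omega>' k] assms(1) k(1) by (auto simp: col_def exits_at_def)
  then show ?thesis using k(2) unfolding crossings_def exits_at_def by blast
qed

lemma finite_bounded_rows:
  assumes "finite \<Lambda>" "fst ` \<Lambda> \<subseteq> {a..b :: int}"
  obtains c c' :: int where "\<Lambda> \<subseteq> {a..b} \<times> {c..c'}"
proof -
  have "finite (snd ` \<Lambda>)" using assms(1) by simp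
  then obtain B where "\<forall>z\<in>snd ` \<Lambda>. \<bar>z\<bar> \<le> B"
    using finite_imp_bounded[of "snd ` \<Lambda>"] by (metis abs_le_iff all_not_in_conv bdd_above_finite bdd_above_def finite_imageI image_eqI)
  then have "\<Lambda> \<subseteq> {a..b} \<times> {- B..B}"
    using assms(2) by (fastforce simp: abs_le_iff)
  then show ?thesis by (rule that)
qed

text \<open>Take the part of the crossing after its last entrance into the columns
  \<open>{s + 1..s + T}\<close> and repeat its steps in the plane, the universal cover, with
  \<open>nbr 0\<close>.\<close>

lemma crossing_path_lift:
  assumes "y \<in> crossings m \<omega> (s + T)" "0 \<le> s" "0 < T" "0 < m"
  obtains \<Lambda> u v where "linked \<Lambda> u v" "fst u = s + 1" "fst v = s + T" "finite \<Lambda>"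
    "fst ` \<Lambda> \<subseteq> {s + 1..s + T}" "(\<lambda>v. (fst v, snd v mod m)) ` \<Lambda> \<subseteq> visited m \<omega> (s + T) y"
proof -
  let ?r = "ray m \<omega> (entry y)"
  obtain k where k: "exits_at m \<omega> (s + T) y (s + T + 1) k" and y: "y \<in> {0..<m}"
    using assms(1) by (auto simp: crossings_def)
  have in_slab: "col m \<omega> y i \<in> {1..s + T}" if "i < k" for i
    using k that by (simp add: exits_at_def)
  have ck: "col m \<omega> y k = s + T + 1" using k by (simp add: exits_at_def)
  then have "k \<noteq> 0" using assms(2,3) by (intro notI) simp
  then obtain i2 where i2: "k = Suc i2" by (metis not0_implies_Suc)
  have c2: "col m \<omega> y i2 = s + T"
    using in_slab[of i2] ck col_step[of m \<omega> y i2] i2 by simp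
  \<comment> \<open>\<open>i1\<close>, the least such time, is the last entrance: from there on the
    ray stays to the right of column \<open>s\<close>.\<close>
  define P where "P i \<longleftrightarrow> (\<forall>j\<in>{i..i2}. s + 1 \<le> col m \<omega> y j)" for i
  define i1 where "i1 = (LEAST i. P i)"
  have "P i2" using c2 assms(3) by (simp add: P_def)
  then have i1: "P i1" "i1 \<le> i2" unfolding i1_def by (rule LeastI, rule Least_le)
  have c1: "col m \<omega> y i1 = s + 1"
  proof (cases i1)
    case 0
    moreover have "s + 1 \<le> col m \<omega> y i1" using i1 by (simp add: P_def)
    ultimately show ?thesis using assms(2) by simp
  next
    case (Suc i)
    then have "\<not> P i" unfolding i1_def using not_less_Least by (metis lessI)
    then obtain j where j: "i \<le> j" "j \<le> i2" "col m \<omega> y j < s + 1"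
      unfolding P_def by (auto simp: not_le)
    have "\<not> i1 \<le> j"
    proof
      assume "i1 \<le> j"
      then have "s + 1 \<le> col m \<omega> y j" using i1(1) j(2) by (simp add: P_def)
      then show False using j(3) by simp
    qed
    then have "col m \<omega> y i \<le> s" using j Suc by (cases "j = i") auto
    moreover have "s + 1 \<le> col m \<omega> y i1" using i1 by (simp add: P_def)
    ultimately show ?thesis using col_step[of m \<omega> y i] Suc by simp
  qed
  define g where "g = rec_nat (1, y) (\<lambda>i u. nbr 0 u (snd (?r (Suc i))))"
  have g_Suc: "g (Suc i) = nbr 0 (g i) (snd (?r (Suc i)))" for i by (simp add: g_def)
  have proj: "(fst (g i), snd (g i) mod m) = target m (?r i)" for i
  proof (induction i)
    case 0
    then show ?case using y by (simp add: g_def target_def)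
  next
    case (Suc i)
    have "(fst (nbr 0 u d), snd (nbr 0 u d) mod m) = nbr m (fst u, snd u mod m) d" for u d
      by (cases u; cases d) (simp_all add: mod_simps)
    then show ?case
      unfolding g_Suc target_def[of m "?r (Suc i)"] fst_ray_Suc Suc[symmetric] .
  qed
  have fst_g: "fst (g i) = col m \<omega> y i" for i
    using arg_cong[OF proj[of i], of fst] by (simp add: col_def)
  show ?thesis
  proof (rule that[of "g ` {i1..i2}" "g i1" "g i2"])
    show "linked (g ` {i1..i2}) (g i1) (g i2)"
      using i1(2) by (intro linked_sequence) (auto simp: g_Suc adjacent_nbr_plane)
    show "fst ` g ` {i1..i2} \<subseteq> {s + 1..s + T}"
      using i1(1) in_slab i2 by (auto simp: fst_g P_def)
    show "(\<lambda>v. (fst v, snd v mod m)) ` g ` {i1..i2} \<subseteq> visited m \<omega> (s + T) y"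
    proof -
      have "target m (?r i) \<in> visited m \<omega> (s + T) y" if "i \<le> i2" for i
        using that in_slab i2 unfolding visited_def by fastforce
      then show ?thesis by (auto simp: proj)
    qed
  qed (auto simp: fst_g c1 c2)
qed

lemma visits_column:
  assumes "y \<in> crossings m \<omega> L" "1 \<le> x" "x \<le> L" "0 < m"
  obtains z where "z \<in> {0..<m}" "(x, z) \<in> visited m \<omega> L y"
proof -
  have "y \<in> crossings m \<omega> (x - 1)"
    using crossings_mono[of "x - 1" L m \<omega>] assms by auto
  then obtain k where k: "exits_at m \<omega> (x - 1) y x k" and y: "y \<in> {0..<m}"
    by (auto simp: crossings_def)
  let ?t = "target m (ray m \<omega> (entry y) k)"
  have "col m \<omega> y i \<in> {1..L}" if "i \<le> k" for i
    using k that assms(2,3) unfolding exits_at_def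
    by (cases "i = k") (auto dest!: spec[of _ i])
  then have "?t \<in> visited m \<omega> L y" unfolding visited_def by blast
  moreover have "fst ?t = x" using k by (simp add: exits_at_def col_def)
  moreover have "snd ?t \<in> {0..<m}"
    using valid_range[OF valid_ray[OF valid_entry[OF y]] assms(4), of \<omega> "Suc k"] by simp
  ultimately show ?thesis using that by (metis prod.collapse)
qed

text \<open>Between its ends the piece avoids both explored sets. Its existence is therefore decided
  by unexplored sites alone, and changes of state at the two ends do not disturb it.\<close>

definition linkable :: "int \<Rightarrow> vertex set \<Rightarrow> vertex set \<Rightarrow> vertex set \<Rightarrow> (vertex \<Rightarrow> site) \<Rightarrow> bool" where
  "linkable m V a b \<xi> \<longleftrightarrow> a \<inter> b \<noteq> {} \<or>
     (\<exists>e l. fst e \<in> a \<and> target m (ray m \<xi> e l) \<in> b \<and>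
        (\<forall>q<l. target m (ray m \<xi> e q) \<in> V - (a \<union> b)))"

lemma linkable_cong:
  assumes "linkable m V a b \<xi>" "\<And>v. v \<in> V - (a \<union> b) \<Longrightarrow> \<xi>' v = \<xi> v"
  shows "linkable m V a b \<xi>'"
proof (cases "a \<inter> b = {}")
  case True
  then obtain e l where e: "fst e \<in> a" "target m (ray m \<xi> e l) \<in> b"
    "\<And>q. q < l \<Longrightarrow> target m (ray m \<xi> e q) \<in> V - (a \<union> b)"
    using assms(1) unfolding linkable_def by blast
  have "ray m \<xi>' e q = ray m \<xi> e q" if "q \<le> l" for q
    by (rule ray_cong[OF _ that]) (rule assms(2)[OF e(3)])
  then show ?thesis
    using e unfolding linkable_def by (intro disjI2 exI[of _ e] exI[of _ l]) simp
qed (simp add: linkable_def)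

text \<open>A ray that hits \<open>b\<close> may have come back to \<open>a\<close> in between; what
  follows its last visit to \<open>a\<close> is a link.\<close>

lemma linkable_if_hits:
  assumes "z \<in> a" "path_vertex m \<xi> (z, d) k \<in> b" "\<And>i. i < k \<Longrightarrow> path_vertex m \<xi> (z, d) i \<in> V - b"
  shows "linkable m V a b \<xi>"
proof (cases "z \<in> b")
  case False
  let ?g = "path_vertex m \<xi> (z, d)"
  have "k \<noteq> 0" using False assms(2) by (intro notI) simp
  define I where "I = {i. i < k \<and> ?g i \<in> a}"
  have "finite I" "0 \<in> I" using \<open>k \<noteq> 0\<close> assms(1) by (auto simp: I_def)
  define i where "i = Max I"
  have i: "i < k" "?g i \<in> a"
    using Max_in[of I] \<open>finite I\<close> \<open>0 \<in> I\<close> unfolding i_def I_def by blast+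
  have last: "?g j \<notin> a" if "i < j" "j < k" for j
    using that Max_ge[OF \<open>finite I\<close>, of j] unfolding i_def[symmetric] by (auto simp: I_def)
  let ?e = "ray m \<xi> (z, d) i"
  have t: "target m (ray m \<xi> ?e q) = ?g (Suc (i + q))" for q
    by (simp add: path_vertex_def ray_add)
  show ?thesis
    unfolding linkable_def
  proof (intro disjI2 exI[of _ ?e] exI[of _ "k - Suc i"] conjI allI impI)
    show "fst ?e \<in> a" using i(2) by (simp add: path_vertex_def)
    show "target m (ray m \<xi> ?e (k - Suc i)) \<in> b"
      using assms(2) i(1) by (simp only: t) simp
    fix q assume "q < k - Suc i"
    then have "Suc (i + q) < k" by simp
    then show "target m (ray m \<xi> ?e q) \<in> V - (a \<union> b)"
      using assms(3) last[of "Suc (i + q)"] by (simp only: t) auto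
  qed
qed (use assms(1) in \<open>auto simp: linkable_def\<close>)

lemma first_visit:
  assumes "x \<in> visited m \<omega> L y" "P x"
  obtains i where "P (target m (ray m \<omega> (entry y) i))" "\<And>q. q \<le> i \<Longrightarrow> col m \<omega> y q \<in> {1..L}"
    "\<And>q. q < i \<Longrightarrow> \<not> P (target m (ray m \<omega> (entry y) q))"
proof -
  obtain i' where i': "x = target m (ray m \<omega> (entry y) i')" "\<forall>q\<le>i'. col m \<omega> y q \<in> {1..L}"
    using assms(1) unfolding visited_def by blast
  define i where "i = (LEAST i. P (target m (ray m \<omega> (entry y) i)))"
  have "P (target m (ray m \<omega> (entry y) i))" "i \<le> i'"
    unfolding i_def using assms(2) i'(1) by (auto intro: LeastI Least_le)
  moreover have "\<not> P (target m (ray m \<omega> (entry y) q))" if "q < i" for q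
    using that not_less_Least unfolding i_def by blast
  ultimately show ?thesis using i'(2) by (intro that) auto
qed

text \<open>Traced back from a common edge, one entry edge would lie on the other ray, which would
  have had to return to column 0 before.\<close>

lemma entry_rays_differ:
  assumes "y1 \<in> {0..<m}" "y2 \<in> {0..<m}" "y1 \<noteq> y2"
    and "\<And>q. q \<le> i \<Longrightarrow> col m \<omega> y1 q \<in> {1..L}" "\<And>q. q \<le> j \<Longrightarrow> col m \<omega> y2 q \<in> {1..L}"
  shows "ray m \<omega> (entry y1) i \<noteq> ray m \<omega> (entry y2) j"
proof -
  have *: False if eq: "ray m \<omega> (entry y) i = ray m \<omega> (entry y') j" and "i \<le> j" and y: "y \<in> {0..<m}" "y' \<in> {0..<m}" "y \<noteq> y'"
    and c: "\<And>q. q \<le> j \<Longrightarrow> col m \<omega> y' q \<in> {1..L}" for y y' i j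
  proof -
    have e: "entry y = ray m \<omega> (entry y') (j - i)"
      by (rule ray_cancel[OF valid_entry[OF y(1)] valid_entry[OF y(2)] eq \<open>i \<le> j\<close>])
    show False
    proof (cases "j - i")
      case 0
      then show False using e y(3) by simp
    next
      case (Suc l)
      then have "(0, y) = target m (ray m \<omega> (entry y') l)"
        using arg_cong[OF e, of fst] by simp
      then have "col m \<omega> y' l = 0" by (simp add: col_def flip: \<open>(0, y) = _\<close>)
      moreover have "l \<le> j" using Suc by simp
      ultimately show False using c[of l] by simp
    qed
  qed
  show ?thesis
    using *[of y1 i y2 j] *[of y2 j y1 i] assms by (metis nat_le_linear)
qed

text \<open>The first ray is led along the linking piece onto the second one, which it then follows
  backwards. If the two rays share a vertex, \<open>u = w\<close> is that vertex.\<close>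

lemma connect_crossings:
  assumes y: "y1 \<in> {0..<m}" "y2 \<in> {0..<m}" "y1 \<noteq> y2" and V: "V \<subseteq> {1..L} \<times> {0..<m}"
    and a: "a = visited m \<omega> L y1 \<inter> V" and b: "b = visited m \<omega> L y2 \<inter> V"
    and link: "linkable m V a b \<omega>"
  shows "\<exists>u\<in>V. \<exists>w\<in>V. \<exists>t t'. y1 \<in> returns m (fun_upd (fun_upd \<omega> u t) w t') L"
proof -
  let ?A = "ray m \<omega> (entry y1)" and ?B = "ray m \<omega> (entry y2)"
  have vA: "valid m (?A q)" and vB: "valid m (?B q)" for q
    using valid_ray[OF valid_entry] y by blast+
  have in_a: "target m (?A q) \<in> a" if "target m (?A q) \<in> V" "\<forall>q'\<le>q. col m \<omega> y1 q' \<in> {1..L}" for q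
    using that unfolding a visited_def by blast
  have in_b: "target m (?B q) \<in> b" if "target m (?B q) \<in> V" "\<forall>q'\<le>q. col m \<omega> y2 q' \<in> {1..L}" for q
    using that unfolding b visited_def by blast
  show ?thesis
  proof (cases "a \<inter> b = {}")
    case False
    then obtain x where x: "x \<in> visited m \<omega> L y1" "x \<in> b" using a by blast
    obtain i where i: "target m (?A i) \<in> b" "\<And>q. q \<le> i \<Longrightarrow> col m \<omega> y1 q \<in> {1..L}"
      "\<And>q. q < i \<Longrightarrow> target m (?A q) \<notin> b"
      by (rule first_visit[OF x(1), of "\<lambda>w. w \<in> b"]) (use x(2) in auto)
    define v where "v = target m (?A i)"
    have vV: "v \<in> V" "v \<in> visited m \<omega> L y2" using i(1) b by (auto simp: v_def)
    obtain j where j: "target m (?B j) = v" "\<And>q. q \<le> j \<Longrightarrow> col m \<omega> y2 q \<in> {1..L}"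
      "\<And>q. q < j \<Longrightarrow> target m (?B q) \<noteq> v"
      by (rule first_visit[OF vV(2), of "\<lambda>w. w = v"]) auto
    \<comment> \<open>Rays that arrive at \<open>v\<close> along the same half-edge would share an
      edge. So the half-edges differ, and some state of \<open>v\<close> joins them.\<close>
    have "snd (?A i) \<noteq> snd (?B j)"
    proof
      assume "snd (?A i) = snd (?B j)"
      then have "flip m (?A i) = flip m (?B j)" using j(1) by (simp add: flip_def v_def)
      then have "?A i = ?B j" by (rule flip_inject[OF vA vB])
      then show False using entry_rays_differ[OF y i(2) j(2)] by simp
    qed
    then obtain t where t: "paired t (opposite (snd (?A i))) = opposite (snd (?B j))"
      using exists_site_pairing by (metis opposite_inject)
    let ?\<omega> = "fun_upd (fun_upd \<omega> v t) v t"
    have "y1 \<in> returns m ?\<omega> L"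
    proof (rule reconnect[OF y(1,2), of i ?\<omega> \<omega> L j 1])
      show "ray m ?\<omega> (?A i) 1 = flip m (?B j)"
        using t j(1) by (simp add: ray_Suc advance_def flip_def v_def)
      show "?\<omega> (target m (?A q)) = \<omega> (target m (?A q))" if "q < i" for q
        using i(1) i(3)[OF that] by (auto simp: v_def)
      show "?\<omega> (target m (?B q)) = \<omega> (target m (?B q))" if "q < j" for q
        using j(3)[OF that] by simp
      show "fst (target m (ray m ?\<omega> (?A i) q)) \<in> {1..L}" if "q < 1" for q
        using i(2)[of i] that by (simp add: col_def)
    qed (use i(2) j(2) in auto)
    then show ?thesis using vV by blast
  next
    case True
    then obtain e l where e: "fst e \<in> a" "target m (ray m \<omega> e l) \<in> b"
      and mid: "\<And>q. q < l \<Longrightarrow> target m (ray m \<omega> e q) \<in> V - (a \<union> b)"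
      using link unfolding linkable_def by blast
    let ?f = "ray m \<omega> e"
    define u w where "u = fst e" and "w = target m (?f l)"
    have u: "u \<in> a" "u \<in> V" "u \<in> visited m \<omega> L y1" "u \<notin> b" using e True a by (auto simp: u_def)
    have w: "w \<in> b" "w \<in> V" "w \<in> visited m \<omega> L y2" "w \<notin> a" using e True b by (auto simp: w_def)
    have vf: "valid m (?f q)" for q
    proof (rule valid_ray)
      have "snd u \<in> {0..<m}" using u(2) V by auto
      then show "valid m e" by (simp add: valid_def u_def)
    qed
    obtain i where i: "target m (?A i) = u" "\<And>q. q \<le> i \<Longrightarrow> col m \<omega> y1 q \<in> {1..L}"
      "\<And>q. q < i \<Longrightarrow> target m (?A q) \<noteq> u"
      by (rule first_visit[OF u(3), of "\<lambda>w. w = u"]) auto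
    obtain j where j: "target m (?B j) = w" "\<And>q. q \<le> j \<Longrightarrow> col m \<omega> y2 q \<in> {1..L}"
      "\<And>q. q < j \<Longrightarrow> target m (?B q) \<noteq> w"
      by (rule first_visit[OF w(3), of "\<lambda>v. v = w"]) auto
    have fst_A: "fst (?A i) \<in> a \<or> fst (?A i) \<notin> V"
    proof (cases i)
      case 0
      then show ?thesis using V by auto
    next
      case (Suc q)
      then show ?thesis using in_a[of q] i(2) by (metis fst_ray_Suc le_SucI)
    qed
    have fst_B: "fst (?B j) \<in> b \<or> fst (?B j) \<notin> V"
    proof (cases j)
      case 0
      then show ?thesis using V by auto
    next
      case (Suc q)
      then show ?thesis using in_b[of q] j(2) by (metis fst_ray_Suc le_SucI)
    qed
    \<comment> \<open>Otherwise the link would begin by retracing the last edge of the first ray,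
      which starts in \<open>a\<close> or outside \<open>V\<close>; but the first step of the link
      leads into \<open>V - a\<close>.\<close>
    have "opposite (snd (?A i)) \<noteq> snd e"
    proof
      assume "opposite (snd (?A i)) = snd e"
      then have "e = flip m (?A i)" by (simp add: prod_eq_iff i(1) u_def)
      then have "target m e = fst (?A i)" using target_flip[OF vA] by simp
      moreover have "target m e \<in> V - a" using mid[of 0] w by (cases l) (auto simp: w_def)
      ultimately show False using fst_A by auto
    qed
    then obtain t where t: "paired t (opposite (snd (?A i))) = snd e"
      by (rule exists_site_pairing)
    \<comment> \<open>Otherwise the link would arrive along the last edge of the second ray, which
      starts in \<open>b\<close> or outside \<open>V\<close>; but the last edge of the link starts
      in \<open>V - b\<close>.\<close>
    have "snd (?f l) \<noteq> snd (?B j)"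
    proof
      assume "snd (?f l) = snd (?B j)"
      then have "flip m (?f l) = flip m (?B j)" using j(1) by (simp add: flip_def w_def)
      then have "?f l = ?B j" by (rule flip_inject[OF vf vB])
      moreover have "fst (?f l) \<in> V - b"
      proof (cases l)
        case 0
        then show ?thesis using u by (simp add: u_def)
      next
        case (Suc q)
        then show ?thesis using mid[of q] by simp
      qed
      ultimately show False using fst_B by auto
    qed
    then obtain t' where t': "paired t' (opposite (snd (?f l))) = opposite (snd (?B j))"
      using exists_site_pairing by (metis opposite_inject)
    let ?\<omega> = "fun_upd (fun_upd \<omega> u t) w t'"
    have uw: "u \<noteq> w" using u w by auto
    have "advance m ?\<omega> (?A i) = e"
      using t uw by (simp add: advance_def i(1)) (simp add: u_def)
    then have f1: "ray m ?\<omega> (?A i) (Suc q) = ray m ?\<omega> e q" for q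
      using ray_add[of m ?\<omega> "?A i" 1 q] by (simp add: ray_Suc)
    have f2: "ray m ?\<omega> e q = ?f q" if "q \<le> l" for q
      by (rule ray_cong[OF _ that]) (use mid u w in fastforce)
    have "y1 \<in> returns m ?\<omega> L"
    proof (rule reconnect[OF y(1,2), of i ?\<omega> \<omega> L j "Suc (Suc l)"])
      have "ray m ?\<omega> (?A i) (Suc (Suc l)) = advance m ?\<omega> (?f l)"
        by (simp only: f1 ray_Suc[of m ?\<omega> e] f2[OF order_refl])
      also have "\<dots> = flip m (?B j)"
        using t' by (simp add: advance_def flip_def j(1) flip: w_def)
      finally show "ray m ?\<omega> (?A i) (Suc (Suc l)) = flip m (?B j)" .
      \<comment> \<open>Before \<open>u\<close> the first ray meets within \<open>V\<close> only
        vertices of \<open>a\<close>, hence not \<open>w\<close>; the argument for the second ray is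
        symmetric.\<close>
      show "?\<omega> (target m (?A q)) = \<omega> (target m (?A q))" if "q < i" for q
        using i(3)[OF that] in_a[of q] i(2) w that by auto
      show "?\<omega> (target m (?B q)) = \<omega> (target m (?B q))" if "q < j" for q
        using j(3)[OF that] in_b[of q] j(2) u that by auto
      show "fst (target m (ray m ?\<omega> (?A i) q)) \<in> {1..L}" if "q < Suc (Suc l)" for q
      proof (cases q)
        case 0
        then show ?thesis using i(2)[of i] by (simp add: col_def)
      next
        case (Suc q')
        then have "target m (?f q') \<in> V"
          using mid[of q'] w that by (cases "q' = l") (auto simp: w_def)
        then show ?thesis
          using f2[of q'] Suc that V by (simp only: f1) auto
      qed
    qed (use i(2) j(2) in auto)
    then show ?thesis using u w by blast
  qed
qed

section \<open>A fresh block destroys a crossing\<close>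

definition override :: "vertex set \<Rightarrow> (vertex \<Rightarrow> site) \<Rightarrow> (vertex \<Rightarrow> site) \<Rightarrow> vertex \<Rightarrow> site" where
  "override V \<eta> \<omega> v = (if v \<in> V then \<omega> v else \<eta> v)"

lemma override_upd: "u \<in> V \<Longrightarrow> override V \<eta> (fun_upd \<omega> u t) = fun_upd (override V \<eta> \<omega>) u t"
  by (auto simp: override_def)

lemma UNIV_site: "(UNIV :: site set) = {No_Mirror, NW_Mirror, NE_Mirror}"
proof (intro equalityI subsetI)
  fix s :: site
  show "s \<in> {No_Mirror, NW_Mirror, NE_Mirror}" by (cases s) auto
qed simp

lemma prob_linkable:
  fixes N s :: int
  defines "L \<equiv> s + (2 * N + 1)"
  defines "V \<equiv> {s + 1..L} \<times> {0..<N}"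
  assumes N: "0 < N" and s: "0 \<le> s" and p: "0 \<le> p" "p \<le> 1"
    and cr: "y1 \<in> crossings N \<omega> L" "y2 \<in> crossings N \<omega> L"
  shows "1 / (8 * real_of_int (2 * N + 1)) \<le> measure_pmf.prob (env p V)
    {\<xi>. linkable N V (visited N \<omega> L y1 \<inter> V) (visited N \<omega> L y2 \<inter> V) \<xi>}"
    (is "?c \<le> measure_pmf.prob _ {\<xi>. linkable N V ?a ?b \<xi>}")
proof -
  \<comment> \<open>The middle column: \<open>2 * N + 1\<close> columns form the window of
    half-width \<open>R = N\<close> around it, the smallest one that satisfies
    \<open>N \<le> R\<close>.\<close>
  define x0 where "x0 = s + 1 + N"
  have V: "V = {x0 - N..x0 + N} \<times> {0..<N}"
    by (simp add: V_def L_def x0_def algebra_simps)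
  obtain yz where yz: "yz \<in> {0..<N}" "(x0, yz) \<in> visited N \<omega> L y1"
    by (rule visits_column[OF cr(1), of x0]) (use N s in \<open>auto simp: x0_def L_def\<close>)
  then have za: "(x0, yz) \<in> ?a" using N by (auto simp: V)
  show ?thesis
  proof (cases "(x0, yz) \<in> ?b")
    case True
    then have "{\<xi>. linkable N V ?a ?b \<xi>} = UNIV"
      using za by (auto simp: linkable_def)
    then show ?thesis using N by simp
  next
    case False
    obtain \<Lambda> u v where \<Lambda>: "linked \<Lambda> u v" "fst u = s + 1" "fst v = L" "finite \<Lambda>"
      "fst ` \<Lambda> \<subseteq> {s + 1..L}" "(\<lambda>v. (fst v, snd v mod N)) ` \<Lambda> \<subseteq> visited N \<omega> L y2"
      by (rule crossing_path_lift[of y2 N \<omega> s "2 * N + 1", folded L_def, OF cr(2) s _ N]) (use N in auto)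
    \<comment> \<open>Moves the lift of the second crossing so that the vertex
      \<open>(x0, yz)\<close> of the first one becomes the origin.\<close>
    define g where "g v = (fst v - x0, snd v - yz)" for v :: vertex
    have g: "linked (g ` \<Lambda>) (g u) (g v)"
      by (rule linked_map[OF \<Lambda>(1)]) (auto simp: g_def adjacent_def)
    have "fst ` g ` \<Lambda> \<subseteq> {- N..N}"
      using \<Lambda>(5) by (force simp: g_def x0_def L_def image_subset_iff)
    then obtain c c' where c: "g ` \<Lambda> \<subseteq> {- N..N} \<times> {c..c'}"
      by (rule finite_bounded_rows[OF finite_imageI[OF \<Lambda>(4)]])
    have "(x0 + fst (g w), (yz + snd (g w)) mod N) \<in> ?b" if "w \<in> \<Lambda>" for w
      using \<Lambda>(5,6) that N by (auto simp: g_def V_def)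
    then have sub: "(\<lambda>v. (x0 + fst v, (yz + snd v) mod N)) ` g ` \<Lambda> \<subseteq> ?b" by blast
    have gu: "fst (g u) = - N" and gv: "fst (g v) = N"
      using \<Lambda>(2,3) by (simp_all add: g_def x0_def L_def)
    obtain d where d: "?c \<le> measure_pmf.prob (env p ({x0 - N..x0 + N} \<times> {0..<N}))
      {\<xi>. \<exists>k. path_vertex N \<xi> ((x0, yz), d) k \<in> ?b \<and>
        (\<forall>i<k. path_vertex N \<xi> ((x0, yz), d) i \<in> {x0 - N..x0 + N} \<times> {0..<N} - ?b)}"
      by (rule exists_hitting_direction_cylinder[OF N order_refl p yz(1) False g gu gv c sub])
    also have "\<dots> \<le> measure_pmf.prob (env p V) {\<xi>. linkable N V ?a ?b \<xi>}"
      unfolding V[symmetric]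
    proof (intro measure_pmf.finite_measure_mono subsetI CollectI)
      fix \<xi> assume "\<xi> \<in> {\<xi>. \<exists>k. path_vertex N \<xi> ((x0, yz), d) k \<in> ?b \<and>
        (\<forall>i<k. path_vertex N \<xi> ((x0, yz), d) i \<in> V - ?b)}"
      then obtain k where k: "path_vertex N \<xi> ((x0, yz), d) k \<in> ?b"
        "\<forall>i<k. path_vertex N \<xi> ((x0, yz), d) i \<in> V - ?b"
        by blast
      show "linkable N V ?a ?b \<xi>"
        by (rule linkable_if_hits[OF za k(1)]) (rule k(2)[rule_format])
    qed simp
    finally show ?thesis .
  qed
qed

lemma prob_change_two_sites:
  assumes "finite V" "u \<in> V" "w \<in> V" "0 < \<kappa>" "\<And>s. \<kappa> \<le> pmf (site_law p) s"
  shows "measure_pmf.prob (env p V) {\<omega>. fun_upd (fun_upd \<omega> u t) w t' \<in> D} * \<kappa>\<^sup>2 \<le> measure_pmf.prob (env p V) D"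
proof -
  have *: "measure_pmf.prob (env p V) {\<omega>. fun_upd \<omega> u s \<in> D} * \<kappa> \<le> measure_pmf.prob (env p V) D"
    if "u \<in> V" for u s D
    using prob_change_site[OF assms(1) that, of p s D] assms(5)[of s]
    by (meson measure_nonneg mult_left_mono order_trans)
  have "measure_pmf.prob (env p V) {\<omega>. fun_upd (fun_upd \<omega> u t) w t' \<in> D} * \<kappa>
      \<le> measure_pmf.prob (env p V) {\<omega>. fun_upd \<omega> w t' \<in> D}"
    using *[OF assms(2), of t "{\<omega>. fun_upd \<omega> w t' \<in> D}"] by simp
  then have "measure_pmf.prob (env p V) {\<omega>. fun_upd (fun_upd \<omega> u t) w t' \<in> D} * \<kappa> * \<kappa>
      \<le> measure_pmf.prob (env p V) {\<omega>. fun_upd \<omega> w t' \<in> D} * \<kappa>"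
    using assms(4) by (intro mult_right_mono) auto
  also have "\<dots> \<le> measure_pmf.prob (env p V) D" by (rule *[OF assms(3)])
  finally show ?thesis by (simp add: power2_eq_square mult.assoc)
qed

definition drop_bound :: "real \<Rightarrow> int \<Rightarrow> real" where
  "drop_bound \<kappa> N = \<kappa>\<^sup>2 / (144 * real_of_int (2 * N + 1) ^ 3 * (real_of_int N)\<^sup>2)"

text \<open>In \<open>drop_bound\<close>, the unexplored sites link the two crossings with probability at least
  \<open>1 / (8 (2 N + 1))\<close>, and \<open>9 ((2 N + 1) N)\<^sup>2\<close> bounds the number of ways to change two sites, each of
  which costs a factor \<open>\<kappa>\<close>.\<close>

theorem block_drops_crossings:
  fixes N s :: int
  defines "L \<equiv> s + (2 * N + 1)"
  defines "V \<equiv> {s + 1..L} \<times> {0..<N}"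
  assumes N: "0 < N" and s: "0 \<le> s" and p: "0 \<le> p" "p \<le> 1"
    and \<kappa>: "0 < \<kappa>" "\<And>t. \<kappa> \<le> pmf (site_law p) t"
    and y: "y1 \<in> crossings N \<eta> s" "y2 \<in> crossings N \<eta> s" "y1 \<noteq> y2"
  shows "drop_bound \<kappa> N \<le> measure_pmf.prob (env p V)
    {\<omega>. card (crossings N (override V \<eta> \<omega>) L) < card (crossings N \<eta> s)}"
    (is "_ \<le> measure_pmf.prob _ ?D")
proof -
  let ?P = "measure_pmf.prob (env p V)"
  let ?\<zeta> = "override V \<eta>"
  define c where "c = 1 / (8 * real_of_int (2 * N + 1))"
  define vis where "vis \<omega> y = visited N (?\<zeta> \<omega>) L y" for \<omega> y
  define U where "U \<omega> = (vis \<omega> y1 \<union> vis \<omega> y2) \<inter> V" for \<omega>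
  define K where "K \<omega> \<longleftrightarrow> y1 \<in> crossings N (?\<zeta> \<omega>) L \<and> y2 \<in> crossings N (?\<zeta> \<omega>) L" for \<omega>
  define F where "F \<omega> = linkable N V (vis \<omega> y1 \<inter> V) (vis \<omega> y2 \<inter> V)" for \<omega>
  have finV: "finite V" by (simp add: V_def)
  have L: "0 \<le> L" "s \<le> L" using N s by (simp_all add: L_def)
  have rng: "y1 \<in> {0..<N}" "y2 \<in> {0..<N}" using y crossings_subset by blast+
  have agree: "?\<zeta> \<omega>' v = ?\<zeta> \<omega> v" if "\<forall>v\<in>U \<omega>. \<omega>' v = \<omega> v" "v \<in> vis \<omega> y1 \<union> vis \<omega> y2" for \<omega> \<omega>' v
    using that by (auto simp: override_def U_def)
  have vis: "vis \<omega>' y = vis \<omega> y" if "\<forall>v\<in>U \<omega>. \<omega>' v = \<omega> v" "y = y1 \<or> y = y2" for \<omega> \<omega>' y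
  proof -
    have "?\<zeta> \<omega>' v = ?\<zeta> \<omega> v" if "v \<in> visited N (?\<zeta> \<omega>) L y" for v
      using agree[OF \<open>\<forall>v\<in>U \<omega>. \<omega>' v = \<omega> v\<close>, of v] that \<open>y = y1 \<or> y = y2\<close> by (auto simp: vis_def)
    then show ?thesis unfolding vis_def by (rule visited_cong)
  qed
  have "c * ?P {\<omega>. K \<omega>} \<le> ?P {\<omega>. K \<omega> \<and> F \<omega> \<omega>}"
  proof (rule prob_given_explored[OF finV, where U = U and K = K and F = F])
    show "U \<omega> \<subseteq> V" for \<omega> by (simp add: U_def)
    show "U \<omega>' = U \<omega>" if "\<And>v. v \<in> U \<omega> \<Longrightarrow> \<omega>' v = \<omega> v" for \<omega> \<omega>'
      using vis[of \<omega> \<omega>'] that by (simp add: U_def)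
    show "K \<omega>'" if K: "K \<omega>" and "\<And>v. v \<in> U \<omega> \<Longrightarrow> \<omega>' v = \<omega> v" for \<omega> \<omega>'
    proof -
      have same: "\<forall>v\<in>U \<omega>. \<omega>' v = \<omega> v" using that by blast
      have "y \<in> crossings N (?\<zeta> \<omega>') L" if "y = y1 \<or> y = y2" for y
      proof (rule crossings_visited_cong)
        show "y \<in> crossings N (?\<zeta> \<omega>) L" using K that by (auto simp: K_def)
        show "?\<zeta> \<omega>' v = ?\<zeta> \<omega> v" if "v \<in> visited N (?\<zeta> \<omega>) L y" for v
          using agree[OF same, of v] that \<open>y = y1 \<or> y = y2\<close> by (auto simp: vis_def)
      qed
      then show ?thesis by (simp add: K_def)
    qed
    show "F \<omega>' \<xi>" if "F \<omega> \<xi>" "\<And>v. v \<in> U \<omega> \<Longrightarrow> \<omega>' v = \<omega> v" for \<omega> \<omega>' \<xi>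
      using vis[of \<omega> \<omega>'] that by (simp add: F_def)
    show "F \<omega> \<xi>'" if "F \<omega> \<xi>" "\<And>v. v \<in> V - U \<omega> \<Longrightarrow> \<xi>' v = \<xi> v" for \<omega> \<xi> \<xi>'
      using that(1) unfolding F_def by (rule linkable_cong) (rule that(2), auto simp: U_def)
    show "c \<le> ?P {\<xi>. F \<omega> \<xi>}" if "K \<omega>" for \<omega>
      using prob_linkable[OF N s p, of y1 "?\<zeta> \<omega>" y2] that
      unfolding K_def c_def F_def vis_def V_def L_def by blast
  qed
  \<comment> \<open>The change that stops \<open>y1\<close> from crossing depends on \<omega>; the
    event is covered by those for fixed sites and states, ready for a union bound.\<close>
  also have "{\<omega>. K \<omega> \<and> F \<omega> \<omega>} \<subseteq> (\<Union>(u, w, t, t')\<in>V \<times> V \<times> UNIV \<times> UNIV. {\<omega>. fun_upd (fun_upd \<omega> u t) w t' \<in> ?D})"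
  proof
    fix \<omega> assume "\<omega> \<in> {\<omega>. K \<omega> \<and> F \<omega> \<omega>}"
    then have K: "K \<omega>" and F: "F \<omega> \<omega>" by auto
    have "linkable N V (vis \<omega> y1 \<inter> V) (vis \<omega> y2 \<inter> V) (?\<zeta> \<omega>)"
      using F unfolding F_def by (rule linkable_cong) (simp add: override_def)
    then have "\<exists>u\<in>V. \<exists>w\<in>V. \<exists>t t'. y1 \<in> returns N (fun_upd (fun_upd (?\<zeta> \<omega>) u t) w t') L"
      unfolding vis_def by (intro connect_crossings[OF rng y(3) _ refl refl]) (use s in \<open>auto simp: V_def\<close>)
    then obtain u w t t' where uw: "u \<in> V" "w \<in> V" "y1 \<in> returns N (?\<zeta> (fun_upd (fun_upd \<omega> u t) w t')) L"
      by (auto simp: override_upd)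
    let ?\<omega> = "fun_upd (fun_upd \<omega> u t) w t'"
    have "y1 \<notin> crossings N (?\<zeta> ?\<omega>) L"
      using uw(3) crossings_Int_returns[OF L(1), of N "?\<zeta> ?\<omega>"] by blast
    moreover have "crossings N (?\<zeta> ?\<omega>) L \<subseteq> crossings N (?\<zeta> ?\<omega>) s"
      by (rule crossings_mono[OF s L(2)])
    moreover have "crossings N (?\<zeta> ?\<omega>) s = crossings N \<eta> s"
      by (rule crossings_cong) (auto simp: override_def V_def)
    ultimately have "card (crossings N (?\<zeta> ?\<omega>) L) < card (crossings N \<eta> s)"
      using y(1) by (intro psubset_card_mono) auto
    then have "?\<omega> \<in> ?D" by simp
    then show "\<omega> \<in> (\<Union>(u, w, t, t')\<in>V \<times> V \<times> UNIV \<times> UNIV. {\<omega>. fun_upd (fun_upd \<omega> u t) w t' \<in> ?D})"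
      using uw(1,2) by blast
  qed
  then have "?P {\<omega>. K \<omega> \<and> F \<omega> \<omega>} \<le> ?P \<dots>"
    by (intro measure_pmf.finite_measure_mono) auto
  also have "\<dots> \<le> (\<Sum>(u, w, t, t')\<in>V \<times> V \<times> (UNIV :: site set) \<times> (UNIV :: site set). ?P {\<omega>. fun_upd (fun_upd \<omega> u t) w t' \<in> ?D})"
    unfolding case_prod_beta
    by (intro measure_pmf.finite_measure_subadditive_finite) (auto simp: finV UNIV_site)
  also have "\<dots> \<le> (\<Sum>(u, w, t, t')\<in>V \<times> V \<times> (UNIV :: site set) \<times> (UNIV :: site set). ?P ?D / \<kappa>\<^sup>2)"
  proof (intro sum_mono)
    fix x :: "vertex \<times> vertex \<times> site \<times> site" assume "x \<in> V \<times> V \<times> UNIV \<times> UNIV"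
    then obtain u w t t' where x: "x = (u, w, t, t')" "u \<in> V" "w \<in> V" by auto
    have "?P {\<omega>. fun_upd (fun_upd \<omega> u t) w t' \<in> ?D} \<le> ?P ?D / \<kappa>\<^sup>2"
      using prob_change_two_sites[OF finV x(2,3) \<kappa>, of t t' ?D] \<kappa>(1) by (simp add: field_simps)
    then show "(case x of (u, w, t, t') \<Rightarrow> ?P {\<omega>. fun_upd (fun_upd \<omega> u t) w t' \<in> ?D})
        \<le> (case x of (u, w, t, t') \<Rightarrow> ?P ?D / \<kappa>\<^sup>2)"
      by (simp add: x)
  qed
  also have "\<dots> = real (card V * (card V * 9)) * (?P ?D / \<kappa>\<^sup>2)"
    by (simp add: case_prod_beta card_cartesian_product UNIV_site)
  also have "real (card V * (card V * 9)) = 9 * (real_of_int (2 * N + 1) * real_of_int N)\<^sup>2"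
    using N by (simp add: V_def L_def card_cartesian_product power2_eq_square)
  finally have main: "c * ?P {\<omega>. K \<omega>} \<le> 9 * (real_of_int (2 * N + 1) * real_of_int N)\<^sup>2 * (?P ?D / \<kappa>\<^sup>2)" .
  have notK: "1 - ?P {\<omega>. K \<omega>} \<le> ?P ?D"
  proof -
    have "1 - ?P {\<omega>. K \<omega>} = ?P (- {\<omega>. K \<omega>})"
      using measure_pmf.prob_compl[of "{\<omega>. K \<omega>}" "env p V"] by (simp add: Compl_eq_Diff_UNIV)
    also have "\<dots> \<le> ?P ?D"
    proof (intro measure_pmf.finite_measure_mono subsetI)
      fix \<omega> assume "\<omega> \<in> - {\<omega>. K \<omega>}"
      then have "y1 \<notin> crossings N (?\<zeta> \<omega>) L \<or> y2 \<notin> crossings N (?\<zeta> \<omega>) L" by (simp add: K_def)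
      moreover have "crossings N (?\<zeta> \<omega>) L \<subseteq> crossings N (?\<zeta> \<omega>) s"
        by (rule crossings_mono[OF s L(2)])
      moreover have "crossings N (?\<zeta> \<omega>) s = crossings N \<eta> s"
        by (rule crossings_cong) (auto simp: override_def V_def)
      ultimately show "\<omega> \<in> ?D"
        using y(1,2) by (auto intro!: psubset_card_mono)
    qed simp
    finally show ?thesis .
  qed
  have q: "drop_bound \<kappa> N \<le> 1 / 2"
  proof -
    have "\<kappa> \<le> 1" using \<kappa>(2)[of No_Mirror] pmf_le_1[of "site_law p" No_Mirror] by linarith
    then have "\<kappa>\<^sup>2 \<le> 1" using \<kappa>(1) by (simp add: power_le_one)
    moreover define Q where "Q = real_of_int (2 * N + 1) ^ 3 * (real_of_int N)\<^sup>2"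
    have "1 \<le> Q"
      using N mult_mono[of 1 "real_of_int (2 * N + 1) ^ 3" 1 "(real_of_int N)\<^sup>2"]
      by (simp add: Q_def one_le_power)
    moreover have "drop_bound \<kappa> N = \<kappa>\<^sup>2 / (144 * Q)"
      by (simp add: drop_bound_def Q_def mult.assoc)
    ultimately show ?thesis
      by (simp add: divide_le_eq)
  qed
  \<comment> \<open>If both crossings survive with probability below 1/2, a drop is likely anyway;
    otherwise the surgery applies. The factor 2 lost here completes 144 = 2 * 8 * 9 in
    \<open>drop_bound\<close>.\<close>
  show ?thesis
  proof (cases "?P {\<omega>. K \<omega>} \<ge> 1 / 2")
    case True
    have "c * (1 / 2) \<le> c * ?P {\<omega>. K \<omega>}"
      using True N by (intro mult_left_mono) (simp_all add: c_def)
    also note main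
    finally have le: "c * (1 / 2) \<le> 9 * (real_of_int (2 * N + 1) * real_of_int N)\<^sup>2 * (?P ?D / \<kappa>\<^sup>2)" .
    define Q where "Q = 9 * (real_of_int (2 * N + 1) * real_of_int N)\<^sup>2"
    have "0 < Q" using N by (simp add: Q_def)
    then have "c * (1 / 2) * \<kappa>\<^sup>2 / Q \<le> ?P ?D"
      using le[folded Q_def] \<kappa>(1) by (simp add: divide_simps mult.commute mult.left_commute)
    moreover have "c * (1 / 2) * \<kappa>\<^sup>2 / Q = drop_bound \<kappa> N"
      by (simp add: c_def Q_def drop_bound_def power2_eq_square power3_eq_cube)
    ultimately show ?thesis by simp
  next
    case False
    then show ?thesis using notK q by linarith
  qed
qed

section \<open>Decay of the number of crossings\<close>

definition slab :: "int \<Rightarrow> int \<Rightarrow> int \<Rightarrow> vertex set" where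
  "slab N a b = {a..b} \<times> {0..<N}"

lemma two_crossings:
  assumes "crossings m \<omega> L \<noteq> {}" "even m" "0 \<le> m" "0 \<le> L"
  obtains y1 y2 where "y1 \<in> crossings m \<omega> L" "y2 \<in> crossings m \<omega> L" "y1 \<noteq> y2"
proof -
  have "even (card (crossings m \<omega> L))" using card_crossings_parity assms by blast
  moreover have "card (crossings m \<omega> L) \<noteq> 0" using assms(1) by simp
  ultimately have "2 \<le> card (crossings m \<omega> L)" by (cases "card (crossings m \<omega> L)") (auto elim: oddE)
  then obtain S where "S \<subseteq> crossings m \<omega> L" "card S = 2"
    by (meson obtain_subset_with_card_n)
  then show ?thesis using that by (metis card_2_iff insert_subset)
qed

text \<open>\<open>2\<^sup>X\<close> on \<open>X > 0\<close>, for the number \<open>X\<close> of crossings, is a supermartingale along the blocks.\<close>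

definition weight :: "int set \<Rightarrow> real" where
  "weight A = (if A = {} then 0 else 2 ^ card A)"

text \<open>With \<eta> fixed on the columns up to \<open>s\<close>, a block can only lose
  crossings, and losing one at least halves the weight. If \<open>P\<close> is the probability of a
  loss, the mean shrinks by the factor \<open>1 - P / 2\<close>.\<close>

lemma weight_block:
  fixes N s :: int
  defines "L \<equiv> s + (2 * N + 1)"
  assumes N: "0 < N" "even N" and s: "0 \<le> s" and p: "0 \<le> p" "p \<le> 1"
    and \<kappa>: "0 < \<kappa>" "\<And>t. \<kappa> \<le> pmf (site_law p) t"
  shows "(\<integral>\<^sup>+\<omega>. ennreal (weight (crossings N (override (slab N (s + 1) L) \<eta> \<omega>) L)) \<partial>env p (slab N (s + 1) L))
    \<le> ennreal ((1 - drop_bound \<kappa> N / 2) * weight (crossings N \<eta> s))"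
proof -
  let ?V = "slab N (s + 1) L"
  let ?X = "\<lambda>\<omega>. crossings N (override ?V \<eta> \<omega>) L"
  let ?A = "crossings N \<eta> s"
  have sub: "?X \<omega> \<subseteq> ?A" for \<omega>
  proof -
    have "?X \<omega> \<subseteq> crossings N (override ?V \<eta> \<omega>) s"
      by (rule crossings_mono) (use N s in \<open>auto simp: L_def\<close>)
    also have "\<dots> = ?A" by (rule crossings_cong) (auto simp: override_def slab_def)
    finally show ?thesis .
  qed
  show ?thesis
  proof (cases "?A = {}")
    case True
    then have "?X \<omega> = {}" for \<omega> using sub by blast
    then show ?thesis by (simp add: weight_def)
  next
    case False
    obtain y1 y2 where y: "y1 \<in> ?A" "y2 \<in> ?A" "y1 \<noteq> y2"
      by (rule two_crossings[OF False N(2) _ s]) (use N in auto)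
    define D where "D = {\<omega>. card (?X \<omega>) < card ?A}"
    define P where "P = measure_pmf.prob (env p ?V) D"
    have drop: "drop_bound \<kappa> N \<le> P"
      using block_drops_crossings[OF N(1) s p \<kappa> y] unfolding P_def D_def slab_def L_def .
    have P1: "0 \<le> P" "P \<le> 1" by (simp_all add: P_def)
    define r where "r = card ?A"
    have r: "r \<noteq> 0" using False by (simp add: r_def)
    have w: "weight (?X \<omega>) \<le> 2 ^ r * (1 - indicator D \<omega> / 2)" for \<omega>
    proof (cases "\<omega> \<in> D")
      case True
      then have "card (?X \<omega>) \<le> r - 1" by (auto simp: D_def r_def)
      then have "weight (?X \<omega>) \<le> 2 ^ (r - 1)"
        by (simp add: weight_def power_increasing)
      also have "(2 :: real) ^ (r - 1) = 2 ^ r / 2" using r by (cases r) simp_all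
      finally show ?thesis using True by simp
    next
      case False
      have "card (?X \<omega>) \<le> r" unfolding r_def by (rule card_mono[OF finite_crossings sub])
      then show ?thesis using False by (simp add: weight_def power_increasing)
    qed
    have "(\<integral>\<^sup>+\<omega>. ennreal (weight (?X \<omega>)) \<partial>env p ?V)
        \<le> (\<integral>\<^sup>+\<omega>. ennreal (2 ^ r / 2) * indicator D \<omega> + ennreal (2 ^ r) * indicator (- D) \<omega> \<partial>env p ?V)"
    proof (rule nn_integral_mono)
      fix \<omega>
      show "ennreal (weight (?X \<omega>)) \<le> ennreal (2 ^ r / 2) * indicator D \<omega> + ennreal (2 ^ r) * indicator (- D) \<omega>"
        using w[of \<omega>] by (cases "\<omega> \<in> D") (simp_all add: ennreal_leI)
    qed
    also have "\<dots> = ennreal (2 ^ r / 2) * ennreal P + ennreal (2 ^ r) * ennreal (1 - P)"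
      using measure_pmf.prob_compl[of D "env p ?V"]
      by (simp add: nn_integral_add nn_integral_cmult_indicator measure_pmf.emeasure_eq_measure P_def Compl_eq_Diff_UNIV)
    also have "\<dots> = ennreal (2 ^ r / 2 * P) + ennreal (2 ^ r * (1 - P))"
      by (intro arg_cong2[where f = "(+)"] ennreal_mult[symmetric]) (use P1 in auto)
    also have "\<dots> = ennreal (2 ^ r / 2 * P + 2 ^ r * (1 - P))"
      by (rule ennreal_plus[symmetric]) (use P1 in auto)
    also have "\<dots> \<le> ennreal ((1 - drop_bound \<kappa> N / 2) * weight ?A)"
    proof (rule ennreal_leI)
      have "2 ^ r / 2 * P + 2 ^ r * (1 - P) = (1 - P / 2) * 2 ^ r" by (simp add: field_simps)
      also have "\<dots> \<le> (1 - drop_bound \<kappa> N / 2) * 2 ^ r"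
        using drop by (intro mult_right_mono) auto
      finally show "2 ^ r / 2 * P + 2 ^ r * (1 - P) \<le> (1 - drop_bound \<kappa> N / 2) * weight ?A"
        using False by (simp add: weight_def r_def)
    qed
    finally show ?thesis .
  qed
qed

lemma drop_bound_range:
  assumes "0 < N" "0 < \<kappa>" "\<kappa> \<le> 1"
  shows "0 < drop_bound \<kappa> N" "drop_bound \<kappa> N \<le> 1"
proof -
  show "0 < drop_bound \<kappa> N" using assms by (simp add: drop_bound_def)
  have "\<kappa>\<^sup>2 \<le> 1" using assms by (simp add: power_le_one)
  moreover have "1 \<le> 144 * real_of_int (2 * N + 1) ^ 3 * (real_of_int N)\<^sup>2"
  proof -
    have "1 * 1 \<le> (144 * real_of_int (2 * N + 1) ^ 3) * (real_of_int N)\<^sup>2"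
    proof (rule mult_mono)
      have "1 \<le> real_of_int (2 * N + 1) ^ 3" using assms by (intro one_le_power) simp
      then show "1 \<le> 144 * real_of_int (2 * N + 1) ^ 3" by linarith
    qed (use assms in \<open>simp_all add: one_le_power\<close>)
    then show ?thesis by simp
  qed
  ultimately show "drop_bound \<kappa> N \<le> 1"
    unfolding drop_bound_def by (subst divide_le_eq_1) linarith
qed

text \<open>The weight is at least 1 as long as a crossing exists, so Markov's inequality applies.
  The factor \<open>2 ^ nat N\<close> is the weight at \<open>L = 0\<close>, where all
  \<open>N\<close> entries cross.\<close>

theorem prob_crossing_decays:
  fixes N :: int
  assumes N: "0 < N" "even N" and p: "0 \<le> p" "p \<le> 1"
    and \<kappa>: "0 < \<kappa>" "\<And>t. \<kappa> \<le> pmf (site_law p) t"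
  shows "measure_pmf.prob (env p (slab N 1 (int k * (2 * N + 1))))
      {\<omega>. crossings N \<omega> (int k * (2 * N + 1)) \<noteq> {}}
    \<le> 2 ^ nat N * (1 - drop_bound \<kappa> N / 2) ^ k"
proof -
  define q where "q = 1 - drop_bound \<kappa> N / 2"
  have "\<kappa> \<le> 1" using \<kappa>(2)[of No_Mirror] pmf_le_1[of "site_law p" No_Mirror] by linarith
  then have q: "0 \<le> q" using drop_bound_range[OF N(1) \<kappa>(1)] by (simp add: q_def)
  define W where "W k = slab N 1 (int k * (2 * N + 1))" for k
  define \<phi> where "\<phi> k \<omega> = ennreal (weight (crossings N \<omega> (int k * (2 * N + 1))))" for k \<omega>
  have fin: "finite (slab N a b)" for a b by (simp add: slab_def)
  have "(\<integral>\<^sup>+\<omega>. \<phi> k \<omega> \<partial>env p (W k)) \<le> ennreal (2 ^ nat N * q ^ k)"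
  proof (induction k)
    case 0
    have "weight (crossings N \<omega> 0) \<le> 2 ^ nat N" for \<omega>
      using card_mono[OF _ crossings_subset[of N \<omega> 0]] by (simp add: weight_def power_increasing)
    then have "(\<integral>\<^sup>+\<omega>. \<phi> 0 \<omega> \<partial>env p (W 0)) \<le> (\<integral>\<^sup>+\<omega>. ennreal (2 ^ nat N) \<partial>env p (W 0))"
      by (intro nn_integral_mono) (simp add: \<phi>_def ennreal_leI)
    then show ?case by (simp add: measure_pmf.emeasure_space_1)
  next
    case (Suc k)
    define s where "s = int k * (2 * N + 1)"
    define L where "L = s + (2 * N + 1)"
    have Suc_L: "int (Suc k) * (2 * N + 1) = L" by (simp add: L_def s_def algebra_simps)
    have s: "0 \<le> s" using N by (simp add: s_def)
    let ?V = "slab N (s + 1) L"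
    have W: "W (Suc k) = W k \<union> ?V" "W k \<inter> ?V = {}"
      unfolding W_def Suc_L s_def[symmetric] using s N by (auto simp: slab_def L_def)
    have env: "env p (W (Suc k)) = map_pmf (\<lambda>(f, g) x. if x \<in> W k then f x else g x) (pair_pmf (env p (W k)) (env p ?V))"
      unfolding env_def W(1) by (rule Pi_pmf_union) (use W(2) fin in \<open>auto simp: W_def\<close>)
    have cong: "crossings N (\<lambda>x. if x \<in> W k then f x else g x) L = crossings N (override ?V f g) L" for f g
    proof (rule crossings_cong)
      fix v assume "v \<in> {1..L} \<times> {0..<N}"
      then have "v \<in> W k \<union> ?V" unfolding W_def s_def[symmetric] by (auto simp: slab_def)
      then show "(if v \<in> W k then f v else g v) = override ?V f g v"
        using W(2) by (auto simp: override_def)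
    qed
    have "(\<integral>\<^sup>+\<omega>. \<phi> (Suc k) \<omega> \<partial>env p (W (Suc k)))
        = (\<integral>\<^sup>+f. \<integral>\<^sup>+g. ennreal (weight (crossings N (override ?V f g) L)) \<partial>env p ?V \<partial>env p (W k))"
      unfolding env \<phi>_def Suc_L by (simp add: nn_integral_pair_pmf' cong)
    also have "\<dots> \<le> (\<integral>\<^sup>+f. ennreal q * \<phi> k f \<partial>env p (W k))"
    proof (intro nn_integral_mono)
      fix f
      have "(\<integral>\<^sup>+g. ennreal (weight (crossings N (override ?V f g) L)) \<partial>env p ?V) \<le> ennreal (q * weight (crossings N f s))"
        using weight_block[OF N s p \<kappa>] unfolding L_def q_def .
      also have "\<dots> = ennreal q * \<phi> k f"
        using q by (simp add: \<phi>_def s_def ennreal_mult weight_def)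
      finally show "(\<integral>\<^sup>+g. ennreal (weight (crossings N (override ?V f g) L)) \<partial>env p ?V) \<le> ennreal q * \<phi> k f" .
    qed
    also have "\<dots> = ennreal q * (\<integral>\<^sup>+f. \<phi> k f \<partial>env p (W k))"
      by (rule nn_integral_cmult) simp
    also have "\<dots> \<le> ennreal q * ennreal (2 ^ nat N * q ^ k)"
      by (intro mult_left_mono Suc) simp
    also have "\<dots> = ennreal (2 ^ nat N * q ^ Suc k)"
      using q by (simp add: ennreal_mult[symmetric] mult_ac)
    finally show ?case .
  qed
  moreover have "ennreal (measure_pmf.prob (env p (W k)) {\<omega>. crossings N \<omega> (int k * (2 * N + 1)) \<noteq> {}})
      \<le> (\<integral>\<^sup>+\<omega>. \<phi> k \<omega> \<partial>env p (W k))"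
  proof -
    have "ennreal (measure_pmf.prob (env p (W k)) {\<omega>. crossings N \<omega> (int k * (2 * N + 1)) \<noteq> {}})
        = (\<integral>\<^sup>+\<omega>. indicator {\<omega>. crossings N \<omega> (int k * (2 * N + 1)) \<noteq> {}} \<omega> \<partial>env p (W k))"
      by (simp add: measure_pmf.emeasure_eq_measure)
    also have "\<dots> \<le> (\<integral>\<^sup>+\<omega>. \<phi> k \<omega> \<partial>env p (W k))"
    proof (intro nn_integral_mono)
      fix \<omega>
      have "1 \<le> (2 :: real) ^ j" for j by simp
      then show "indicator {\<omega>. crossings N \<omega> (int k * (2 * N + 1)) \<noteq> {}} \<omega> \<le> \<phi> k \<omega>"
        by (auto simp: \<phi>_def weight_def ennreal_1[symmetric] simp del: ennreal_1 split: split_indicator intro!: ennreal_leI)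
    qed
    finally show ?thesis .
  qed
  ultimately have "ennreal (measure_pmf.prob (env p (W k)) {\<omega>. crossings N \<omega> (int k * (2 * N + 1)) \<noteq> {}})
      \<le> ennreal (2 ^ nat N * q ^ k)"
    by (rule order_trans[rotated])
  then show ?thesis
    using q unfolding W_def q_def by (subst (asm) ennreal_le_iff) auto
qed

section \<open>Localization\<close>

text \<open>Only finitely many environments live on \<open>V\<close>, so the event is a finite union
  of cylinder sets, and the product measure of each is a point mass of
  \<open>env p V\<close>.\<close>

lemma prob_lorentz_law_restrict:
  assumes fin: "finite V" and V: "V \<subseteq> cylinder n"
  shows "measure (lorentz_law p n) {\<omega> \<in> space (lorentz_law p n). pull V id id \<omega> \<in> E} = measure_pmf.prob (env p V) E"
    and "{\<omega> \<in> space (lorentz_law p n). pull V id id \<omega> \<in> E} \<in> sets (lorentz_law p n)"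
proof -
  let ?M = "lorentz_law p n"
  let ?I = "cylinder n"
  define S where "S = {\<sigma> :: vertex \<Rightarrow> site. \<forall>v. v \<notin> V \<longrightarrow> \<sigma> v = No_Mirror}"
  define A where "A \<sigma> = {\<omega> \<in> space ?M. pull V id id \<omega> = \<sigma>}" for \<sigma>
  have A_emb: "A \<sigma> = prod_emb ?I (\<lambda>_. measure_pmf (site_law p)) V (\<Pi>\<^sub>E v\<in>V. {\<sigma> v})" if "\<sigma> \<in> S" for \<sigma>
    using that unfolding A_def lorentz_law_def
    by (auto simp: prod_emb_def space_PiM pull_def fun_eq_iff S_def PiE_iff restrict_def extensional_def)
  have A_sets: "A \<sigma> \<in> sets ?M" if "\<sigma> \<in> S" for \<sigma>
    unfolding A_emb[OF that] lorentz_law_def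
    by (rule sets_PiM_I[OF fin V]) simp
  have A_measure: "measure ?M (A \<sigma>) = pmf (env p V) \<sigma>" if \<sigma>: "\<sigma> \<in> S" for \<sigma>
  proof -
    have "emeasure ?M (A \<sigma>) = (\<Prod>v\<in>V. emeasure (measure_pmf (site_law p)) {\<sigma> v})"
      unfolding A_emb[OF \<sigma>] lorentz_law_def
      by (rule emeasure_PiM_emb[OF _ V fin]) (auto intro: measure_pmf.prob_space_axioms)
    also have "\<dots> = ennreal (\<Prod>v\<in>V. pmf (site_law p) (\<sigma> v))"
      by (simp add: emeasure_pmf_single prod_ennreal)
    also have "(\<Prod>v\<in>V. pmf (site_law p) (\<sigma> v)) = pmf (env p V) \<sigma>"
      unfolding env_def using \<sigma> by (intro pmf_Pi'[OF fin, symmetric]) (auto simp: S_def)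
    finally show ?thesis by (simp add: measure_def)
  qed
  have finS: "finite S"
  proof -
    have "finite (UNIV :: site set)" by (simp add: UNIV_site)
    then have "finite (PiE_dflt V No_Mirror (\<lambda>_. UNIV :: site set))"
      by (intro finite_PiE_dflt fin)
    moreover have "S \<subseteq> PiE_dflt V No_Mirror (\<lambda>_. UNIV)" by (auto simp: S_def PiE_dflt_def)
    ultimately show ?thesis by (rule rev_finite_subset)
  qed
  have union: "{\<omega> \<in> space ?M. pull V id id \<omega> \<in> E} = (\<Union>\<sigma>\<in>S \<inter> E. A \<sigma>)"
    by (auto simp: A_def S_def pull_def)
  show "{\<omega> \<in> space ?M. pull V id id \<omega> \<in> E} \<in> sets ?M"
    unfolding union by (rule sets.finite_UN) (use finS A_sets in auto)
  interpret prob_space ?M by (rule prob_space_lorentz_law)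
  have "measure ?M {\<omega> \<in> space ?M. pull V id id \<omega> \<in> E} = (\<Sum>\<sigma>\<in>S \<inter> E. measure ?M (A \<sigma>))"
    unfolding union
    by (rule finite_measure_finite_Union) (use finS A_sets in \<open>auto simp: disjoint_family_on_def A_def\<close>)
  also have "\<dots> = (\<Sum>\<sigma>\<in>S \<inter> E. pmf (env p V) \<sigma>)"
    by (intro sum.cong refl A_measure) auto
  also have "\<dots> = measure_pmf.prob (env p V) (S \<inter> E)"
    using finS by (intro measure_measure_pmf_finite[symmetric]) auto
  also have "\<dots> = measure_pmf.prob (env p V) E"
  proof -
    have "set_pmf (env p V) \<subseteq> S"
      unfolding env_def S_def by (rule set_Pi_pmf_subset[OF fin])
    then have "S \<inter> E \<inter> set_pmf (env p V) = E \<inter> set_pmf (env p V)" by auto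
    then show ?thesis by (metis measure_Int_set_pmf)
  qed
  finally show "measure ?M {\<omega> \<in> space ?M. pull V id id \<omega> \<in> E} = measure_pmf.prob (env p V) E" .
qed

text \<open>After its last visit to the columns at most 0, the ray leaves column 0 by an entry edge
  and reaches column \<open>L + 1\<close> without coming back; this part is a crossing.\<close>

lemma crossing_if_escapes:
  assumes e: "valid m e" "fst (fst e) = 0" and L: "0 \<le> L" and m: "0 < m"
    and escape: "L + 1 \<le> fst (fst (ray m \<omega> e j))"
  shows "crossings m \<omega> L \<noteq> {}"
proof -
  let ?x = "\<lambda>i. fst (fst (ray m \<omega> e i))"
  define I where "I = {i. i < j \<and> ?x i \<le> 0}"
  have "j \<noteq> 0" using e escape L by (intro notI) simp
  then have I: "finite I" "0 \<in> I" using e by (auto simp: I_def)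
  define i where "i = Max I"
  have i: "i < j" "?x i \<le> 0"
    using Max_in[of I] I unfolding i_def I_def by blast+
  have pos: "1 \<le> ?x q" if "i < q" "q \<le> j" for q
  proof (rule ccontr)
    assume "\<not> 1 \<le> ?x q"
    moreover then have "q \<noteq> j" using escape L by auto
    ultimately have "q \<in> I" using that by (auto simp: I_def)
    then show False using Max_ge[OF I(1)] that(1) by (force simp: i_def)
  qed
  obtain x y d where r: "ray m \<omega> e i = ((x, y), d)" by (metis surj_pair)
  have "1 \<le> fst (nbr m (x, y) d)" "x \<le> 0"
    using pos[of "Suc i"] i r by (simp_all add: target_def)
  then have xd: "x = 0" "d = East" by (cases d; simp)+
  have y: "y \<in> {0..<m}"
    using valid_range[OF valid_ray[OF e(1)] m, of \<omega> i] r by simp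
  have c: "col m \<omega> y q = ?x (i + Suc q)" for q
    unfolding col_def fst_ray_Suc[symmetric] ray_add[of m \<omega> e i "Suc q"] r xd ..
  define k where "k = (LEAST q. L + 1 \<le> col m \<omega> y q)"
  have ex: "L + 1 \<le> col m \<omega> y (j - Suc i)" using c[of "j - Suc i"] escape i by simp
  then have k: "L + 1 \<le> col m \<omega> y k" "k \<le> j - Suc i"
    unfolding k_def by (rule LeastI, rule Least_le)
  have lt: "col m \<omega> y q \<le> L" if "q < k" for q
    using that not_less_Least[of q "\<lambda>q. L + 1 \<le> col m \<omega> y q"] unfolding k_def by simp
  have "col m \<omega> y q \<in> {1..L}" if "q < k" for q
    using lt[OF that] pos[of "i + Suc q"] c[of q] that k(2) by simp
  moreover have "col m \<omega> y k = L + 1"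
  proof (cases k)
    case 0
    then show ?thesis using k L by simp
  next
    case (Suc q)
    then show ?thesis using k(1) lt[of q] col_step[of m \<omega> y q] by simp
  qed
  ultimately have "y \<in> crossings m \<omega> L"
    using y unfolding crossings_def exits_at_def by blast
  then show ?thesis by blast
qed

text \<open>Reflection in column 0 turns escapes to the left into escapes to the right, so that
  crossings from left to right cover both.\<close>

definition mirror_vertex :: "vertex \<Rightarrow> vertex" where
  "mirror_vertex v = (- fst v, snd v)"

fun mirror_dir :: "direction \<Rightarrow> direction" where
  "mirror_dir East = West"
| "mirror_dir West = East"
| "mirror_dir North = North"
| "mirror_dir South = South"

definition mirror_env :: "(vertex \<Rightarrow> site) \<Rightarrow> vertex \<Rightarrow> site" where
  "mirror_env \<omega> v = swap_site (\<omega> (mirror_vertex v))"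

lemma ray_mirror:
  "ray m (mirror_env \<omega>) (mirror_vertex (fst e), mirror_dir (snd e)) i
     = (mirror_vertex (fst (ray m \<omega> e i)), mirror_dir (snd (ray m \<omega> e i)))"
proof (rule ray_transport[of mirror_dir swap_site i])
  show "opposite (mirror_dir d) = mirror_dir (opposite d)" for d by (cases d) auto
  show "paired (swap_site s) (mirror_dir d) = mirror_dir (paired s d)" for s d
    by (cases s; cases d) auto
  show "target m (mirror_vertex (fst (ray m \<omega> e j)), mirror_dir (snd (ray m \<omega> e j)))
      = mirror_vertex (target m (ray m \<omega> e j))" for j
    by (cases "ray m \<omega> e j" rule: prod.exhaust; cases "fst (ray m \<omega> e j)"; cases "snd (ray m \<omega> e j)")
      (auto simp: target_def mirror_vertex_def)
qed (simp_all add: mirror_env_def mirror_vertex_def)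

lemma remains_in_if_no_crossing:
  assumes "1 \<le> n" "0 \<le> L" "real_of_int L \<le> M"
    and no: "crossings (2 * int n) \<omega> L = {}" "crossings (2 * int n) (mirror_env \<omega>) L = {}"
    and e: "initial_vertex e \<in> {0} \<times> {0..<2 * int n}"
  shows "remains_in n \<omega> e {(x, y) \<in> cylinder n. - M \<le> real_of_int x \<and> real_of_int x \<le> M}"
proof -
  let ?N = "2 * int n"
  have N: "0 < ?N" using assms(1) by simp
  have e': "fst e \<in> {0} \<times> {0..<?N}" using e by (cases e) auto
  then have v: "valid ?N e" "fst (fst e) = 0" by (auto simp: valid_def)
  define e2 where "e2 = (mirror_vertex (fst e), mirror_dir (snd e))"
  have v2: "valid ?N e2" "fst (fst e2) = 0"
    using v by (simp_all add: e2_def valid_def mirror_vertex_def)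
  have "fst (ray ?N \<omega> e k) \<in> {(x, y) \<in> cylinder n. - M \<le> real_of_int x \<and> real_of_int x \<le> M}" for k
  proof -
    have "fst (fst (ray ?N \<omega> e k)) \<le> L"
      using crossing_if_escapes[OF v assms(2) N, of \<omega> k] no(1) by fastforce
    moreover have "- L \<le> fst (fst (ray ?N \<omega> e k))"
      using crossing_if_escapes[OF v2 assms(2) N, of "mirror_env \<omega>" k] no(2)
      unfolding e2_def ray_mirror by (fastforce simp: mirror_vertex_def)
    ultimately have "\<bar>real_of_int (fst (fst (ray ?N \<omega> e k)))\<bar> \<le> M"
      using assms(3) by linarith
    moreover have "snd (fst (ray ?N \<omega> e k)) \<in> {0..<?N}"
      by (rule valid_range[OF valid_ray[OF v(1)] N])
    ultimately show ?thesis
      by (cases "fst (ray ?N \<omega> e k)") (auto simp: cylinder_def abs_le_iff)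
  qed
  note inside = this
  have "initial_vertex (ray ?N \<omega> e k) = fst (ray ?N \<omega> e k)"
    "final_vertex n (ray ?N \<omega> e k) = fst (ray ?N \<omega> e (Suc k))" for k
    by (cases "ray ?N \<omega> e k"; simp add: target_def neighbour_eq_nbr)+
  then show ?thesis
    unfolding remains_in_def trajectory_eq_ray using inside by presburger
qed

text \<open>An escape to the left is a crossing in the reflected environment, which has the same
  law; hence the factor 2.\<close>

lemma localization_lower_bound:
  assumes n: "1 \<le> n" and L: "0 \<le> L" "real_of_int L \<le> M" and p: "0 \<le> p" "p \<le> 1"
  shows "1 - 2 * measure_pmf.prob (env p (slab (2 * int n) 1 L)) {\<omega>. crossings (2 * int n) \<omega> L \<noteq> {}}
    \<le> measure (lorentz_law p n) (localization_event p n M)"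
proof -
  let ?N = "2 * int n"
  define V where "V = slab ?N (- L) L"
  let ?S = "slab ?N 1 L"
  let ?P = "measure_pmf.prob (env p V)"
  define bad where "bad = {\<omega>. crossings ?N \<omega> L \<noteq> {}}"
  have fin: "finite V" by (simp add: V_def slab_def)
  have V: "V \<subseteq> cylinder n" by (auto simp: V_def slab_def cylinder_def)
  have right: "?P {\<omega>. \<omega> \<in> bad} = measure_pmf.prob (env p ?S) bad"
  proof -
    have "crossings ?N (pull ?S id id \<omega>) L = crossings ?N \<omega> L" for \<omega>
      by (rule crossings_cong) (simp add: pull_def slab_def)
    then have eq: "{\<omega>. \<omega> \<in> bad} = {\<omega>. pull ?S id id \<omega> \<in> bad}" by (simp add: bad_def)
    have "?S \<subseteq> V" by (auto simp: V_def slab_def)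
    then show ?thesis
      unfolding eq by (intro prob_pull[OF fin]) simp_all
  qed
  have left: "?P {\<omega>. mirror_env \<omega> \<in> bad} = measure_pmf.prob (env p ?S) bad"
  proof -
    have "crossings ?N (pull ?S mirror_vertex swap_site \<omega>) L = crossings ?N (mirror_env \<omega>) L" for \<omega>
      by (rule crossings_cong) (simp add: pull_def slab_def mirror_env_def)
    then have "{\<omega>. mirror_env \<omega> \<in> bad} = {\<omega>. pull ?S mirror_vertex swap_site \<omega> \<in> bad}" by (simp add: bad_def)
    moreover have "inj_on mirror_vertex ?S" by (auto simp: inj_on_def mirror_vertex_def)
    moreover have "mirror_vertex ` ?S \<subseteq> V" by (auto simp: V_def slab_def mirror_vertex_def)
    ultimately show ?thesis
      using prob_pull[OF fin, of mirror_vertex ?S swap_site p bad] map_swap_site_law[OF p] by simp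
  qed
  define good where "good = - ({\<omega>. \<omega> \<in> bad} \<union> {\<omega>. mirror_env \<omega> \<in> bad})"
  have "1 - 2 * measure_pmf.prob (env p ?S) bad \<le> 1 - ?P ({\<omega>. \<omega> \<in> bad} \<union> {\<omega>. mirror_env \<omega> \<in> bad})"
    using measure_Un_le[of "{\<omega>. \<omega> \<in> bad}" "env p V" "{\<omega>. mirror_env \<omega> \<in> bad}"] left right
    by simp
  also have "\<dots> = ?P good"
    using measure_pmf.prob_compl[of "{\<omega>. \<omega> \<in> bad} \<union> {\<omega>. mirror_env \<omega> \<in> bad}" "env p V"]
    by (simp add: good_def Compl_eq_Diff_UNIV)
  also have "\<dots> = measure (lorentz_law p n) {\<omega> \<in> space (lorentz_law p n). pull V id id \<omega> \<in> good}"
    by (rule prob_lorentz_law_restrict(1)[OF fin V, symmetric])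
  also have "\<dots> \<le> measure (lorentz_law p n) (localization_event p n M)"
  proof -
    interpret prob_space "lorentz_law p n" by (rule prob_space_lorentz_law)
    show ?thesis
    proof (rule finite_measure_mono[OF _ localization_event_measurable], rule subsetI)
      fix \<omega> assume \<omega>: "\<omega> \<in> {\<omega> \<in> space (lorentz_law p n). pull V id id \<omega> \<in> good}"
      have "crossings ?N (pull V id id \<omega>) L = crossings ?N \<omega> L"
        by (rule crossings_cong) (auto simp: pull_def V_def slab_def)
      moreover have "crossings ?N (mirror_env (pull V id id \<omega>)) L = crossings ?N (mirror_env \<omega>) L"
        by (rule crossings_cong) (auto simp: pull_def V_def slab_def mirror_env_def mirror_vertex_def)
      ultimately have "crossings ?N \<omega> L = {}" "crossings ?N (mirror_env \<omega>) L = {}"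
        using \<omega> by (auto simp: good_def bad_def)
      note stays = remains_in_if_no_crossing[OF n L this]
      have "\<omega> \<in> space (lorentz_law p n)" using \<omega> by simp
      then show "\<omega> \<in> localization_event p n M"
        unfolding localization_event_def by (intro CollectI conjI allI impI stays)
    qed
  qed
  finally show ?thesis unfolding bad_def .
qed

text \<open>The term \<open>n * 2\<close> comes from the initial weight. For \<open>M\<close> this
  large it is at most a third of \<open>M / (D * n ^ 6)\<close>, and a sixth of that quotient
  already exceeds the right-hand quotient; 1/3 + 1/6 is below 1.\<close>

lemma sum_of_exponents:
  fixes n M D C :: real
  assumes n: "1 \<le> n" and D: "1 \<le> D" and M: "6 * D * n ^ 10 \<le> M"
  shows "n * 2 - M / (D * n ^ 6) \<le> - (M / (6 * D * n ^ 10))"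
proof -
  have n6: "1 \<le> n ^ 6" and n46: "n ^ 6 \<le> n ^ 10" and n1: "n \<le> n ^ 4"
    using n power_increasing[of 6 10 n] power_increasing[of 1 4 n] by (simp_all add: one_le_power)
  have "0 \<le> M" using M D n6 n46 by (smt (verit) mult_nonneg_nonneg)
  have "n * 2 \<le> M / (3 * D * n ^ 6)"
  proof -
    have "n * 2 * (3 * D * n ^ 6) \<le> n ^ 4 * 2 * (3 * D * n ^ 6)"
      using n1 D n6 by (intro mult_right_mono) auto
    also have "\<dots> = 6 * D * n ^ 10" by (simp flip: power_add)
    also have "\<dots> \<le> M" by (rule M)
    finally show ?thesis using D n6 by (subst pos_le_divide_eq) (auto intro!: mult_pos_pos)
  qed
  moreover have "M / (6 * D * n ^ 10) \<le> M / (6 * D * n ^ 6)"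
    using \<open>0 \<le> M\<close> D n6 n46 by (intro divide_left_mono mult_left_mono mult_pos_pos) auto
  moreover have "M / (3 * D * n ^ 6) + M / (6 * D * n ^ 6) \<le> M / (D * n ^ 6)"
  proof -
    have "M / (3 * D * n ^ 6) + M / (6 * D * n ^ 6) = (M / (D * n ^ 6)) / 2"
      by (simp add: field_simps)
    moreover have "0 \<le> M / (D * n ^ 6)" using \<open>0 \<le> M\<close> D n6 by simp
    ultimately show ?thesis by simp
  qed
  ultimately show ?thesis by linarith
qed

theorem corollary1p4:
  fixes p :: real
  assumes "0 < p" and "p < 1"
  shows "\<exists>(C::real) > 0. \<exists>n_star::nat. \<forall>n::nat. \<forall>M::real.
           n \<ge> 1 \<and> n \<ge> n_star \<and> M \<ge> 1 \<and> M \<ge> C * real n ^ 10 \<longrightarrow>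
             measure (lorentz_law p n) (localization_event p n M)
               \<ge> 1 - C * exp (- (M / (C * real n ^ 10)))"
proof -
  \<comment> \<open>The least probability of a site state, i.e. the price of prescribing one
    site.\<close>
  define \<kappa> where "\<kappa> = min (1 - p) (p / 2)"
  have \<kappa>: "0 < \<kappa>" "\<kappa> \<le> 1" using assms by (auto simp: \<kappa>_def)
  have \<kappa>_le: "\<kappa> \<le> pmf (site_law p) t" for t
    using assms by (cases t) (simp_all add: \<kappa>_def pmf_site_law min_def)
  \<comment> \<open>1440000 = 72000 * 2 * 10, from the bound \<open>q_ge\<close>, the halved rate in
    \<open>1 - q / 2\<close>, and the number \<open>M / (10 * r)\<close> of blocks. The 6 in
    \<open>C\<close> is that of \<open>sum_of_exponents\<close>.\<close>
  define D where "D = 1440000 / \<kappa>\<^sup>2"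
  have "\<kappa>\<^sup>2 \<le> 1" using \<kappa> by (simp add: power_le_one)
  then have D: "1440000 \<le> D"
    using \<kappa> by (simp add: D_def le_divide_eq)
  define C where "C = 6 * D"
  have C: "10 \<le> C" "0 < C" using D by (simp_all add: C_def)
  have "measure (lorentz_law p n) (localization_event p n M) \<ge> 1 - C * exp (- (M / (C * real n ^ 10)))"
    if n: "1 \<le> n" and M: "C * real n ^ 10 \<le> M" for n :: nat and M :: real
  proof -
    define N where "N = 2 * int n"
    have N: "0 < N" "even N" using n by (simp_all add: N_def)
    define r where "r = real n"
    have r: "1 \<le> r" using n by (simp add: r_def)
    define T where "T = 2 * N + 1"
    have T: "0 < T" "real_of_int T \<le> 5 * r" using n by (simp_all add: T_def N_def r_def)
    have r10: "r \<le> r ^ 10" using r power_increasing[of 1 10 r] by simp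
    have "10 * r \<le> C * r ^ 10" using r10 C r by (intro mult_mono) auto
    then have M10: "10 * r \<le> M" using M unfolding r_def by linarith
    define k where "k = nat \<lfloor>M / T\<rfloor>"
    have k0: "0 \<le> M / T" using M10 r T(1) by simp
    then have k: "real k \<le> M / T" "M / T - 1 \<le> real k"
      by (simp_all add: k_def)
    define L where "L = int k * T"
    have L: "0 \<le> L" "real_of_int L \<le> M"
      using T(1) k(1) by (simp_all add: L_def pos_le_divide_eq)
    \<comment> \<open>Rounding down costs one block, at most half of
      \<open>M / (5 * r)\<close>.\<close>
    have "M / (5 * r) \<le> M / T"
      using T M10 r by (intro divide_left_mono) auto
    moreover have "1 \<le> M / (10 * r)" using M10 r by simp
    moreover have "M / (5 * r) = M / (10 * r) + M / (10 * r)" using r by (simp add: field_simps)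
    ultimately have kM: "M / (10 * r) \<le> real k" using k(2) by linarith
    define q where "q = drop_bound \<kappa> N"
    have q: "0 < q" "q \<le> 1" using drop_bound_range[OF N(1) \<kappa>] by (simp_all add: q_def)
    have q_ge: "\<kappa>\<^sup>2 / (72000 * r ^ 5) \<le> q"
    proof -
      \<comment> \<open>72000 = 144 * 5^3 * 2^2, as \<open>T \<le> 5 * r\<close> and
        \<open>N = 2 * r\<close>.\<close>
      have "144 * real_of_int (2 * N + 1) ^ 3 * (real_of_int N)\<^sup>2 \<le> 144 * (5 * r) ^ 3 * (2 * r)\<^sup>2"
        using T r by (intro mult_mono power_mono) (auto simp: T_def N_def r_def)
      also have "\<dots> = 72000 * r ^ 5" by (simp add: power_mult_distrib flip: power_add)
      finally have "144 * real_of_int (2 * N + 1) ^ 3 * (real_of_int N)\<^sup>2 \<le> 72000 * r ^ 5" .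
      then show ?thesis
        unfolding q_def drop_bound_def using N by (intro divide_left_mono mult_pos_pos) (use r in auto)
    qed
    have "M / (D * r ^ 6) = (\<kappa>\<^sup>2 / (72000 * r ^ 5)) / 2 * (M / (10 * r))"
      using \<kappa>(1) r by (simp add: D_def divide_simps flip: power_Suc2)
    also have "\<dots> \<le> q / 2 * real k"
      using q_ge kM q M10 r by (intro mult_mono) auto
    finally have rate: "M / (D * r ^ 6) \<le> q / 2 * real k" .
    have "measure_pmf.prob (env p (slab N 1 L)) {\<omega>. crossings N \<omega> L \<noteq> {}} \<le> 2 ^ nat N * (1 - q / 2) ^ k"
      using prob_crossing_decays[OF N _ _ \<kappa>(1) \<kappa>_le, of k] assms by (simp add: L_def T_def q_def)
    also have "(1 - q / 2) ^ k \<le> exp (- (q / 2)) ^ k"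
      using q exp_ge_add_one_self[of "- (q / 2)"] by (intro power_mono) auto
    also have "exp (- (q / 2)) ^ k = exp (- (q / 2 * real k))"
      by (simp flip: exp_of_nat2_mult)
    also have "\<dots> \<le> exp (- (M / (D * r ^ 6)))" using rate by simp
    also have "(2 :: real) ^ nat N \<le> exp 1 ^ nat N"
      using exp_ge_add_one_self[of 1] by (intro power_mono) auto
    also have "exp 1 ^ nat N = exp (r * 2)"
      by (simp add: N_def r_def nat_mult_distrib mult.commute flip: exp_of_nat_mult)
    also have "exp (r * 2) * exp (- (M / (D * r ^ 6))) = exp (r * 2 - M / (D * r ^ 6))"
      by (simp flip: exp_add)
    also have "\<dots> \<le> exp (- (M / (C * r ^ 10)))"
      using sum_of_exponents[OF r, of D M] D M by (simp add: C_def r_def)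
    finally have bound: "measure_pmf.prob (env p (slab N 1 L)) {\<omega>. crossings N \<omega> L \<noteq> {}} \<le> exp (- (M / (C * r ^ 10)))"
      by (simp add: mult_right_mono)
    have "1 - C * exp (- (M / (C * r ^ 10))) \<le> 1 - 2 * exp (- (M / (C * r ^ 10)))"
      using C by simp
    also have "\<dots> \<le> 1 - 2 * measure_pmf.prob (env p (slab N 1 L)) {\<omega>. crossings N \<omega> L \<noteq> {}}"
      using bound by simp
    also have "\<dots> \<le> measure (lorentz_law p n) (localization_event p n M)"
      unfolding N_def by (rule localization_lower_bound[OF n L]) (use assms in auto)
    finally show ?thesis by (simp add: r_def)
  qed
  then show ?thesis using C by blast
qed

end
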